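(* Let $$\overline{\mathbb{L}}(v)=\mathrm{tr}_{1,\ldots,N}\,L_1^+(v)\,L_2^+(v-h)\cdots L_N^+(v-(N-1)h)\,\mathbf{1}\in V(R^{-})[[v]].$$ Then the braiding $\mathcal{S}(z)$ of $V(R^-)$ satisfies, for any $a\in V(R^{-})$, $$\mathcal{S}(z)(a\otimes\overline{\mathbb{L}}(v))=a\otimes\overline{\mathbb{L}}(v).$$
   Context: Fix an integer $N\geq 2$ and a formal parameter $h$. Tensor products over $\mathbb{C}[[h]]$ are $h$-adically completed. Expansion convention: $(a_1u_1+\cdots+a_nu_n)^r$ with $r<0$, nonzero $a_i\in\mathbb{C}$, is expanded in nonnegative powers of $u_2,\ldots,u_n$ (the same if the last variable is replaced by $h$). $R^{-}(u)=u(u+h)^{-1}(I-Phu^{-1})\in\mathrm{End}\,\mathbb{C}^N\otimes\mathrm{End}\,\mathbb{C}^N[[h/u]]$, with $I$ the identity and $P$ the permutation operator on $\mathbb{C}^N\otimes\mathbb{C}^N$. Subscripts indicate tensor factors. For $u=(u_1,\ldots,u_n)$, $v=(v_1,\ldots,v_m)$ and $R^-_{ij}=R^-_{ij}(z+u_i-v_{j-n})$ put $$R_{nm}^{-\,12}(z+u-v)=\prod_{i=1,\ldots,n}^{\longrightarrow}\ \prod_{j=n+1,\ldots,n+m}^{\longleftarrow}R^-_{ij},\qquad R_{nm}^{-\,\bar1\bar2}(z+u-v)=\prod_{i=1,\ldots,n}^{\longleftarrow}\ \prod_{j=n+1,\ldots,n+m}^{\longrightarrow}R^-_{ij},$$ where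 $\longrightarrow$ (resp. $\longleftarrow$) means factors are written from left to right in increasing (resp. decreasing) order of the index. $A(R^-)$ is the topologically free associative algebra over $\mathbb{C}[[h]]$ (topologically free: isomorphic to $V_0[[h]]$ as a module for some complex vector space $V_0$) generated by $l_{ij}^{(-r)}$, $r\ge1$, $i,j=1,\ldots,N$, subject to $R^-(-u+v)L_1^+(u)L_2^+(v)=L_2^+(v)L_1^+(u)R^-(u-v)$, where $L^+(u)=\sum_{i,j}e_{ij}\otimes l_{ij}^+(u)$, $l_{ij}^+(u)=\sum_{r\geq1}l_{ij}^{(-r)}u^{r-1}$, $e_{ij}$ matrix units; $L_k^+$ is the copy whose matrix part acts on the $k$-th factor. Let $\mathbf{1}$ be the unit of $A(R^-)$ and $L^+_{[n]}(u)=L^+_1(u_1)\cdots L^+_n(u_n)$. $V(R^-)$ is the quantum vertex algebra on the $\mathbb{C}[[h]]$-module $A(R^-)$ with vacuum $\mathbf{1}$ whose braiding is the $\mathbb{C}[[h]]$-module map $\mathcal{S}(z)\colon V(R^-)\otimes V(R^-)\to V(R^-)\otimes V(R^-)\otimes\mathbb{C}((z))[[h]]$ given for $n,m\ge1$ by $$\mathcal{S}(z)\big(L_{[n]}^{+13}(u)L_{[m]}^{+24}(v)(\mathbf{1}\otimes\mathbf{1})\big)=R_{nm}^{-\,\bar1\bar2}(z+u-v)L_{[n]}^{+13}(u)L_{[m]}^{+24}(v)R_{nm}^{-\,12}(z+u-v)^{-1}(\mathbf{1}\otimes\mathbf{1}),$$ with $\mathcal{S}(z)(\mathbf{1}\otimes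 a)=\mathbf{1}\otimes a$ and $\mathcal{S}(z)(a\otimes\mathbf{1})=a\otimes\mathbf{1}$ for all $a$; the superscripts $1,2,3,4$ refer to the factors of $(\mathrm{End}\,\mathbb{C}^N)^{\otimes n}\otimes(\mathrm{End}\,\mathbb{C}^N)^{\otimes m}\otimes V(R^-)\otimes V(R^-)$. $\mathrm{tr}_{1,\ldots,N}$ is the trace over the $N$ tensor factors $\mathrm{End}\,\mathbb{C}^N$, and $\mathcal{S}(z)$ is applied coefficientwise in $v$. *)

theory Defs
  imports
    Complex_Main
    "HOL-Library.Poly_Mapping"
    "HOL-Library.FuncSet"
    "HOL-Library.Cardinality"
    "HOL-Computational_Algebra.Formal_Laurent_Series"
begin

unbundle fps_syntax

section \<open>Modules over \<open>\<complex>[[h]]\<close>\<close>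

text \<open>
  The ring \<open>\<complex>[[h]]\<close> is \<^typ>\<open>complex fps\<close>, with \<open>h\<close> the series \<^term>\<open>fps_X :: complex fps\<close>.
  For a complex vector space \<open>V\<^sub>0\<close>, the topologically free module \<open>V\<^sub>0[[h]]\<close> is the type of
  power series in \<open>h\<close> with coefficients in \<open>V\<^sub>0\<close>.
\<close>

class complex_vec = ab_group_add +
  fixes cscale :: "complex \<Rightarrow> 'a \<Rightarrow> 'a"
  assumes cscale_add_right: "cscale c (x + y) = cscale c x + cscale c y"
    and cscale_add_left: "cscale (c + d) x = cscale c x + cscale d x"
    and cscale_cscale: "cscale c (cscale d x) = cscale (c * d) x"
    and cscale_one: "cscale 1 x = x"
begin

lemma cscale_zero_right [simp]: "cscale c 0 = 0"
  using cscale_add_right[of c 0 0] by simp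

lemma cscale_zero_left [simp]: "cscale 0 x = 0"
  using cscale_add_left[of 0 0 x] by simp

lemma cscale_sum_right: "cscale c (sum f A) = (\<Sum>a\<in>A. cscale c (f a))"
  by (induction A rule: infinite_finite_induct) (simp_all add: cscale_add_right)

lemma cscale_sum_left: "cscale (sum g A) x = (\<Sum>a\<in>A. cscale (g a) x)"
  by (induction A rule: infinite_finite_induct) (simp_all add: cscale_add_left)

end

class hmodule = ab_group_add +
  fixes hscale :: "complex fps \<Rightarrow> 'a \<Rightarrow> 'a"  (infixr \<open>*\<^sub>h\<close> 75)
  assumes hscale_add_right: "c *\<^sub>h (x + y) = c *\<^sub>h x + c *\<^sub>h y"
    and hscale_add_left: "(c + d) *\<^sub>h x = c *\<^sub>h x + d *\<^sub>h x"
    and hscale_hscale: "c *\<^sub>h (d *\<^sub>h x) = (c * d) *\<^sub>h x"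
    and hscale_one: "1 *\<^sub>h x = x"
begin

lemma hscale_zero_right [simp]: "c *\<^sub>h 0 = 0"
  using hscale_add_right[of c 0 0] by simp

lemma hscale_zero_left [simp]: "0 *\<^sub>h x = 0"
  using hscale_add_left[of 0 0 x] by simp

lemma hscale_minus_right: "c *\<^sub>h (- x) = - (c *\<^sub>h x)"
  using hscale_add_right[of c x "- x"] by (simp add: eq_neg_iff_add_eq_0 add.commute)

lemma hscale_diff_right: "c *\<^sub>h (x - y) = c *\<^sub>h x - c *\<^sub>h y"
  using hscale_add_right[of c x "- y"] by (simp add: hscale_minus_right)

end

definition hlinear :: "('a::hmodule \<Rightarrow> 'b::hmodule) \<Rightarrow> bool" where
  "hlinear f \<longleftrightarrow> (\<forall>x y. f (x + y) = f x + f y) \<and> (\<forall>c x. f (c *\<^sub>h x) = c *\<^sub>h f x)"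

instantiation complex :: complex_vec
begin
definition cscale_complex :: "complex \<Rightarrow> complex \<Rightarrow> complex" where
  "cscale_complex c x = c * x"
instance by standard (simp_all add: cscale_complex_def algebra_simps)
end

instantiation poly_mapping :: (type, complex_vec) complex_vec
begin
definition cscale_poly_mapping :: "complex \<Rightarrow> ('a \<Rightarrow>\<^sub>0 'b) \<Rightarrow> ('a \<Rightarrow>\<^sub>0 'b)" where
  "cscale_poly_mapping c p = Poly_Mapping.map (cscale c) p"

lemma lookup_cscale: "Poly_Mapping.lookup (cscale c p) k = cscale c (Poly_Mapping.lookup p k)"
  by (simp add: cscale_poly_mapping_def map.rep_eq when_def)

instance
  by standard
    (rule poly_mapping_eqI,
     simp add: lookup_cscale lookup_add cscale_add_right cscale_add_left cscale_cscale cscale_one)+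
end

instantiation fls :: (complex_vec) complex_vec
begin
definition cscale_fls :: "complex \<Rightarrow> 'a fls \<Rightarrow> 'a fls" where
  "cscale_fls c f = Abs_fls (\<lambda>n. cscale c (f $$ n))"

lemma fls_nth_cscale: "cscale c (f :: 'a fls) $$ n = cscale c (f $$ n)"
proof -
  have "\<forall>\<^sub>\<infinity>n::nat. cscale c (f $$ (- int n)) = 0"
    using fls_nth[of f, unfolded mem_Collect_eq] by (rule MOST_mono) simp
  then show ?thesis by (simp add: cscale_fls_def Abs_fls_inverse)
qed

instance
  by standard
    (rule fls_eqI,
     simp add: fls_nth_cscale cscale_add_right cscale_add_left cscale_cscale cscale_one)+
end

instantiation fps :: (complex_vec) hmodule
begin
definition hscale_fps :: "complex fps \<Rightarrow> 'a fps \<Rightarrow> 'a fps" where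
  "hscale_fps c x = Abs_fps (\<lambda>k. \<Sum>i\<le>k. cscale (c $ i) (x $ (k - i)))"

instance
proof
  fix c d :: "complex fps" and x y :: "'a fps"
  show "c *\<^sub>h (x + y) = c *\<^sub>h x + c *\<^sub>h y"
    by (rule fps_ext) (simp add: hscale_fps_def cscale_add_right sum.distrib)
  show "(c + d) *\<^sub>h x = c *\<^sub>h x + d *\<^sub>h x"
    by (rule fps_ext) (simp add: hscale_fps_def cscale_add_left sum.distrib)
  have one: "(\<Sum>i\<le>k. cscale ((1::complex fps) $ i) (x $ (k - i))) = x $ k" for k
  proof -
    have "(\<Sum>i\<le>k. cscale ((1::complex fps) $ i) (x $ (k - i))) =
          (\<Sum>i\<in>{0}. cscale ((1::complex fps) $ i) (x $ (k - i)))"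
      by (rule sum.mono_neutral_right) auto
    then show ?thesis by (simp add: cscale_one)
  qed
  show "1 *\<^sub>h x = x"
    by (rule fps_ext) (simp only: hscale_fps_def fps_nth_Abs_fps one)
  show "c *\<^sub>h (d *\<^sub>h x) = (c * d) *\<^sub>h x"
  proof (rule fps_ext)
    fix k
    have "(c *\<^sub>h (d *\<^sub>h x)) $ k =
        (\<Sum>i\<le>k. \<Sum>j\<le>k - i. cscale (c $ i * d $ j) (x $ (k - i - j)))"
      by (simp add: hscale_fps_def cscale_sum_right cscale_cscale)
    also have "\<dots> = (\<Sum>(i, j)\<in>(SIGMA i:{..k}. {..k - i}). cscale (c $ i * d $ j) (x $ (k - i - j)))"
      by (simp add: sum.Sigma)
    also have "\<dots> = (\<Sum>(l, i)\<in>(SIGMA l:{..k}. {0..l}). cscale (c $ i * d $ (l - i)) (x $ (k - l)))"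
      by (rule sum.reindex_bij_witness[where j = "\<lambda>(i, j). (i + j, i)" and i = "\<lambda>(l, i). (i, l - i)"])
         (auto simp: diff_diff_add)
    also have "\<dots> = (\<Sum>l\<le>k. \<Sum>i=0..l. cscale (c $ i * d $ (l - i)) (x $ (k - l)))"
      by (simp add: sum.Sigma)
    also have "\<dots> = ((c * d) *\<^sub>h x) $ k"
      by (simp add: hscale_fps_def fps_mult_nth cscale_sum_left)
    finally show "(c *\<^sub>h (d *\<^sub>h x)) $ k = ((c * d) *\<^sub>h x) $ k" .
  qed
qed
end


section \<open>Completed tensor products\<close>

text \<open>
  The algebraic tensor product \<open>M \<otimes> M'\<close> over \<open>\<complex>[[h]]\<close>: the free \<open>\<complex>[[h]]\<close>-module on
  \<open>M \<times> M'\<close> modulo the submodule generated by the bilinearity relations.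
\<close>

inductive_set bilin_rel :: "(('a::hmodule \<times> 'b::hmodule) \<Rightarrow>\<^sub>0 complex fps) set" where
  add_l: "Poly_Mapping.single (a + a', b) c - Poly_Mapping.single (a, b) c
            - Poly_Mapping.single (a', b) c \<in> bilin_rel"
| add_r: "Poly_Mapping.single (a, b + b') c - Poly_Mapping.single (a, b) c
            - Poly_Mapping.single (a, b') c \<in> bilin_rel"
| scale_l: "Poly_Mapping.single (d *\<^sub>h a, b) c - Poly_Mapping.single (a, b) (d * c) \<in> bilin_rel"
| scale_r: "Poly_Mapping.single (a, d *\<^sub>h b) c - Poly_Mapping.single (a, b) (d * c) \<in> bilin_rel"
| zero: "0 \<in> bilin_rel"
| add: "p \<in> bilin_rel \<Longrightarrow> q \<in> bilin_rel \<Longrightarrow> p + q \<in> bilin_rel"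
| uminus: "p \<in> bilin_rel \<Longrightarrow> - p \<in> bilin_rel"

lemma bilin_rel_diff: "p \<in> bilin_rel \<Longrightarrow> q \<in> bilin_rel \<Longrightarrow> p - q \<in> bilin_rel"
  using bilin_rel.add[OF _ bilin_rel.uminus] by fastforce

definition pm_scale :: "complex fps \<Rightarrow> ('a \<Rightarrow>\<^sub>0 complex fps) \<Rightarrow> ('a \<Rightarrow>\<^sub>0 complex fps)" where
  "pm_scale c p = Poly_Mapping.map (\<lambda>x. c * x) p"

lemma lookup_pm_scale: "Poly_Mapping.lookup (pm_scale c p) k = c * Poly_Mapping.lookup p k"
  by (simp add: pm_scale_def map.rep_eq when_def)

lemma pm_scale_simps:
  "pm_scale c (p + q) = pm_scale c p + pm_scale c q"
  "pm_scale c (p - q) = pm_scale c p - pm_scale c q"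
  "pm_scale c (- p) = - pm_scale c p"
  "pm_scale c 0 = 0"
  "pm_scale (c + d) p = pm_scale c p + pm_scale d p"
  "pm_scale c (pm_scale d p) = pm_scale (c * d) p"
  "pm_scale 1 p = p"
  "pm_scale c (Poly_Mapping.single k e) = Poly_Mapping.single k (c * e)"
  by (rule poly_mapping_eqI,
      simp add: lookup_pm_scale lookup_add lookup_minus lookup_single when_def algebra_simps)+

lemma bilin_rel_scale: "p \<in> bilin_rel \<Longrightarrow> pm_scale c p \<in> bilin_rel"
proof (induction rule: bilin_rel.induct)
  case (scale_l d a b e)
  then show ?case
    using bilin_rel.scale_l[of d a b "c * e"] by (simp add: pm_scale_simps mult.left_commute)
next
  case (scale_r a d b e)
  then show ?case
    using bilin_rel.scale_r[of a d b "c * e"] by (simp add: pm_scale_simps mult.left_commute)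
qed (simp_all add: pm_scale_simps bilin_rel.intros)

quotient_type (overloaded) ('a, 'b) tensor =
  "('a::hmodule \<times> 'b::hmodule) \<Rightarrow>\<^sub>0 complex fps" / "\<lambda>p q. p - q \<in> bilin_rel"
proof (rule equivpI)
  show "reflp (\<lambda>p q. p - q \<in> bilin_rel)"
    by (simp add: reflp_def bilin_rel.zero)
  show "symp (\<lambda>p q. p - q \<in> bilin_rel)"
    unfolding symp_def using bilin_rel.uminus by fastforce
  show "transp (\<lambda>p q. p - q \<in> bilin_rel)"
    unfolding transp_def using bilin_rel.add by fastforce
qed

instantiation tensor :: (hmodule, hmodule) hmodule
begin
lift_definition zero_tensor :: "('a, 'b) tensor" is 0 .
lift_definition plus_tensor :: "('a, 'b) tensor \<Rightarrow> ('a, 'b) tensor \<Rightarrow> ('a, 'b) tensor" is "(+)"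
  by (metis add_diff_add bilin_rel.add)
lift_definition minus_tensor :: "('a, 'b) tensor \<Rightarrow> ('a, 'b) tensor \<Rightarrow> ('a, 'b) tensor" is "(-)"
proof -
  fix p p' q q' :: "('a \<times> 'b) \<Rightarrow>\<^sub>0 complex fps"
  assume "p - p' \<in> bilin_rel" "q - q' \<in> bilin_rel"
  then have "(p - p') - (q - q') \<in> bilin_rel" by (rule bilin_rel_diff)
  then show "p - q - (p' - q') \<in> bilin_rel" by (simp add: algebra_simps)
qed
lift_definition uminus_tensor :: "('a, 'b) tensor \<Rightarrow> ('a, 'b) tensor" is uminus
  using bilin_rel.uminus by fastforce
lift_definition hscale_tensor :: "complex fps \<Rightarrow> ('a, 'b) tensor \<Rightarrow> ('a, 'b) tensor" is pm_scale
  by (metis bilin_rel_scale pm_scale_simps(2))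
instance
  by standard (transfer; simp add: pm_scale_simps bilin_rel.zero algebra_simps)+
end

lift_definition pure_tensor :: "'a::hmodule \<Rightarrow> 'b::hmodule \<Rightarrow> ('a, 'b) tensor"
  is "\<lambda>a b. Poly_Mapping.single (a, b) 1" .

text \<open>
  The \<open>h\<close>-adic completion \<open>lim M / h\<^sup>n M\<close>.  An element of the inverse limit is represented by a
  choice \<open>x n\<close> of representatives of its components in \<open>M / h\<^sup>n M\<close>.
\<close>

definition hcong :: "nat \<Rightarrow> 'a::hmodule \<Rightarrow> 'a \<Rightarrow> bool" where
  "hcong n x y \<longleftrightarrow> (\<exists>w. x - y = fps_X ^ n *\<^sub>h w)"

lemma hcong_refl [simp]: "hcong n x x"
  unfolding hcong_def by (rule exI[of _ 0]) simp

lemma hcong_add: "hcong n x y \<Longrightarrow> hcong n x' y' \<Longrightarrow> hcong n (x + x') (y + y')"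
  unfolding hcong_def by (metis add_diff_add hscale_add_right)

lemma hcong_uminus: "hcong n x y \<Longrightarrow> hcong n (- x) (- y)"
  unfolding hcong_def by (metis hscale_minus_right minus_diff_minus)

lemma hcong_diff: "hcong n x y \<Longrightarrow> hcong n x' y' \<Longrightarrow> hcong n (x - x') (y - y')"
  using hcong_add[OF _ hcong_uminus] by fastforce

lemma hcong_sym: "hcong n x y \<Longrightarrow> hcong n y x"
  unfolding hcong_def by (metis hscale_minus_right minus_diff_eq)

lemma hcong_trans: "hcong n x y \<Longrightarrow> hcong n y z \<Longrightarrow> hcong n x z"
  using hcong_add[of n x y y z] unfolding hcong_def by simp

lemma hcong_hscale: "hcong n x y \<Longrightarrow> hcong n (c *\<^sub>h x) (c *\<^sub>h y)"
  unfolding hcong_def by (metis hscale_diff_right hscale_hscale mult.commute)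

quotient_type (overloaded) 'a hcompl =
  "nat \<Rightarrow> 'a::hmodule" / partial:
    "\<lambda>x y. (\<forall>n. hcong n (x (Suc n)) (x n)) \<and> (\<forall>n. hcong n (y (Suc n)) (y n))
           \<and> (\<forall>n. hcong n (x n) (y n))"
proof (rule part_equivpI)
  show "\<exists>x::nat \<Rightarrow> 'a. (\<forall>n. hcong n (x (Suc n)) (x n)) \<and> (\<forall>n. hcong n (x (Suc n)) (x n))
           \<and> (\<forall>n. hcong n (x n) (x n))"
    by (rule exI[of _ "\<lambda>_. 0"]) simp
  show "symp (\<lambda>x y :: nat \<Rightarrow> 'a. (\<forall>n. hcong n (x (Suc n)) (x n))
           \<and> (\<forall>n. hcong n (y (Suc n)) (y n)) \<and> (\<forall>n. hcong n (x n) (y n)))"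
    by (auto simp: symp_def intro: hcong_sym)
  show "transp (\<lambda>x y :: nat \<Rightarrow> 'a. (\<forall>n. hcong n (x (Suc n)) (x n))
           \<and> (\<forall>n. hcong n (y (Suc n)) (y n)) \<and> (\<forall>n. hcong n (x n) (y n)))"
    by (auto simp: transp_def intro: hcong_trans)
qed

instantiation hcompl :: (hmodule) hmodule
begin
lift_definition zero_hcompl :: "'a hcompl" is "\<lambda>_. 0" by simp
lift_definition plus_hcompl :: "'a hcompl \<Rightarrow> 'a hcompl \<Rightarrow> 'a hcompl" is "\<lambda>x y n. x n + y n"
  by (simp add: hcong_add)
lift_definition minus_hcompl :: "'a hcompl \<Rightarrow> 'a hcompl \<Rightarrow> 'a hcompl" is "\<lambda>x y n. x n - y n"
  by (simp add: hcong_diff)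
lift_definition uminus_hcompl :: "'a hcompl \<Rightarrow> 'a hcompl" is "\<lambda>x n. - x n"
  by (simp add: hcong_uminus)
lift_definition hscale_hcompl :: "complex fps \<Rightarrow> 'a hcompl \<Rightarrow> 'a hcompl" is "\<lambda>c x n. c *\<^sub>h x n"
  by (simp add: hcong_hscale)
instance
  by standard (transfer;
    simp add: hcong_add hcong_diff hcong_uminus hcong_hscale hscale_add_left hscale_add_right
      hscale_hscale hscale_one add_ac)+
end

lift_definition to_hcompl :: "'a::hmodule \<Rightarrow> 'a hcompl" is "\<lambda>x _. x" by simp

type_synonym ('a, 'b) ctensor = "('a, 'b) tensor hcompl"

definition ctens :: "'a::hmodule \<Rightarrow> 'b::hmodule \<Rightarrow> ('a, 'b) ctensor"  (infixr \<open>\<otimes>\<^sub>h\<close> 72) where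
  "a \<otimes>\<^sub>h b = to_hcompl (pure_tensor a b)"


section \<open>Power series in several variables\<close>

text \<open>
  Power series over \<^typ>\<open>'a\<close> in the variables \<^typ>\<open>'x\<close>, as coefficient functions on monomials.
  Series involving only finitely many of the variables represent \<open>'a[[u\<^sub>1,\<dots>,u\<^sub>n,v\<^sub>1,\<dots>,v\<^sub>m]]\<close>.
\<close>

typedef ('x, 'a) mfps = "UNIV :: (('x \<Rightarrow>\<^sub>0 nat) \<Rightarrow> 'a) set"
  morphisms mcoeff Abs_mfps ..

lemma mcoeff_Abs [simp]: "mcoeff (Abs_mfps f) m = f m"
  by (simp add: Abs_mfps_inverse)

lemma mfps_eqI: "(\<And>m. mcoeff f m = mcoeff g m) \<Longrightarrow> f = g"
  using mcoeff_inject by blast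

lemma finite_monomial_splits [simp]: "finite {(a, b :: 'x \<Rightarrow>\<^sub>0 nat). a + b = m}"
proof -
  define F where "F = Pi\<^sub>E (Poly_Mapping.keys m) (\<lambda>x. {..Poly_Mapping.lookup m x})"
  define g where "g = (\<lambda>f. (Abs_poly_mapping (\<lambda>x. if x \<in> Poly_Mapping.keys m then f x else 0 :: nat)))"
  have "finite F" unfolding F_def by (rule finite_PiE) auto
  have sub: "{(a, b). a + b = m} \<subseteq> (\<lambda>a. (a, m - a)) ` g ` F"
  proof clarify
    fix a b :: "'x \<Rightarrow>\<^sub>0 nat" assume ab: "m = a + b"
    define f where "f = restrict (Poly_Mapping.lookup a) (Poly_Mapping.keys m)"
    have "f \<in> F" by (auto simp: F_def f_def ab lookup_add)
    moreover have "(\<lambda>x. if x \<in> Poly_Mapping.keys m then f x else 0) = Poly_Mapping.lookup a"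
      by (rule ext) (auto simp: f_def ab in_keys_iff lookup_add)
    then have "g f = a" by (simp add: g_def lookup_inverse)
    ultimately have "a \<in> g ` F" by blast
    moreover have "b = a + b - a" by simp
    ultimately show "(a, b) \<in> (\<lambda>a'. (a', a + b - a')) ` g ` F" by blast
  qed
  show ?thesis using \<open>finite F\<close> by (intro finite_subset[OF sub]) auto
qed

lemma finite_monomial_splits' [simp]: "finite {p :: ('x \<Rightarrow>\<^sub>0 nat) \<times> _. fst p + snd p = m}"
  using finite_monomial_splits[of m] by (simp add: case_prod_unfold)

text \<open>
  The Cauchy product of two series with respect to an arbitrary pairing of coefficients.
\<close>

definition mconv :: "('a \<Rightarrow> 'b \<Rightarrow> 'c::comm_monoid_add) \<Rightarrow> ('x, 'a) mfps \<Rightarrow> ('x, 'b) mfps \<Rightarrow> ('x, 'c) mfps"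
  where "mconv op f g = Abs_mfps (\<lambda>m. \<Sum>(a, b) | a + b = m. op (mcoeff f a) (mcoeff g b))"

instantiation mfps :: (type, zero) zero
begin
definition zero_mfps :: "('a, 'b) mfps" where "zero_mfps = Abs_mfps (\<lambda>_. 0)"
instance ..
end

definition mconst :: "'a::zero \<Rightarrow> ('x, 'a) mfps" where
  "mconst c = Abs_mfps (\<lambda>m. if m = 0 then c else 0)"

instantiation mfps :: (type, "{zero, one}") one
begin
definition one_mfps :: "('a, 'b) mfps" where "one_mfps = mconst 1"
instance ..
end

instantiation mfps :: (type, comm_monoid_add) comm_monoid_add
begin
definition plus_mfps :: "('a, 'b) mfps \<Rightarrow> ('a, 'b) mfps \<Rightarrow> ('a, 'b) mfps" where
  "plus_mfps f g = Abs_mfps (\<lambda>m. mcoeff f m + mcoeff g m)"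
instance
  by standard (simp_all add: plus_mfps_def zero_mfps_def mcoeff_inverse add_ac)
end

instantiation mfps :: (type, ab_group_add) ab_group_add
begin
definition minus_mfps :: "('a, 'b) mfps \<Rightarrow> ('a, 'b) mfps \<Rightarrow> ('a, 'b) mfps" where
  "minus_mfps f g = Abs_mfps (\<lambda>m. mcoeff f m - mcoeff g m)"
definition uminus_mfps :: "('a, 'b) mfps \<Rightarrow> ('a, 'b) mfps" where
  "uminus_mfps f = Abs_mfps (\<lambda>m. - mcoeff f m)"
instance
  by standard (simp_all add: plus_mfps_def minus_mfps_def uminus_mfps_def zero_mfps_def)
end

lemma mcoeff_zero [simp]: "mcoeff 0 m = 0"
  by (simp add: zero_mfps_def)

lemma mcoeff_add [simp]: "mcoeff (f + g) m = mcoeff f m + mcoeff g m"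
  by (simp add: plus_mfps_def)

lemma mcoeff_minus [simp]: "mcoeff (f - g) m = mcoeff f m - mcoeff g m"
  by (simp add: minus_mfps_def)

lemma mcoeff_uminus [simp]: "mcoeff (- f) m = - mcoeff f m"
  by (simp add: uminus_mfps_def)

instantiation mfps :: (type, semiring_0) semiring_0
begin
definition times_mfps :: "('a, 'b) mfps \<Rightarrow> ('a, 'b) mfps \<Rightarrow> ('a, 'b) mfps" where
  "times_mfps = mconv (*)"

lemma mcoeff_mult: "mcoeff (f * g) m = (\<Sum>(a, b) | a + b = m. mcoeff f a * mcoeff g b)"
  by (simp add: times_mfps_def mconv_def)

instance
proof
  fix f g k :: "('a, 'b) mfps"
  show "0 * f = 0" "f * 0 = 0"
    by (rule mfps_eqI, simp add: mcoeff_mult case_prod_unfold)+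
  show "(f + g) * k = f * k + g * k" "k * (f + g) = k * f + k * g"
    by (rule mfps_eqI,
        simp add: mcoeff_mult case_prod_unfold distrib_left distrib_right sum.distrib)+
  show "f * g * k = f * (g * k)"
  proof (rule mfps_eqI)
    fix m
    have "mcoeff (f * g * k) m =
        (\<Sum>(a, b) | a + b = m. \<Sum>(c, d) | c + d = a. mcoeff f c * mcoeff g d * mcoeff k b)"
      by (simp add: mcoeff_mult case_prod_unfold sum_distrib_right)
    also have "\<dots> = (\<Sum>(p, q)\<in>(SIGMA p:{(a, b). a + b = m}. {(c, d). c + d = fst p}).
        mcoeff f (fst q) * mcoeff g (snd q) * mcoeff k (snd p))"
      by (subst sum.Sigma[symmetric]) (auto simp: case_prod_unfold)
    also have "\<dots> = (\<Sum>(p, q)\<in>(SIGMA p:{(a, b). a + b = m}. {(c, d). c + d = snd p}).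
        mcoeff f (fst p) * (mcoeff g (fst q) * mcoeff k (snd q)))"
      by (rule sum.reindex_bij_witness
          [where j = "\<lambda>((a, b), (c, d)). ((c, d + b), (d, b))"
             and i = "\<lambda>((a, b), (c, d)). ((a + c, d), (a, c))"])
         (auto simp: add.assoc mult.assoc)
    also have "\<dots> = (\<Sum>(a, b) | a + b = m. \<Sum>(c, d) | c + d = b.
        mcoeff f a * (mcoeff g c * mcoeff k d))"
      by (subst sum.Sigma[symmetric]) (auto simp: case_prod_unfold)
    also have "\<dots> = mcoeff (f * (g * k)) m"
      by (simp add: mcoeff_mult case_prod_unfold sum_distrib_left)
    finally show "mcoeff (f * g * k) m = mcoeff (f * (g * k)) m" .
  qed
qed
end

instance mfps :: (type, ring) ring ..

lemma mconst_mult: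
  fixes f :: "('x, 'a::semiring_0) mfps"
  shows "mconst c * f = Abs_mfps (\<lambda>m. c * mcoeff f m)"
proof (rule mfps_eqI)
  fix m :: "'x \<Rightarrow>\<^sub>0 nat"
  have "mcoeff (mconst c * f) m = (\<Sum>(a, b)\<in>{(0 :: 'x \<Rightarrow>\<^sub>0 nat, m)}. mcoeff (mconst c) a * mcoeff f b)"
    unfolding mcoeff_mult by (rule sum.mono_neutral_right) (auto simp: mconst_def split: if_splits)
  then show "mcoeff (mconst c * f) m = mcoeff (Abs_mfps (\<lambda>m. c * mcoeff f m)) m"
    by (simp add: mconst_def)
qed

lemma mult_mconst:
  fixes f :: "('x, 'a::semiring_0) mfps"
  shows "f * mconst c = Abs_mfps (\<lambda>m. mcoeff f m * c)"
proof (rule mfps_eqI)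
  fix m :: "'x \<Rightarrow>\<^sub>0 nat"
  have "mcoeff (f * mconst c) m = (\<Sum>(a, b)\<in>{(m, 0 :: 'x \<Rightarrow>\<^sub>0 nat)}. mcoeff f a * mcoeff (mconst c) b)"
    unfolding mcoeff_mult by (rule sum.mono_neutral_right) (auto simp: mconst_def split: if_splits)
  then show "mcoeff (f * mconst c) m = mcoeff (Abs_mfps (\<lambda>m. mcoeff f m * c)) m"
    by (simp add: mconst_def)
qed

instance mfps :: (type, ring_1) ring_1
proof
  fix f :: "('a, 'b) mfps"
  show "1 * f = f" "f * 1 = f"
    by (simp_all add: one_mfps_def mconst_mult mult_mconst mcoeff_inverse)
  have "mcoeff (0 :: ('a, 'b) mfps) 0 \<noteq> mcoeff 1 0"
    by (simp add: one_mfps_def mconst_def)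
  then show "(0 :: ('a, 'b) mfps) \<noteq> 1" by metis
qed

instance mfps :: (type, comm_ring_1) comm_ring_1
proof
  fix f g :: "('a, 'b) mfps"
  show "f * g = g * f"
  proof (rule mfps_eqI)
    fix m
    show "mcoeff (f * g) m = mcoeff (g * f) m"
      unfolding mcoeff_mult
      by (rule sum.reindex_bij_witness[where i = prod.swap and j = prod.swap])
         (auto simp: add.commute mult.commute)
  qed
qed (simp_all add: distrib_right)

text \<open>The series \<open>\<Sum>\<^sub>r c\<^sub>r x\<^sup>r\<close> in the single variable \<open>x\<close>.\<close>

definition mseries :: "'x \<Rightarrow> (nat \<Rightarrow> 'a::zero) \<Rightarrow> ('x, 'a) mfps" where
  "mseries x c = Abs_mfps (\<lambda>m. if Poly_Mapping.keys m \<subseteq> {x} then c (Poly_Mapping.lookup m x) else 0)"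

definition mvar :: "'x \<Rightarrow> ('x, 'a::zero_neq_one) mfps" where
  "mvar x = mseries x (\<lambda>r. if r = 1 then 1 else 0)"


section \<open>Matrices over tensor powers of \<open>\<complex>\<^sup>N\<close>\<close>

text \<open>
  The basis of \<open>\<complex>\<^sup>N\<close> is indexed by a finite type \<^typ>\<open>'n\<close>, so \<open>N = CARD('n)\<close>.  An element of
  \<open>(End \<complex>\<^sup>N)\<^sup>\<otimes>\<^sup>p\<close> with coefficients in \<open>r\<close> is given by its matrix entries, indexed by pairs of
  lists of length \<open>p\<close>; values at lists of other lengths are irrelevant.  Tensor factors, and
  likewise the variables \<open>u\<^sub>i\<close>, \<open>v\<^sub>j\<close>, are numbered from \<open>0\<close>.
\<close>

type_synonym ('n, 'r) tmat = "'n list \<Rightarrow> 'n list \<Rightarrow> 'r"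

definition idx :: "nat \<Rightarrow> 'n list set" where
  "idx p = {I. length I = p}"

definition tone :: "('n, 'r::{zero, one}) tmat" where
  "tone I J = (if I = J then 1 else 0)"

definition tmult :: "nat \<Rightarrow> ('n, 'r::semiring_0) tmat \<Rightarrow> ('n, 'r) tmat \<Rightarrow> ('n, 'r) tmat" where
  "tmult p X Y I J = (\<Sum>K\<in>idx p. X I K * Y K J)"

definition tprod :: "nat \<Rightarrow> ('n, 'r::ring_1) tmat list \<Rightarrow> ('n, 'r) tmat" where
  "tprod p Xs = foldr (tmult p) Xs tone"

definition tinv :: "nat \<Rightarrow> ('n, 'r::ring_1) tmat \<Rightarrow> ('n, 'r) tmat" where
  "tinv p X = (SOME Y. \<forall>I\<in>idx p. \<forall>J\<in>idx p.
     tmult p X Y I J = tone I J \<and> tmult p Y X I J = tone I J)"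

definition ttrace :: "nat \<Rightarrow> ('n, 'r::comm_monoid_add) tmat \<Rightarrow> 'r" where
  "ttrace p X = (\<Sum>I\<in>idx p. X I I)"

definition leg :: "nat \<Rightarrow> ('n \<Rightarrow> 'n \<Rightarrow> 'r::zero) \<Rightarrow> ('n, 'r) tmat" where
  "leg k A I J = (if \<forall>l<length I. l \<noteq> k \<longrightarrow> I ! l = J ! l then A (I ! k) (J ! k) else 0)"

definition tperm :: "nat \<Rightarrow> nat \<Rightarrow> ('n, 'r::{zero, one}) tmat" where
  "tperm i j I J = (if I = J[i := J ! j, j := J ! i] then 1 else 0)"

text \<open>
  The inverse of a unit in a commutative ring.  It is applied only in the rings
  \<open>\<complex>((u))[[v]][[h]]\<close> and \<open>\<complex>((z))[[h]][[u\<^sub>1,u\<^sub>2,\<dots>,v\<^sub>1,v\<^sub>2,\<dots>]]\<close>, where an inverse is a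
  Laurent series in the leading variable and an expansion in nonnegative powers of the others.
\<close>

definition rinv :: "'r::comm_ring_1 \<Rightarrow> 'r" where
  "rinv x = (THE y. x * y = 1)"

lemma rinv_eq: "x * y = 1 \<Longrightarrow> rinv x = y"
  unfolding rinv_def by (rule the_equality) (metis mult.commute mult.left_commute mult_1)+

lemma fps_unit:
  fixes f :: "'a::comm_ring_1 fps"
  assumes "f $ 0 * c = 1"
  shows "f * rinv f = 1"
  using fps_right_inverse[of f c] assms rinv_eq by metis

lemma mfps_unit:
  fixes f :: "('x, 'a::comm_ring_1) mfps"
  assumes "mcoeff f 0 * c = 1"
  shows "f * rinv f = 1"
proof -
  define deg where "deg m = (\<Sum>x\<in>Poly_Mapping.keys m. Poly_Mapping.lookup m x)" for m :: "'x \<Rightarrow>\<^sub>0 nat"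
  have deg_less: "deg b < deg (a + b)" if "a \<noteq> 0" for a b
  proof -
    obtain x where x: "Poly_Mapping.lookup a x \<noteq> 0"
      using \<open>a \<noteq> 0\<close> by (metis lookup_zero poly_mapping_eqI)
    let ?K = "Poly_Mapping.keys (a + b)"
    have "deg b = (\<Sum>y\<in>?K. Poly_Mapping.lookup b y)"
      unfolding deg_def by (rule sum.mono_neutral_left) (auto simp: in_keys_iff lookup_add)
    also have "\<dots> < deg (a + b)"
      unfolding deg_def using x
      by (intro sum_strict_mono_ex1) (auto simp: lookup_add in_keys_iff intro!: bexI[of _ x])
    finally show ?thesis .
  qed
  define G where "G g m = c * ((if m = 0 then 1 else 0) -
      (\<Sum>(a, b) | a + b = m \<and> a \<noteq> 0. mcoeff f a * g b))" for g and m :: "'x \<Rightarrow>\<^sub>0 nat"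
  define g where "g = wfrec (measure deg) G"
  have g: "g m = G g m" for m
  proof -
    have "g m = G (cut g (measure deg) m) m"
      unfolding g_def by (rule wfrec) simp
    also have "\<dots> = G g m"
      unfolding G_def by (intro arg_cong2[of _ _ _ _ "\<lambda>x y. c * (x - y)"] refl sum.cong)
        (auto simp: cut_apply deg_less)
    finally show ?thesis .
  qed
  have "f * Abs_mfps g = 1"
  proof (rule mfps_eqI)
    fix m :: "'x \<Rightarrow>\<^sub>0 nat"
    have split: "{(a, b). a + b = m} = insert (0, m) {(a, b). a + b = m \<and> a \<noteq> 0}" by auto
    have "finite {(a, b). a + b = m \<and> a \<noteq> 0}"
      by (rule finite_subset[OF _ finite_monomial_splits[of m]]) auto
    then have "mcoeff (f * Abs_mfps g) m = mcoeff f 0 * g m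
        + (\<Sum>(a, b) | a + b = m \<and> a \<noteq> 0. mcoeff f a * g b)"
      unfolding mcoeff_mult split by simp
    also have "mcoeff f 0 * g m = (if m = 0 then 1 else 0)
        - (\<Sum>(a, b) | a + b = m \<and> a \<noteq> 0. mcoeff f a * g b)"
      unfolding g[of m] G_def mult.assoc[symmetric] assms by simp
    finally show "mcoeff (f * Abs_mfps g) m = mcoeff 1 m"
      by (simp add: one_mfps_def mconst_def)
  qed
  then show ?thesis using rinv_eq by metis
qed

text \<open>\<open>R\<^sup>-(x) = x (x + h)\<^sup>-\<^sup>1 (I - P h x\<^sup>-\<^sup>1)\<close> acting in the tensor factors \<open>i\<close> and \<open>j\<close>.\<close>

definition Rminus :: "'r \<Rightarrow> 'r \<Rightarrow> nat \<Rightarrow> nat \<Rightarrow> ('n, 'r::comm_ring_1) tmat" where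
  "Rminus h x i j I J = x * rinv (x + h) * (tone I J - tperm i j I J * h * rinv x)"


section \<open>The algebra \<open>A(R\<^sup>-)\<close>\<close>

text \<open>\<open>Gen s i j\<close> stands for the generator \<open>l\<^sub>i\<^sub>j\<^sup>(\<^sup>-\<^sup>r\<^sup>)\<close> with \<open>r = s + 1\<close>.\<close>

datatype 'n gen = Gen nat 'n 'n

datatype 'n lword = Lword "'n gen list"

instantiation lword :: (type) monoid_add
begin
definition zero_lword :: "'a lword" where "zero_lword = Lword []"
fun plus_lword :: "'a lword \<Rightarrow> 'a lword \<Rightarrow> 'a lword" where
  "plus_lword (Lword a) (Lword b) = Lword (a @ b)"
instance
proof
  fix a b c :: "'a lword"
  show "a + b + c = a + (b + c)" by (cases a; cases b; cases c) simp
  show "0 + a = a" "a + 0 = a" by (cases a; simp add: zero_lword_def)+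
qed
end

text \<open>The free complex algebra on the generators, and its \<open>h\<close>-adic completion.\<close>

type_synonym 'n free_alg = "'n lword \<Rightarrow>\<^sub>0 complex"
type_synonym 'n free_halg = "'n free_alg fps"

definition fgen :: "nat \<Rightarrow> 'n \<Rightarrow> 'n \<Rightarrow> 'n free_alg" where
  "fgen s i j = Poly_Mapping.single (Lword [Gen s i j]) 1"

text \<open>
  The defining relation is an identity in \<open>F((u))[[v]][[h]]\<close>, where \<open>F\<close> is the free algebra;
  the outermost series is the one in \<open>h\<close>.
\<close>

type_synonym 'a ser = "'a fls fps fps"

definition su :: "complex ser" where "su = fps_const (fps_const fls_X)"
definition sv :: "complex ser" where "sv = fps_const fps_X"
definition sh :: "complex ser" where "sh = fps_X"

definition emb_ser :: "complex ser \<Rightarrow> 'n free_alg ser" where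
  "emb_ser f = Abs_fps (\<lambda>k. Abs_fps (\<lambda>b. Abs_fls (\<lambda>a. Poly_Mapping.single 0 (f $ k $ b $$ a))))"

definition Lu :: "'n \<Rightarrow> 'n \<Rightarrow> 'n free_alg ser" where
  "Lu i j = fps_const (fps_const (fps_to_fls (Abs_fps (\<lambda>s. fgen s i j))))"

definition Lv :: "'n \<Rightarrow> 'n \<Rightarrow> 'n free_alg ser" where
  "Lv i j = fps_const (Abs_fps (\<lambda>s. fls_const (fgen s i j)))"

definition rel_mat :: "('n::finite, 'n free_alg ser) tmat" where
  "rel_mat I J =
     tmult 2 (tmult 2 (\<lambda>I J. emb_ser (Rminus sh (- su + sv) 0 1 I J)) (leg 0 Lu)) (leg 1 Lv) I J
   - tmult 2 (tmult 2 (leg 1 Lv) (leg 0 Lu)) (\<lambda>I J. emb_ser (Rminus sh (su - sv) 0 1 I J)) I J"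

text \<open>
  A \<open>\<complex>[[h]]\<close>-module is topologically free if and only if it is separated and complete in the
  \<open>h\<close>-adic topology and torsion free.  Accordingly, the topologically free algebra presented by
  the relations is the quotient of the completed free algebra by the smallest two-sided ideal
  which contains the relations (coefficientwise in \<open>u\<close> and \<open>v\<close>), is \<open>h\<close>-adically closed
  and has an \<open>h\<close>-torsion free quotient.
\<close>

inductive_set rel_ideal :: "('n::finite) free_halg set" where
  rel: "I \<in> idx 2 \<Longrightarrow> J \<in> idx 2 \<Longrightarrow> Abs_fps (\<lambda>k. rel_mat I J $ k $ b $$ a) \<in> rel_ideal"
| zero: "0 \<in> rel_ideal"
| add: "x \<in> rel_ideal \<Longrightarrow> y \<in> rel_ideal \<Longrightarrow> x + y \<in> rel_ideal"
| mult_l: "x \<in> rel_ideal \<Longrightarrow> y * x \<in> rel_ideal"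
| mult_r: "x \<in> rel_ideal \<Longrightarrow> x * y \<in> rel_ideal"
| closed: "\<forall>k. \<exists>y w. y \<in> rel_ideal \<and> x - y = fps_X ^ k * w \<Longrightarrow> x \<in> rel_ideal"
| saturated: "fps_X * x \<in> rel_ideal \<Longrightarrow> x \<in> rel_ideal"

lemma rel_ideal_uminus: "x \<in> rel_ideal \<Longrightarrow> - x \<in> rel_ideal"
  using rel_ideal.mult_l[of x "- 1"] by simp

lemma rel_ideal_diff: "x \<in> rel_ideal \<Longrightarrow> y \<in> rel_ideal \<Longrightarrow> x - y \<in> rel_ideal"
  using rel_ideal.add[OF _ rel_ideal_uminus] by fastforce

lemma free_alg_cscale: "cscale c p = Poly_Mapping.single 0 c * (p :: 'n free_alg)"
  unfolding mult_map_scale_conv_mult[symmetric] cscale_poly_mapping_def cscale_complex_def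
  by (simp add: fun_eq_iff)

lemma free_halg_hscale: "c *\<^sub>h x = (c *\<^sub>h 1) * (x :: 'n free_halg)"
proof -
  have 1: "(c *\<^sub>h (1 :: 'n free_halg)) $ i = Poly_Mapping.single 0 (c $ i)" for i
  proof -
    have "(c *\<^sub>h (1 :: 'n free_halg)) $ i = (\<Sum>j\<in>{i}. cscale (c $ j) ((1 :: 'n free_halg) $ (i - j)))"
      unfolding hscale_fps_def fps_nth_Abs_fps by (rule sum.mono_neutral_right) auto
    then show ?thesis by (simp add: free_alg_cscale)
  qed
  have "(c *\<^sub>h x) $ n = (\<Sum>i\<le>n. Poly_Mapping.single 0 (c $ i) * x $ (n - i))" for n
    by (simp add: hscale_fps_def free_alg_cscale)
  then show ?thesis
    by (intro fps_ext) (simp add: fps_mult_nth 1 atLeast0AtMost)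
qed

quotient_type (overloaded) 'n RA = "('n::finite) free_halg" / "\<lambda>x y. x - y \<in> rel_ideal"
proof (rule equivpI)
  show "reflp (\<lambda>x y :: 'n free_halg. x - y \<in> rel_ideal)"
    by (simp add: reflp_def rel_ideal.zero)
  show "symp (\<lambda>x y :: 'n free_halg. x - y \<in> rel_ideal)"
    unfolding symp_def using rel_ideal_uminus by fastforce
  show "transp (\<lambda>x y :: 'n free_halg. x - y \<in> rel_ideal)"
    unfolding transp_def using rel_ideal.add by fastforce
qed

text \<open>\<open>A(R\<^sup>-)\<close> is nonzero: the relations have no constant term.\<close>

definition ring_ideal :: "('a::ring_1 \<Rightarrow> bool) \<Rightarrow> bool" where
  "ring_ideal Z \<longleftrightarrow> Z 0 \<and> (\<forall>x y. Z x \<longrightarrow> Z y \<longrightarrow> Z (x + y)) \<and> (\<forall>x y. Z x \<longrightarrow> Z (x * y) \<and> Z (y * x))"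

lemma ring_ideal_sum: "ring_ideal Z \<Longrightarrow> (\<And>a. a \<in> A \<Longrightarrow> Z (f a)) \<Longrightarrow> Z (sum f A)"
  by (induction A rule: infinite_finite_induct) (auto simp: ring_ideal_def)

lemma ring_ideal_diff: "ring_ideal Z \<Longrightarrow> Z x \<Longrightarrow> Z y \<Longrightarrow> Z (x - y)"
  unfolding ring_ideal_def by (metis add_uminus_conv_diff mult_minus1)

lemma ring_ideal_fps:
  assumes Z: "ring_ideal Z" shows "ring_ideal (\<lambda>x. \<forall>k. Z (x $ k))"
  unfolding ring_ideal_def
proof (intro conjI allI impI)
  have *: "Z (x * y)" "Z (y * x)" if "Z x" for x y
    using Z that unfolding ring_ideal_def by metis+
  fix x y k
  show "Z (0 $ k)"
    using Z unfolding ring_ideal_def by simp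
  assume x: "\<forall>k. Z (x $ k)"
  show "Z ((x * y) $ k)"
    unfolding fps_mult_nth by (rule ring_ideal_sum[OF Z], rule *(1)) (simp add: x)
  show "Z ((y * x) $ k)"
    unfolding fps_mult_nth by (rule ring_ideal_sum[OF Z], rule *(2)) (simp add: x)
  assume "\<forall>k. Z (y $ k)"
  with x show "Z ((x + y) $ k)"
    using Z unfolding ring_ideal_def by simp
qed

lemma ring_ideal_fls:
  assumes Z: "ring_ideal Z" shows "ring_ideal (\<lambda>x. \<forall>k. Z (x $$ k))"
  unfolding ring_ideal_def
proof (intro conjI allI impI)
  have *: "Z (x * y)" "Z (y * x)" if "Z x" for x y
    using Z that unfolding ring_ideal_def by metis+
  fix x y k
  show "Z (0 $$ k)"
    using Z unfolding ring_ideal_def by simp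
  assume x: "\<forall>k. Z (x $$ k)"
  show "Z ((x * y) $$ k)"
    unfolding fls_times_nth(1) by (rule ring_ideal_sum[OF Z], rule *(1)) (simp add: x)
  show "Z ((y * x) $$ k)"
    unfolding fls_times_nth(1) by (rule ring_ideal_sum[OF Z], rule *(2)) (simp add: x)
  assume "\<forall>k. Z (y $$ k)"
  with x show "Z ((x + y) $$ k)"
    using Z unfolding ring_ideal_def by simp
qed

lemma lookup_mult_0: "Poly_Mapping.lookup (p * q :: 'n free_alg) 0 =
    Poly_Mapping.lookup p 0 * Poly_Mapping.lookup q 0"
proof -
  have eq: "0 = a + b \<longleftrightarrow> a = 0 \<and> b = 0" for a b :: "'n lword"
    by (cases a; cases b) (auto simp: zero_lword_def)
  have "(\<Sum>b. Poly_Mapping.lookup q b when (0 :: 'n lword) = a + b) = (Poly_Mapping.lookup q 0 when a = 0)"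
    for a
    by (cases "a = 0") (simp_all add: eq)
  then show ?thesis
    unfolding lookup_mult by (simp add: mult_when)
qed

lemma ring_ideal_aug: "ring_ideal (\<lambda>p :: 'n free_alg. Poly_Mapping.lookup p 0 = 0)"
  by (simp add: ring_ideal_def lookup_add lookup_mult_0)

lemma rel_ideal_aug:
  fixes x :: "'n::finite free_halg"
  shows "x \<in> rel_ideal \<Longrightarrow> Poly_Mapping.lookup (x $ k) 0 = 0"
proof -
  define Z where "Z f \<longleftrightarrow> (\<forall>k b a. Poly_Mapping.lookup (f $ k $ b $$ a) 0 = 0)"
    for f :: "'n free_alg ser"
  have Z: "ring_ideal Z"
    unfolding Z_def
    using ring_ideal_fps[OF ring_ideal_fps[OF ring_ideal_fls[OF ring_ideal_aug]]] .
  have gen: "Poly_Mapping.lookup (fgen s i j) 0 = 0" for s and i j :: 'n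
    by (simp add: fgen_def lookup_single zero_lword_def)
  have L: "Z (leg p Lu I J)" "Z (leg p Lv I J)" for p and I J :: "'n list"
    by (auto simp: Z_def leg_def Lu_def Lv_def gen)
  have Zl: "Z (f * g)" and Zr: "Z (g * f)" if "Z f" for f g
    using Z that unfolding ring_ideal_def by simp_all
  have rm: "Z (rel_mat I J)" for I J
    unfolding rel_mat_def tmult_def
    by (rule ring_ideal_diff[OF Z]; rule ring_ideal_sum[OF Z])
       (rule Zr L Zl ring_ideal_sum[OF Z])+
  have I: "ring_ideal (\<lambda>x :: 'n free_halg. \<forall>k. Poly_Mapping.lookup (x $ k) 0 = 0)"
    using ring_ideal_fps[OF ring_ideal_aug] .
  show "x \<in> rel_ideal \<Longrightarrow> Poly_Mapping.lookup (x $ k) 0 = 0"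
  proof (induction arbitrary: k rule: rel_ideal.induct)
    case (rel I J b a)
    then show ?case using rm[of I J] by (simp add: Z_def)
  next
    case (mult_l x y)
    then show ?case using I unfolding ring_ideal_def by simp
  next
    case (mult_r x y)
    then show ?case using I unfolding ring_ideal_def by simp
  next
    case (closed x)
    then obtain y w where y: "\<And>l. Poly_Mapping.lookup (y $ l) 0 = 0"
      and w: "x - y = fps_X ^ Suc k * w" by blast
    have "(x - y) $ k = 0"
      unfolding w by (simp only: fps_X_power_mult_nth) simp
    then have "x $ k = y $ k" by simp
    with y show ?case by simp
  next
    case (saturated x)
    from saturated.IH[of "Suc k"] show ?case by simp
  qed (simp_all add: lookup_add)
qed

instantiation RA :: (finite) ring_1
begin
lift_definition zero_RA :: "'a RA" is 0 .
lift_definition one_RA :: "'a RA" is 1 .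
lift_definition plus_RA :: "'a RA \<Rightarrow> 'a RA \<Rightarrow> 'a RA" is "(+)"
  by (metis add_diff_add rel_ideal.add)
lift_definition minus_RA :: "'a RA \<Rightarrow> 'a RA \<Rightarrow> 'a RA" is "(-)"
proof -
  fix p p' q q' :: "'a free_halg"
  assume "p - p' \<in> rel_ideal" "q - q' \<in> rel_ideal"
  then have "(p - p') - (q - q') \<in> rel_ideal" by (rule rel_ideal_diff)
  then show "p - q - (p' - q') \<in> rel_ideal" by (simp add: algebra_simps)
qed
lift_definition uminus_RA :: "'a RA \<Rightarrow> 'a RA" is uminus
  using rel_ideal_uminus by fastforce
lift_definition times_RA :: "'a RA \<Rightarrow> 'a RA \<Rightarrow> 'a RA" is "(*)"
proof -
  fix p p' q q' :: "'a free_halg"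
  assume "p - p' \<in> rel_ideal" "q - q' \<in> rel_ideal"
  then have "(p - p') * q + p' * (q - q') \<in> rel_ideal"
    by (intro rel_ideal.add rel_ideal.mult_l rel_ideal.mult_r)
  then show "p * q - p' * q' \<in> rel_ideal" by (simp add: algebra_simps)
qed
instance
proof
  show "(0 :: 'a RA) \<noteq> 1"
  proof transfer
    show "(0 :: 'a free_halg) - 1 \<notin> rel_ideal"
      using rel_ideal_aug[of "- 1 :: 'a free_halg" 0] by auto
  qed
qed (transfer; simp add: rel_ideal.zero algebra_simps)+
end

instantiation RA :: (finite) hmodule
begin
lift_definition hscale_RA :: "complex fps \<Rightarrow> 'a RA \<Rightarrow> 'a RA" is "\<lambda>c x. c *\<^sub>h x"
  by (metis free_halg_hscale hscale_diff_right rel_ideal.mult_l)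
instance
  by standard
    (transfer; simp add: rel_ideal.zero hscale_add_left hscale_add_right hscale_hscale hscale_one)+
end

text \<open>The image of \<open>l\<^sub>i\<^sub>j\<^sup>(\<^sup>-\<^sup>s\<^sup>-\<^sup>1\<^sup>)\<close> in \<open>A(R\<^sup>-)\<close>.\<close>

lift_definition lgen :: "nat \<Rightarrow> 'n::finite \<Rightarrow> 'n \<Rightarrow> 'n RA" is "\<lambda>s i j. fps_const (fgen s i j)" .


section \<open>The braiding and the series \<open>L(v)\<close>\<close>

datatype vars = U nat | V nat

text \<open>\<open>L\<^sub>0(x 0) L\<^sub>1(x 1) \<cdots> L\<^sub>n\<^sub>-\<^sub>1(x (n-1))\<close> for variables \<open>x 0, x 1, \<dots>\<close>.\<close>

definition Lprod :: "nat \<Rightarrow> (nat \<Rightarrow> 'x) \<Rightarrow> ('n::finite, ('x, 'n RA) mfps) tmat" where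
  "Lprod n x = tprod n (map (\<lambda>k. leg k (\<lambda>i j. mseries (x k) (\<lambda>s. lgen s i j))) [0..<n])"

text \<open>
  The entries of \<open>L\<^sup>1\<^sup>3(u) L\<^sup>2\<^sup>4(v) (1 \<otimes> 1)\<close>: the first \<open>n\<close> indices belong to the matrix factor
  \<open>1\<close> and the last \<open>m\<close> indices to the matrix factor \<open>2\<close>.
\<close>

definition Lpair ::
  "nat \<Rightarrow> nat \<Rightarrow> ('n::finite, (vars, ('n RA, 'n RA) ctensor) mfps) tmat" where
  "Lpair n m I J = mconv (\<otimes>\<^sub>h) (Lprod n U (take n I) (take n J)) (Lprod m V (drop n I) (drop n J))"

text \<open>\<open>\<complex>((z))[[h]]\<close>, the outer series being the one in \<open>h\<close>.\<close>

type_synonym zh = "complex fls fps"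

definition Rfactor :: "nat \<Rightarrow> nat \<Rightarrow> nat \<Rightarrow> ('n, (vars, zh) mfps) tmat" where
  "Rfactor n i j = Rminus (mconst fps_X) (mconst (fps_const fls_X) + mvar (U i) - mvar (V j)) i (n + j)"

text \<open>
  The ordered products \<open>R\<^sub>n\<^sub>m\<^sup>1\<^sup>2(z+u-v)\<close> and, for the barred superscripts, \<open>Rnm_bar\<close>; the factors are
  listed from left to right, with \<open>j\<close> varying fastest.
\<close>

definition Rnm :: "nat \<Rightarrow> nat \<Rightarrow> ('n, (vars, zh) mfps) tmat" where
  "Rnm n m = tprod (n + m) [Rfactor n i j. i \<leftarrow> [0..<n], j \<leftarrow> rev [0..<m]]"

definition Rnm_bar :: "nat \<Rightarrow> nat \<Rightarrow> ('n, (vars, zh) mfps) tmat" where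
  "Rnm_bar n m = tprod (n + m) [Rfactor n i j. i \<leftarrow> rev [0..<n], j \<leftarrow> [0..<m]]"

text \<open>
  The conditions determining \<open>S(z)\<close>.  A scalar \<open>f\<close> in \<open>\<complex>((z))[[h]]\<close> multiplies an element \<open>w\<close> of
  \<open>V \<otimes> V\<close> as \<open>w \<otimes> f\<close>, and \<open>w\<close> itself is viewed as \<open>w \<otimes> 1\<close>.  The identity for \<open>n, m\<close> is stated
  for all matrix entries \<open>I, J\<close> and all monomials \<open>e\<close> in the \<open>u\<^sub>i\<close>, \<open>v\<^sub>j\<close>.
\<close>

definition is_braiding ::
  "(('n::finite RA, 'n RA) ctensor \<Rightarrow> (('n RA, 'n RA) ctensor, zh) ctensor) \<Rightarrow> bool" where
  "is_braiding S \<longleftrightarrow> hlinear S \<and>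
     (\<forall>a. S (1 \<otimes>\<^sub>h a) = (1 \<otimes>\<^sub>h a) \<otimes>\<^sub>h 1) \<and>
     (\<forall>a. S (a \<otimes>\<^sub>h 1) = (a \<otimes>\<^sub>h 1) \<otimes>\<^sub>h 1) \<and>
     (\<forall>n\<ge>1. \<forall>m\<ge>1. \<forall>I\<in>idx (n + m). \<forall>J\<in>idx (n + m). \<forall>e.
        S (mcoeff (Lpair n m I J) e) =
        mcoeff (\<Sum>K\<in>idx (n + m). \<Sum>M\<in>idx (n + m).
          mconv (\<otimes>\<^sub>h) (Lpair n m K M) (Rnm_bar n m I K * tinv (n + m) (Rnm n m) M J)) e)"

text \<open>
  The unit \<open>1\<close> of \<open>A(R\<^sup>-)\<close> is the vacuum, so applying a product of series \<open>L(v)\<close> to it changes nothing.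

  The series \<open>l\<^sub>i\<^sub>j(v - kh) = \<Sum>\<^sub>r l\<^sub>i\<^sub>j\<^sup>(\<^sup>-\<^sup>r\<^sup>-\<^sup>1\<^sup>) (v - kh)\<^sup>r\<close> in \<open>A(R\<^sup>-)[[v]]\<close>.  As \<open>(v - kh)\<^sup>r\<close> is
  homogeneous of degree \<open>r\<close>, only \<open>r \<le> b + s\<close> can contribute to the coefficient of \<open>v\<^sup>b h\<^sup>s\<close>.
\<close>

definition shift_power :: "nat \<Rightarrow> nat \<Rightarrow> complex fps fps" where
  "shift_power k r = (fps_const fps_X - of_nat k * fps_X) ^ r"

lift_definition lshift_coeff :: "nat \<Rightarrow> 'n::finite \<Rightarrow> 'n \<Rightarrow> nat \<Rightarrow> 'n RA" is
  "\<lambda>k i j b. Abs_fps (\<lambda>s. \<Sum>r\<le>b + s. cscale (shift_power k r $ s $ b) (fgen r i j))" .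

definition Lbar :: "'n::finite RA fps" where
  "Lbar = ttrace CARD('n)
     (tprod CARD('n) (map (\<lambda>k. leg k (\<lambda>i j. Abs_fps (lshift_coeff k i j))) [0..<CARD('n)]))"

end

theory Submission
  imports Defs
begin

text \<open>
  Let \<open>P\<close> denote the permutation operator, so that \<open>R\<^sup>-(x) = (x - h P) / (x + h)\<close>.  The statement is a
  consequence of two facts about antisymmetric tensors.

  The first is fusion.  Once the denominators are cleared, the defining relation of \<open>A(R\<^sup>-)\<close> can be
  evaluated at \<open>u - v = h\<close> and at \<open>u - v = - h\<close>.  At each of these points one side vanishes, and
  the other is, up to sign, \<open>2 h\<^sup>2\<close> times \<open>(1 + P) L\<^sub>1(u) L\<^sub>2(u - h)\<close>, respectively times
  \<open>L\<^sub>1(u) L\<^sub>2(u - h) (1 + P)\<close> up to a relabelling of the factors.  As \<open>A(R\<^sup>-)\<close> has no \<open>h\<close>-torsion,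
  the entries of \<open>M(v) = L\<^sub>1(v) L\<^sub>2(v - h) \<cdots> L\<^sub>N(v - (N - 1) h)\<close> change sign whenever two row indices,
  or two column indices, are exchanged (\<open>fusion\<close>, \<open>fused_antisymmetric\<close>).

  The second is that, for \<open>x\<^sub>j = x + j h\<close>, the product \<open>R\<^sub>0\<^sub>1(x\<^sub>0) R\<^sub>0\<^sub>2(x\<^sub>1) \<cdots> R\<^sub>0\<^sub>N(x\<^sub>N\<^sub>-\<^sub>1)\<close> acts
  on tensors which are antisymmetric in the factors \<open>1, \<dots>, N\<close> as the scalar \<open>(x - h) / (x + N h)\<close>.  The
  product telescopes to \<open>(x - h \<Sum>\<^sub>j P\<^sub>0\<^sub>j) / (x + N h)\<close>, and \<open>\<Sum>\<^sub>j P\<^sub>0\<^sub>j\<close> is the identity on such tensors,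
  because among \<open>N + 1\<close> indices with \<open>N\<close> values two must agree (\<open>sum_swaps\<close>, \<open>mat_act_row\<close>).

  Substituting \<open>v\<^sub>j = v - j h\<close> (indices starting from \<open>0\<close>) into the formula for \<open>S(z)\<close> with \<open>m = N\<close> therefore
  replaces both products of \<open>R\<close>-matrices by one and the same scalar, which cancels against its inverse
  (\<open>conjugation_trivial\<close>).  So \<open>S(z)\<close> fixes \<open>a \<otimes> w\<close> for every coefficient \<open>w\<close> of every entry of \<open>M(v)\<close>,
  in particular of its trace, when \<open>a\<close> is a word in the generators (\<open>braiding_word\<close>); words span an
  \<open>h\<close>-adically dense submodule (\<open>hlinear_zero_on_words\<close>).

  The substitution is an infinite \<open>h\<close>-adic sum, and \<open>S(z)\<close> is given on the coefficients of series
  in independent variables.  The relation \<open>substituted\<close> expresses that one series arises from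
  another by substitution.  It makes sense for coefficients in any module over \<open>\<complex>[[h]]\<close>, is preserved by
  linear maps and by Cauchy products, and determines the result in separated modules.
\<close>

unbundle fps_syntax


section \<open>Bilinear maps and the \<open>h\<close>-adic topology\<close>

lemma hlinear_add: "hlinear f \<Longrightarrow> f (x + y) = f x + f y"
  and hlinear_hscale: "hlinear f \<Longrightarrow> f (c *\<^sub>h x) = c *\<^sub>h f x"
  by (simp_all add: hlinear_def)

lemma hlinear_zero: "hlinear f \<Longrightarrow> f 0 = 0"
  using hlinear_hscale[of f 0 0] by simp

lemma hlinear_diff: "hlinear f \<Longrightarrow> f (x - y) = f x - f y"
  using hlinear_add[of f "x - y" y] by simp

lemma hlinear_sum: "hlinear f \<Longrightarrow> f (sum g A) = (\<Sum>a\<in>A. f (g a))"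
  by (induction A rule: infinite_finite_induct) (simp_all add: hlinear_zero hlinear_add)

text \<open>
  A linear map over \<open>\<complex>[[h]]\<close> is \<open>h\<close>-adically continuous, so the braiding can be applied to infinite
  \<open>h\<close>-adic sums.
\<close>

lemma hlinear_hcong: "hlinear f \<Longrightarrow> hcong K x y \<Longrightarrow> hcong K (f x) (f y)"
  unfolding hcong_def by (metis hlinear_diff hlinear_hscale)

lemma hscale_sum_right: "c *\<^sub>h sum g A = (\<Sum>a\<in>A. c *\<^sub>h g a)"
  by (induction A rule: infinite_finite_induct) (simp_all add: hscale_add_right)

lemma hscale_sum_left: "sum g A *\<^sub>h x = (\<Sum>a\<in>A. g a *\<^sub>h (x :: 'a::hmodule))"
  by (induction A rule: infinite_finite_induct) (simp_all add: hscale_add_left)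

lemma hcong_sum: "(\<And>a. a \<in> A \<Longrightarrow> hcong K (f a) (g a)) \<Longrightarrow> hcong K (sum f A) (sum g A)"
  by (induction A rule: infinite_finite_induct) (simp_all add: hcong_add)

lemma hcong_zero_level [simp]: "hcong 0 x y"
  unfolding hcong_def by (rule exI[of _ "x - y"]) (simp add: hscale_one)

lemma hcong_dvd: "fps_X ^ K dvd c \<Longrightarrow> hcong K (c *\<^sub>h x) 0"
  unfolding hcong_def by (auto simp: dvd_def hscale_hscale intro: exI[of _ "_ *\<^sub>h _"])

lemma hmodule_no_2_torsion:
  assumes "x + x = 0" shows "x = (0 :: 'a::hmodule)"
proof -
  have "x = (fps_const (1 / 2) + fps_const (1 / 2)) *\<^sub>h x"
    by (simp add: hscale_one)
  also have "\<dots> = fps_const (1 / 2) *\<^sub>h (x + x)"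
    by (simp only: hscale_add_right hscale_add_left)
  finally show ?thesis using assms by simp
qed

definition hbilinear :: "('a::hmodule \<Rightarrow> 'b::hmodule \<Rightarrow> 'c::hmodule) \<Rightarrow> bool" where
  "hbilinear f \<longleftrightarrow> (\<forall>x. hlinear (f x)) \<and> (\<forall>y. hlinear (\<lambda>x. f x y))"

lemma hbilinearD:
  assumes "hbilinear f"
  shows "hlinear (f x)" "hlinear (\<lambda>x. f x y)"
  using assms by (simp_all add: hbilinear_def)

lemma hbilinear_hcong:
  assumes "hbilinear f" "hcong K x x'" "hcong K y y'"
  shows "hcong K (f x y) (f x' y')"
  using hcong_trans[OF hlinear_hcong[OF hbilinearD(1)[OF assms(1), of x] assms(3)]
      hlinear_hcong[OF hbilinearD(2)[OF assms(1), of y'] assms(2)]] .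

lemma hbilinear_sum_sum:
  assumes "hbilinear f"
  shows "f (\<Sum>a\<in>A. c a *\<^sub>h x a) (\<Sum>b\<in>B. d b *\<^sub>h y b) = (\<Sum>(a, b)\<in>A \<times> B. (c a * d b) *\<^sub>h f (x a) (y b))"
  unfolding hlinear_sum[OF hbilinearD(2)[OF assms]]
  by (simp add: hlinear_sum[OF hbilinearD(1)[OF assms]]
      hlinear_hscale[OF hbilinearD(1)[OF assms]] hlinear_hscale[OF hbilinearD(2)[OF assms]]
      hscale_sum_right hscale_hscale sum.cartesian_product mult.commute)

definition hseparated :: "'a::hmodule itself \<Rightarrow> bool" where
  "hseparated _ \<longleftrightarrow> (\<forall>x y :: 'a. (\<forall>K. hcong K x y) \<longrightarrow> x = y)"

lemma hseparatedD: "hseparated TYPE('a::hmodule) \<Longrightarrow> (\<And>K. hcong K (x::'a) y) \<Longrightarrow> x = y"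
  by (auto simp: hseparated_def)

lemma hcong_fps_iff: "hcong K (x :: 'a::complex_vec fps) y \<longleftrightarrow> (\<forall>k<K. x $ k = y $ k)"
proof
  have nth: "(fps_X ^ K *\<^sub>h w) $ k = (if k < K then 0 else w $ (k - K))" for w :: "'a fps" and k
  proof -
    have "(fps_X ^ K *\<^sub>h w) $ k = (\<Sum>i\<in>(if k < K then {} else {K}). cscale (fps_X ^ K $ i) (w $ (k - i)))"
      unfolding hscale_fps_def fps_nth_Abs_fps
      by (rule sum.mono_neutral_right) (auto simp: fps_X_power_nth split: if_splits)
    then show ?thesis by (simp add: fps_X_power_nth cscale_one)
  qed
  show "\<forall>k<K. x $ k = y $ k" if "hcong K x y"
    using that nth unfolding hcong_def by (metis eq_iff_diff_eq_0 fps_sub_nth)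
  assume eq: "\<forall>k<K. x $ k = y $ k"
  have "x - y = fps_X ^ K *\<^sub>h Abs_fps (\<lambda>k. (x - y) $ (k + K))"
    by (rule fps_ext) (use eq in \<open>auto simp: nth\<close>)
  then show "hcong K x y" unfolding hcong_def by blast
qed

lemma hseparated_fps: "hseparated TYPE('a::complex_vec fps)"
  unfolding hseparated_def hcong_fps_iff by (auto simp: fps_eq_iff)

text \<open>
  If a difference is divisible by \<open>h\<^sup>K\<close>, then its component in \<open>M / h\<^sup>K M\<close> vanishes; divisibility
  by all powers of \<open>h\<close> thus kills every component.
\<close>

lemma hseparated_hcompl: "hseparated TYPE('a::hmodule hcompl)"
  unfolding hseparated_def hcong_def
proof (transfer, intro ballI impI)
  let ?C = "{x. (\<forall>n. hcong n (x (Suc n)) (x n)) \<and> (\<forall>n. hcong n (x (Suc n)) (x n)) \<and> (\<forall>n. hcong n (x n) (x n))}"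
  fix x y :: "nat \<Rightarrow> 'a"
  assume x: "x \<in> ?C" and y: "y \<in> ?C"
    and *: "\<forall>K. \<exists>w\<in>?C.
        (\<forall>n. hcong n (x (Suc n) - y (Suc n)) (x n - y n)) \<and>
        (\<forall>n. hcong n (fps_X ^ K *\<^sub>h w (Suc n)) (fps_X ^ K *\<^sub>h w n)) \<and>
        (\<forall>n. hcong n (x n - y n) (fps_X ^ K *\<^sub>h w n))"
  have "hcong K (x K) (y K)" for K
  proof -
    from * obtain w where "hcong K (x K - y K) (fps_X ^ K *\<^sub>h w K)" by blast
    moreover have "hcong K (fps_X ^ K *\<^sub>h w K) 0" by (rule hcong_dvd) simp
    ultimately have "hcong K (x K - y K) 0" by (rule hcong_trans)
    then show ?thesis by (simp add: hcong_def)
  qed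
  with x y show "(\<forall>n. hcong n (x (Suc n)) (x n)) \<and> (\<forall>n. hcong n (y (Suc n)) (y n)) \<and> (\<forall>n. hcong n (x n) (y n))"
    by blast
qed

lemma hbilinear_ctens: "hbilinear (\<otimes>\<^sub>h)"
proof -
  have lin: "to_hcompl (x + y) = to_hcompl x + to_hcompl y" "to_hcompl (c *\<^sub>h x) = c *\<^sub>h to_hcompl x"
    for x y :: "('a, 'b) tensor" and c
    by (transfer, simp)+
  have "pure_tensor (a + a') b = pure_tensor a b + pure_tensor a' b" for a a' :: 'a and b :: 'b
    by transfer (metis bilin_rel.add_l diff_diff_add)
  moreover have "pure_tensor a (b + b') = pure_tensor a b + pure_tensor a b'" for a :: 'a and b b' :: 'b
    by transfer (metis bilin_rel.add_r diff_diff_add)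
  moreover have "pure_tensor (c *\<^sub>h a) b = c *\<^sub>h pure_tensor a b" for a :: 'a and b :: 'b and c
    by transfer (metis bilin_rel.scale_l pm_scale_simps(8))
  moreover have "pure_tensor a (c *\<^sub>h b) = c *\<^sub>h pure_tensor a b" for a :: 'a and b :: 'b and c
    by transfer (metis bilin_rel.scale_r pm_scale_simps(8))
  ultimately show ?thesis
    unfolding hbilinear_def hlinear_def ctens_def by (simp add: lin)
qed

section \<open>Algebras over \<open>\<complex>[[h]]\<close>\<close>

lemma hscale_nth_0: "(c *\<^sub>h x) $ 0 = cscale (c $ 0) (x $ 0)" for x :: "'a::complex_vec fps"
  by (simp add: hscale_fps_def)

text \<open>
  The scalar \<open>c\<close> acts as multiplication by the central element \<open>c *\<^sub>h 1\<close>.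
\<close>

lemma fps_hbilinear_times:
  fixes x y :: "'a::{complex_vec,ring_1} fps"
  assumes l: "\<And>c (p::'a) q. cscale c p * q = cscale c (p * q)"
    and r: "\<And>c (p::'a) q. p * cscale c q = cscale c (p * q)"
  shows "hbilinear ((*) :: 'a fps \<Rightarrow> _)"
proof -
  define E where "E c = c *\<^sub>h (1 :: 'a fps)" for c
  have E1: "E c $ i = cscale (c $ i) 1" for c i
  proof -
    have "E c $ i = (\<Sum>j\<in>{i}. cscale (c $ j) ((1 :: 'a fps) $ (i - j)))"
      unfolding E_def hscale_fps_def fps_nth_Abs_fps by (rule sum.mono_neutral_right) auto
    then show ?thesis by simp
  qed
  have El: "c *\<^sub>h x = E c * x" for c and x :: "'a fps"
    by (rule fps_ext) (simp add: hscale_fps_def fps_mult_nth E1 l atLeast0AtMost)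
  have Er: "E c * x = x * E c" for c and x :: "'a fps"
  proof (rule fps_ext)
    fix k
    have "(E c * x) $ k = (\<Sum>i=0..k. cscale (c $ i) (x $ (k - i)))"
      by (simp add: fps_mult_nth E1 l)
    also have "\<dots> = (\<Sum>i=0..k. cscale (c $ (k - i)) (x $ i))"
      by (rule sum.reindex_bij_witness[where i = "\<lambda>i. k - i" and j = "\<lambda>i. k - i"]) auto
    also have "\<dots> = (x * E c) $ k"
      by (simp add: fps_mult_nth E1 r)
    finally show "(E c * x) $ k = (x * E c) $ k" .
  qed
  show ?thesis
    unfolding hbilinear_def hlinear_def El
    by (simp add: algebra_simps) (metis Er mult.assoc)
qed

lemma fls_cscale: "cscale c (p :: complex fls) = fls_const c * p"
  by (rule fls_eqI) (simp add: fls_nth_cscale cscale_complex_def)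

lemma hbilinear_times_zh: "hbilinear ((*) :: zh \<Rightarrow> _)"
  by (rule fps_hbilinear_times) (simp_all add: fls_cscale algebra_simps)

lemma update_eq_add:
  "a \<notin> Poly_Mapping.keys f \<Longrightarrow> Poly_Mapping.update a b f = f + Poly_Mapping.single a b"
  by (intro poly_mapping_eqI) (auto simp: lookup_update lookup_add lookup_single when_def in_keys_iff)

lemma single_0_central: "Poly_Mapping.single 0 c * p = p * Poly_Mapping.single 0 (c::complex)"
  for p :: "'n free_alg"
proof (induction p rule: update_induct)
  case const
  then show ?case by simp
next
  case (update f a b)
  have "Poly_Mapping.update a b f = f + Poly_Mapping.single a b"
    using update by (intro update_eq_add) simp
  then show ?case using update by (simp add: algebra_simps mult_single)
qed

lemma hbilinear_times_free_halg: "hbilinear ((*) :: 'n free_halg \<Rightarrow> _)"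
proof (rule fps_hbilinear_times)
  fix c and p q :: "'n free_alg"
  show "cscale c p * q = cscale c (p * q)"
    by (simp add: free_alg_cscale mult.assoc)
  show "p * cscale c q = cscale c (p * q)"
    unfolding free_alg_cscale by (metis mult.assoc single_0_central)
qed

lemma hbilinear_times_RA: "hbilinear ((*) :: 'n::finite RA \<Rightarrow> _)"
proof -
  have l: "c *\<^sub>h (x * y) = (c *\<^sub>h x) * y" and r: "c *\<^sub>h (x * y) = x * (c *\<^sub>h y)" for c and x y :: "'n free_halg"
    using hbilinear_times_free_halg unfolding hbilinear_def hlinear_def by metis+
  have L: "c *\<^sub>h (x * y) = (c *\<^sub>h x) * y" for c and x y :: "'n RA"
    by transfer (simp add: l rel_ideal.zero)
  have R: "c *\<^sub>h (x * y) = x * (c *\<^sub>h y)" for c and x y :: "'n RA"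
    by transfer (simp add: r rel_ideal.zero)
  show ?thesis
    unfolding hbilinear_def hlinear_def by (simp add: algebra_simps flip: L R)
qed

section \<open>Substitution into power series\<close>

definition mdeg :: "('x \<Rightarrow>\<^sub>0 nat) \<Rightarrow> nat" where
  "mdeg e = (\<Sum>x\<in>Poly_Mapping.keys e. Poly_Mapping.lookup e x)"

lemma mdeg_superset:
  "finite Y \<Longrightarrow> Poly_Mapping.keys e \<subseteq> Y \<Longrightarrow> mdeg e = (\<Sum>x\<in>Y. Poly_Mapping.lookup e x)"
  unfolding mdeg_def by (rule sum.mono_neutral_left) (auto simp: in_keys_iff)

lemma mdeg_add: "mdeg (a + b) = mdeg a + mdeg b"
proof -
  let ?Y = "Poly_Mapping.keys a \<union> Poly_Mapping.keys b"
  have "mdeg (a + b) = (\<Sum>x\<in>?Y. Poly_Mapping.lookup (a + b) x)"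
    by (rule mdeg_superset) (auto simp: in_keys_iff lookup_add)
  then show ?thesis
    using mdeg_superset[of ?Y a] mdeg_superset[of ?Y b] by (simp add: lookup_add sum.distrib)
qed

lemma mdeg_zero [simp]: "mdeg 0 = 0"
  and mdeg_single [simp]: "mdeg (Poly_Mapping.single x r) = r"
  by (simp_all add: mdeg_def)

text \<open>
  If \<open>h\<close> is counted as a variable of degree one, all terms of \<open>p\<close> have total degree at least \<open>d\<close>.
  A substitution that preserves this filtration converges \<open>h\<close>-adically.
\<close>

definition horder :: "nat \<Rightarrow> ('x, complex fps) mfps \<Rightarrow> bool" where
  "horder d p \<longleftrightarrow> (\<forall>e. fps_X ^ (d - mdeg e) dvd mcoeff p e)"

lemma horder_mult:
  assumes "horder d p" "horder d' q"
  shows "horder (d + d') (p * q)"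
  unfolding horder_def mcoeff_mult
proof (intro allI dvd_sum, clarify)
  fix a b :: "'a \<Rightarrow>\<^sub>0 nat"
  have "fps_X ^ (d + d' - mdeg (a + b)) dvd (fps_X ^ ((d - mdeg a) + (d' - mdeg b)) :: complex fps)"
    by (rule le_imp_power_dvd) (simp add: mdeg_add)
  also have "\<dots> dvd mcoeff p a * mcoeff q b"
    unfolding power_add using assms by (intro mult_dvd_mono) (auto simp: horder_def)
  finally show "fps_X ^ (d + d' - mdeg (a + b)) dvd mcoeff p a * mcoeff q b" .
qed

lemma horder_one: "horder 0 1"
  by (simp add: horder_def)

lemma horder_power: "horder d p \<Longrightarrow> horder (r * d) (p ^ r)"
  by (induction r) (simp_all add: horder_one horder_mult)

lemma horder_prod: "(\<And>x. x \<in> Y \<Longrightarrow> horder (d x) (p x)) \<Longrightarrow> horder (sum d Y) (prod p Y)"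
  by (induction Y rule: infinite_finite_induct) (simp_all add: horder_one horder_mult)

definition map_coeffs :: "('a \<Rightarrow> 'b) \<Rightarrow> ('x, 'a) mfps \<Rightarrow> ('x, 'b) mfps" where
  "map_coeffs S f = Abs_mfps (\<lambda>e. S (mcoeff f e))"

lemma mcoeff_mconv: "mcoeff (mconv op f g) m = (\<Sum>(a, b) | a + b = m. op (mcoeff f a) (mcoeff g b))"
  by (simp add: mconv_def)

text \<open>
  The variable \<open>x\<close> is replaced by \<open>\<sigma> x\<close>. The constant term of \<open>\<sigma> x\<close> is divisible by \<open>h\<close>, so monomials
  of high degree contribute only high powers of \<open>h\<close> to a given coefficient; and as all but
  finitely many variables are sent to \<open>0\<close>, only finitely many monomials of each degree contribute
  at all.
\<close>

locale h_substitution =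
  fixes X :: "'x set" and \<sigma> :: "'x \<Rightarrow> ('x, complex fps) mfps"
  assumes finite_X: "finite X"
    and \<sigma>_outside: "x \<notin> X \<Longrightarrow> \<sigma> x = 0"
    and \<sigma>_const: "mcoeff (\<sigma> x) 0 $ 0 = 0"
begin

definition image_monomial :: "('x \<Rightarrow>\<^sub>0 nat) \<Rightarrow> ('x, complex fps) mfps" where
  "image_monomial e = (\<Prod>x\<in>Poly_Mapping.keys e. \<sigma> x ^ Poly_Mapping.lookup e x)"

lemma image_monomial_superset:
  "finite Y \<Longrightarrow> Poly_Mapping.keys e \<subseteq> Y \<Longrightarrow> image_monomial e = (\<Prod>x\<in>Y. \<sigma> x ^ Poly_Mapping.lookup e x)"
  unfolding image_monomial_def by (rule prod.mono_neutral_left) (auto simp: in_keys_iff)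

lemma image_monomial_add: "image_monomial (a + b) = image_monomial a * image_monomial b"
proof -
  let ?Y = "Poly_Mapping.keys a \<union> Poly_Mapping.keys b"
  have "image_monomial (a + b) = (\<Prod>x\<in>?Y. \<sigma> x ^ Poly_Mapping.lookup (a + b) x)"
    by (rule image_monomial_superset) (auto simp: in_keys_iff lookup_add)
  then show ?thesis
    using image_monomial_superset[of ?Y a] image_monomial_superset[of ?Y b]
    by (simp add: lookup_add power_add prod.distrib)
qed

lemma image_monomial_zero: "image_monomial 0 = 1"
  and image_monomial_single: "image_monomial (Poly_Mapping.single x r) = \<sigma> x ^ r"
  by (simp_all add: image_monomial_def)

lemma image_monomial_order: "horder (mdeg e) (image_monomial e)"
proof -
  have "horder 1 (\<sigma> x)" for x
    unfolding horder_def
  proof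
    fix e :: "'x \<Rightarrow>\<^sub>0 nat"
    show "fps_X ^ (1 - mdeg e) dvd mcoeff (\<sigma> x) e"
    proof (cases "e = 0")
      case True
      have "mcoeff (\<sigma> x) 0 = fps_X * Abs_fps (\<lambda>k. mcoeff (\<sigma> x) 0 $ Suc k)"
        using \<sigma>_const[of x] by (intro fps_ext) (simp split: nat.split)
      then have "fps_X dvd mcoeff (\<sigma> x) 0" by (rule dvdI)
      with True show ?thesis by simp
    next
      case False
      then obtain y where "Poly_Mapping.lookup e y \<noteq> 0"
        by (metis lookup_zero poly_mapping_eqI)
      then have "mdeg e \<ge> 1"
        unfolding mdeg_def by (simp add: in_keys_iff Suc_le_eq sum_pos2 gr_zeroI)
      then show ?thesis by simp
    qed
  qed
  from horder_prod[of _ "\<lambda>x. Poly_Mapping.lookup e x * 1", OF horder_power[OF this]]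
  show ?thesis unfolding image_monomial_def mdeg_def by simp
qed

definition mons :: "nat \<Rightarrow> ('x \<Rightarrow>\<^sub>0 nat) set" where
  "mons d = {e. Poly_Mapping.keys e \<subseteq> X \<and> mdeg e \<le> d}"

lemma finite_mons: "finite (mons d)"
proof (rule inj_on_finite[of "\<lambda>e. restrict (Poly_Mapping.lookup e) X"])
  show "inj_on (\<lambda>e. restrict (Poly_Mapping.lookup e) X) (mons d)"
  proof (rule inj_onI)
    fix a b assume ab: "a \<in> mons d" "b \<in> mons d"
      and eq: "restrict (Poly_Mapping.lookup a) X = restrict (Poly_Mapping.lookup b) X"
    show "a = b"
    proof (rule poly_mapping_eqI)
      fix x show "Poly_Mapping.lookup a x = Poly_Mapping.lookup b x"
        using ab fun_cong[OF eq, of x] unfolding mons_def mem_Collect_eq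
        by (cases "x \<in> X") (simp, metis in_keys_iff subsetD)
    qed
  qed
  show "(\<lambda>e. restrict (Poly_Mapping.lookup e) X) ` mons d \<subseteq> Pi\<^sub>E X (\<lambda>_. {..d})"
  proof (clarsimp simp: mons_def PiE_iff)
    fix e x assume "x \<in> X" "Poly_Mapping.keys e \<subseteq> X" "mdeg e \<le> d"
    then show "Poly_Mapping.lookup e x \<le> d"
      using member_le_sum[of x X "Poly_Mapping.lookup e"] finite_X mdeg_superset[of X e] by simp
  qed
  show "finite (Pi\<^sub>E X (\<lambda>_. {..d}))"
    by (rule finite_PiE) (simp_all add: finite_X)
qed

text \<open>
  This is why the substitution may be truncated at degree \<open>d\<close>, for a fixed precision \<open>K\<close> in \<open>h\<close>.
\<close>

lemma image_monomial_cong_0: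
  assumes "e \<notin> mons d" "mdeg e0 + K \<le> d"
  shows "hcong K (mcoeff (image_monomial e) e0 *\<^sub>h y) 0"
proof (cases "Poly_Mapping.keys e \<subseteq> X")
  case True
  with assms have "K \<le> mdeg e - mdeg e0" by (auto simp: mons_def)
  then show ?thesis
    using image_monomial_order[of e] unfolding horder_def
    by (intro hcong_dvd) (meson dvd_trans le_imp_power_dvd)
next
  case False
  then obtain x where x: "x \<in> Poly_Mapping.keys e" "x \<notin> X" by blast
  then have "\<sigma> x ^ Poly_Mapping.lookup e x = 0"
    by (simp add: \<sigma>_outside in_keys_iff zero_power)
  with x have "image_monomial e = 0"
    unfolding image_monomial_def by (meson finite_keys prod_zero)
  then show ?thesis by simp
qed

definition partial_subst :: "nat \<Rightarrow> ('x, 'a::hmodule) mfps \<Rightarrow> ('x \<Rightarrow>\<^sub>0 nat) \<Rightarrow> 'a" where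
  "partial_subst d f e0 = (\<Sum>e\<in>mons d. mcoeff (image_monomial e) e0 *\<^sub>h mcoeff f e)"

text \<open>
  The series \<open>g\<close> is the result of the substitution in \<open>f\<close>. A relation is used instead of a
  function because the coefficients may lie in modules, such as quotients and completed tensor
  products, in which no limit is constructed here; it only says that the truncated sums converge
  to the coefficients of \<open>g\<close>.
\<close>

definition substituted :: "('x, 'a::hmodule) mfps \<Rightarrow> ('x, 'a) mfps \<Rightarrow> bool" where
  "substituted f g \<longleftrightarrow> (\<forall>e0 K d. mdeg e0 + K \<le> d \<longrightarrow> hcong K (partial_subst d f e0) (mcoeff g e0))"

lemma substitutedD:
  "substituted f g \<Longrightarrow> mdeg e0 + K \<le> d \<Longrightarrow> hcong K (partial_subst d f e0) (mcoeff g e0)"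
  by (simp add: substituted_def)

lemma substituted_unique:
  assumes "hseparated TYPE('a::hmodule)" "substituted f g" "substituted f (g' :: ('x, 'a) mfps)"
  shows "g = g'"
proof (rule mfps_eqI, rule hseparatedD[OF assms(1)])
  fix e0 K
  show "hcong K (mcoeff g e0) (mcoeff g' e0)"
    by (rule hcong_trans[OF hcong_sym[OF substitutedD[OF assms(2) order_refl]]
          substitutedD[OF assms(3) order_refl]])
qed

lemma substituted_add: "substituted f g \<Longrightarrow> substituted f' g' \<Longrightarrow> substituted (f + f') (g + g')"
  unfolding substituted_def partial_subst_def by (simp add: hscale_add_right sum.distrib hcong_add)

lemma substituted_diff: "substituted f g \<Longrightarrow> substituted f' g' \<Longrightarrow> substituted (f - f') (g - g')"
  unfolding substituted_def partial_subst_def by (simp add: hscale_diff_right sum_subtractf hcong_diff)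

lemma substituted_zero: "substituted 0 0"
  unfolding substituted_def partial_subst_def by simp

lemma substituted_sum:
  "(\<And>a. a \<in> A \<Longrightarrow> substituted (f a) (g a)) \<Longrightarrow> substituted (sum f A) (sum g A)"
  by (induction A rule: infinite_finite_induct) (simp_all add: substituted_zero substituted_add)

text \<open>
  Linear maps commute with the truncated sums, and they are continuous.
\<close>

lemma substituted_map_coeffs:
  assumes "hlinear S" "substituted f g"
  shows "substituted (map_coeffs S f) (map_coeffs S g)"
proof -
  have "partial_subst d (map_coeffs S f) e0 = S (partial_subst d f e0)" for d e0
    unfolding partial_subst_def map_coeffs_def by (simp add: hlinear_sum[OF assms(1)] hlinear_hscale[OF assms(1)])
  then show ?thesis
    using assms(2) hlinear_hcong[OF assms(1)] unfolding substituted_def by (simp add: map_coeffs_def)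
qed

text \<open>
  Images of monomials are multiplicative, so up to truncation the substituted pairing is the sum
  over all pairs of monomials. The pairs \<open>(a, b)\<close> in \<open>mons d \<times> mons d\<close> for which \<open>a + b\<close> has
  degree above \<open>d\<close> only contribute multiples of \<open>h\<^sup>K\<close>. The pairing is arbitrary in order to cover
  products in algebras as well as the tensor product.
\<close>

lemma substituted_mconv:
  assumes op: "hbilinear op" and f: "substituted f f'" and g: "substituted g g'"
  shows "substituted (mconv op f g) (mconv op f' g')"
  unfolding substituted_def
proof (intro allI impI)
  fix e0 :: "'x \<Rightarrow>\<^sub>0 nat" and K d assume d: "mdeg e0 + K \<le> d"
  define F where "F = (\<lambda>(a, b). mcoeff (image_monomial (a + b)) e0 *\<^sub>h op (mcoeff f a) (mcoeff g b))"
  let ?D = "{(a, b). a + b \<in> mons d}"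
  have sub: "?D \<subseteq> mons d \<times> mons d"
    by (auto simp: mons_def mdeg_add in_keys_iff lookup_add subset_iff)
  have "partial_subst d (mconv op f g) e0 = (\<Sum>e\<in>mons d. \<Sum>p\<in>{(a, b). a + b = e}. F p)"
    unfolding partial_subst_def mcoeff_mconv hscale_sum_right
    by (intro sum.cong refl) (auto simp: F_def)
  also have "\<dots> = (\<Sum>(e, p)\<in>(SIGMA e:mons d. {(a, b). a + b = e}). F p)"
    by (rule sum.Sigma) (simp_all add: finite_mons)
  also have "\<dots> = sum F ?D"
    by (rule sum.reindex_bij_witness[where i = "\<lambda>(a, b). (a + b, (a, b))" and j = snd]) auto
  finally have 1: "partial_subst d (mconv op f g) e0 = sum F ?D" .
  have "sum F (mons d \<times> mons d) = sum F ?D + sum F (mons d \<times> mons d - ?D)"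
    using sum.subset_diff[OF sub, of F] by (simp add: finite_mons add.commute)
  moreover have "hcong K (sum F (mons d \<times> mons d - ?D)) (\<Sum>_\<in>mons d \<times> mons d - ?D. 0)"
    by (rule hcong_sum) (auto simp: F_def intro!: image_monomial_cong_0[OF _ d])
  ultimately have 2: "hcong K (sum F (mons d \<times> mons d)) (sum F ?D)"
    using hcong_add[OF hcong_refl, of K "sum F (mons d \<times> mons d - ?D)" 0 "sum F ?D"] by simp
  have "sum F (mons d \<times> mons d) = (\<Sum>(a, b)\<in>mons d \<times> mons d. \<Sum>(p, q) | p + q = e0.
      (mcoeff (image_monomial a) p * mcoeff (image_monomial b) q) *\<^sub>h op (mcoeff f a) (mcoeff g b))"
    unfolding F_def
    by (intro sum.cong refl) (simp add: image_monomial_add mcoeff_mult hscale_sum_left case_prod_unfold)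
  also have "\<dots> = (\<Sum>(p, q) | p + q = e0. op (partial_subst d f p) (partial_subst d g q))"
    unfolding partial_subst_def hbilinear_sum_sum[OF op]
    by (simp only: case_prod_unfold) (rule sum.swap)
  also have "hcong K \<dots> (mcoeff (mconv op f' g') e0)"
    unfolding mcoeff_mconv
  proof (rule hcong_sum, clarify)
    fix a b assume "e0 = a + b"
    then have "mdeg a + K \<le> d" "mdeg b + K \<le> d" using d by (simp_all add: mdeg_add)
    then show "hcong K (op (partial_subst d f a) (partial_subst d g b)) (op (mcoeff f' a) (mcoeff g' b))"
      using f g by (intro hbilinear_hcong[OF op] substitutedD)
  qed
  finally show "hcong K (partial_subst d (mconv op f g) e0) (mcoeff (mconv op f' g') e0)"
    unfolding 1 using hcong_trans[OF hcong_sym[OF 2]] by blast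
qed

text \<open>
  In a module of power series in \<open>h\<close>, the coefficient of \<open>h\<^sup>k\<close> of the truncated sums is constant
  once the precision exceeds \<open>k\<close>; these stable values are the result.
\<close>

lemma substituted_exists:
  fixes f :: "('x, 'a::complex_vec fps) mfps"
  shows "\<exists>g. substituted f g"
proof
  have stable: "hcong K (partial_subst d f e0) (partial_subst d' f e0)"
    if "mdeg e0 + K \<le> d'" "d' \<le> d" for K d d' and e0 :: "'x \<Rightarrow>\<^sub>0 nat"
  proof -
    let ?F = "\<lambda>e. mcoeff (image_monomial e) e0 *\<^sub>h mcoeff f e"
    have "mons d' \<subseteq> mons d" using that by (auto simp: mons_def)
    then have "sum ?F (mons d) = sum ?F (mons d') + sum ?F (mons d - mons d')"
      by (metis (no_types, lifting) add.commute finite_mons sum.subset_diff)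
    moreover have "hcong K (sum ?F (mons d - mons d')) (\<Sum>_\<in>mons d - mons d'. 0)"
      by (rule hcong_sum) (use that in \<open>auto intro!: image_monomial_cong_0\<close>)
    ultimately show ?thesis
      unfolding partial_subst_def
      using hcong_add[OF hcong_refl, of K "sum ?F (mons d - mons d')" 0 "sum ?F (mons d')"] by simp
  qed
  show "substituted f (Abs_mfps (\<lambda>e0. Abs_fps (\<lambda>k. partial_subst (mdeg e0 + Suc k) f e0 $ k)))"
    unfolding substituted_def
  proof (intro allI impI)
    fix e0 :: "'x \<Rightarrow>\<^sub>0 nat" and K d assume d: "mdeg e0 + K \<le> d"
    have "partial_subst d f e0 $ k = partial_subst (mdeg e0 + Suc k) f e0 $ k" if "k < K" for k
      using stable[of e0 "Suc k" "mdeg e0 + Suc k" d] that d by (simp add: hcong_fps_iff)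
    then show "hcong K (partial_subst d f e0)
        (mcoeff (Abs_mfps (\<lambda>e0. Abs_fps (\<lambda>k. partial_subst (mdeg e0 + Suc k) f e0 $ k))) e0)"
      by (simp add: hcong_fps_iff)
  qed
qed

lemma substituted_mconst: "substituted (mconst c) (mconst c)"
proof -
  have "partial_subst d (mconst c) e0 = mcoeff (mconst c) e0" for d e0
  proof -
    have "partial_subst d (mconst c) e0 = (\<Sum>e\<in>{0}. mcoeff (image_monomial e) e0 *\<^sub>h mcoeff (mconst c) e)"
      unfolding partial_subst_def
      by (rule sum.mono_neutral_right) (use finite_mons in \<open>auto simp: mons_def mconst_def\<close>)
    then show ?thesis
      by (simp add: image_monomial_zero one_mfps_def mconst_def hscale_one)
  qed
  then show ?thesis by (simp add: substituted_def)
qed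

lemma substituted_one: "substituted 1 1"
  using substituted_mconst[of 1] by (simp add: one_mfps_def)

lemma substituted_mseries:
  assumes x: "x \<in> X"
    and g: "\<And>e0 K d. mdeg e0 + K \<le> d \<Longrightarrow>
      hcong K (\<Sum>r\<le>d. mcoeff (\<sigma> x ^ r) e0 *\<^sub>h c r) (mcoeff g e0)"
  shows "substituted (mseries x c) g"
  unfolding substituted_def
proof (intro allI impI)
  fix e0 :: "'x \<Rightarrow>\<^sub>0 nat" and K d assume d: "mdeg e0 + K \<le> d"
  have inj: "inj_on (Poly_Mapping.single x) {..d}"
    by (rule inj_onI) (metis lookup_single_eq)
  have "e = Poly_Mapping.single x (Poly_Mapping.lookup e x)" if "Poly_Mapping.keys e \<subseteq> {x}"
    for e :: "'x \<Rightarrow>\<^sub>0 nat"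
    using that by (intro poly_mapping_eqI) (auto simp: lookup_single when_def in_keys_iff)
  then have img: "e \<in> Poly_Mapping.single x ` {..d}" if "Poly_Mapping.keys e \<subseteq> {x}" "mdeg e \<le> d"
    for e :: "'x \<Rightarrow>\<^sub>0 nat"
    using that by (metis atMost_iff imageI mdeg_single)
  have "partial_subst d (mseries x c) e0 =
      (\<Sum>e\<in>Poly_Mapping.single x ` {..d}. mcoeff (image_monomial e) e0 *\<^sub>h mcoeff (mseries x c) e)"
    unfolding partial_subst_def
    by (rule sum.mono_neutral_right)
      (use x img finite_mons in \<open>auto simp: mons_def mseries_def split: if_splits\<close>)
  also have "\<dots> = (\<Sum>r\<le>d. mcoeff (\<sigma> x ^ r) e0 *\<^sub>h c r)"
    by (subst sum.reindex[OF inj]) (auto simp: image_monomial_single mseries_def intro!: sum.cong)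
  finally show "hcong K (partial_subst d (mseries x c) e0) (mcoeff g e0)"
    using g[OF d] by simp
qed

lemma substituted_mvar:
  assumes "x \<in> X"
  shows "substituted (mvar x :: ('x, 'a::{hmodule, zero_neq_one}) mfps) (map_coeffs (\<lambda>c. c *\<^sub>h 1) (\<sigma> x))"
  unfolding mvar_def
proof (rule substituted_mseries[OF assms])
  fix e0 :: "'x \<Rightarrow>\<^sub>0 nat" and K d assume d: "mdeg e0 + K \<le> d"
  show "hcong K (\<Sum>r\<le>d. mcoeff (\<sigma> x ^ r) e0 *\<^sub>h (if r = 1 then 1 else 0 :: 'a))
      (mcoeff (map_coeffs (\<lambda>c. c *\<^sub>h 1) (\<sigma> x)) e0)"
  proof (cases "d = 0")
    \<comment> \<open>The truncation at degree \<open>0\<close> loses the monomial \<open>x\<close>, but it is only used with \<open>K = 0\<close>.\<close>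
    case True
    with d show ?thesis by simp
  next
    case False
    have "(\<Sum>r\<le>d. mcoeff (\<sigma> x ^ r) e0 *\<^sub>h (if r = 1 then 1 else 0 :: 'a)) =
        (\<Sum>r\<in>{1}. mcoeff (\<sigma> x ^ r) e0 *\<^sub>h (if r = 1 then 1 else 0 :: 'a))"
      by (rule sum.mono_neutral_right) (use False in auto)
    then show ?thesis by (simp add: map_coeffs_def)
  qed
qed

lemma substituted_times:
  assumes "hbilinear ((*) :: 'a \<Rightarrow> 'a \<Rightarrow> 'a::{hmodule, semiring_0})"
    and "substituted f f'" "substituted g (g' :: ('x, 'a) mfps)"
  shows "substituted (f * g) (f' * g')"
  using substituted_mconv[OF assms] by (simp add: times_mfps_def)

text \<open>
  Substitution is multiplicative and preserves \<open>1\<close>, so the image of an inverse is the inverse of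
  the image.
\<close>

lemma substituted_rinv:
  fixes f f' :: "('x, 'a::{complex_vec, comm_ring_1} fps) mfps"
  assumes bil: "hbilinear ((*) :: 'a fps \<Rightarrow> 'a fps \<Rightarrow> 'a fps)"
    and f: "substituted f f'" and unit: "f * rinv f = 1"
  shows "substituted (rinv f) (rinv f')"
proof -
  obtain g where g: "substituted (rinv f) g" using substituted_exists by blast
  have "substituted 1 (f' * g)"
    using substituted_times[OF bil f g] unit by simp
  then have "f' * g = 1"
    by (rule substituted_unique[OF hseparated_fps _ substituted_one])
  from rinv_eq[OF this] g show ?thesis by simp
qed

end


section \<open>The substitution \<open>v\<^sub>j = v - j h\<close>\<close>

text \<open>
  A monomial splits in only one way into a factor in the variables \<open>Y\<close> and a factor in the
  variables \<open>Z\<close>.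
\<close>

lemma mcoeff_mconv_disjoint:
  assumes YZ: "Y \<inter> Z = {}"
    and f: "\<And>a. mcoeff f a \<noteq> 0 \<Longrightarrow> Poly_Mapping.keys a \<subseteq> Y"
    and g: "\<And>b. mcoeff g b \<noteq> 0 \<Longrightarrow> Poly_Mapping.keys b \<subseteq> Z"
    and op: "\<And>y. op 0 y = 0" "\<And>x. op x 0 = 0"
    and a: "Poly_Mapping.keys a \<subseteq> Y" and b: "Poly_Mapping.keys b \<subseteq> Z"
  shows "mcoeff (mconv op f g) (a + b) = op (mcoeff f a) (mcoeff g b)"
proof -
  have "mcoeff (mconv op f g) (a + b) = (\<Sum>(p, q)\<in>{(a, b)}. op (mcoeff f p) (mcoeff g q))"
    unfolding mcoeff_mconv
  proof (rule sum.mono_neutral_right, simp, simp, clarify)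
    fix p q
    assume pq: "p + q = a + b" and ne: "op (mcoeff f p) (mcoeff g q) \<noteq> 0"
    have p: "Poly_Mapping.keys p \<subseteq> Y" and q: "Poly_Mapping.keys q \<subseteq> Z"
      using ne f g op by metis+
    have "Poly_Mapping.lookup p x = Poly_Mapping.lookup a x \<and> Poly_Mapping.lookup q x = Poly_Mapping.lookup b x" for x
    proof -
      have "Poly_Mapping.lookup p x + Poly_Mapping.lookup q x = Poly_Mapping.lookup a x + Poly_Mapping.lookup b x"
        using pq by (metis lookup_add)
      moreover have "x \<notin> Y \<Longrightarrow> Poly_Mapping.lookup p x = 0 \<and> Poly_Mapping.lookup a x = 0"
        using p a by (auto simp: in_keys_iff)
      moreover have "x \<notin> Z \<Longrightarrow> Poly_Mapping.lookup q x = 0 \<and> Poly_Mapping.lookup b x = 0"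
        using q b by (auto simp: in_keys_iff)
      moreover have "x \<notin> Y \<or> x \<notin> Z" using YZ by blast
      ultimately show ?thesis by linarith
    qed
    then show "p = a \<and> q = b" by (auto intro: poly_mapping_eqI)
  qed
  then show ?thesis by simp
qed

lemma keys_mseries: "mcoeff (mseries x c) a \<noteq> 0 \<Longrightarrow> Poly_Mapping.keys a \<subseteq> {x}"
  by (auto simp: mseries_def split: if_splits)

lemma mcoeff_mseries_single [simp]: "mcoeff (mseries x c) (Poly_Mapping.single x r) = c r"
  by (simp add: mseries_def)

lemma keys_subset_single:
  "Poly_Mapping.keys e \<subseteq> {x} \<Longrightarrow> e = Poly_Mapping.single x (Poly_Mapping.lookup e x)"
  for e :: "'x \<Rightarrow>\<^sub>0 nat"
  by (intro poly_mapping_eqI) (auto simp: lookup_single when_def in_keys_iff)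

lemma mcoeff_mvar_times:
  "mcoeff (mvar x * f) e = (if Poly_Mapping.lookup e x = 0 then 0 else mcoeff f (e - Poly_Mapping.single x 1))"
  for f :: "('x, 'a::ring_1) mfps"
proof -
  have ne: "mcoeff (mvar x :: ('x, 'a) mfps) a \<noteq> 0 \<Longrightarrow> a = Poly_Mapping.single x 1" for a
  proof -
    assume ne: "mcoeff (mvar x :: ('x, 'a) mfps) a \<noteq> 0"
    then have "a = Poly_Mapping.single x (Poly_Mapping.lookup a x)"
      unfolding mvar_def by (intro keys_subset_single keys_mseries)
    moreover have "Poly_Mapping.lookup a x = 1"
      using ne unfolding mvar_def mseries_def by (auto split: if_splits)
    ultimately show ?thesis by simp
  qed
  show ?thesis
  proof (cases "Poly_Mapping.lookup e x = 0")
    case True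
    have "mcoeff (mvar x * f) e = (\<Sum>(a, b) | a + b = e. 0)"
      unfolding mcoeff_mult
    proof (intro sum.cong refl, clarify)
      fix a b assume "e = a + b"
      with True have "a \<noteq> Poly_Mapping.single x 1" by (auto simp: lookup_add)
      with ne have "mcoeff (mvar x :: ('x, 'a) mfps) a = 0" by blast
      then show "mcoeff (mvar x) a * mcoeff f b = 0" by simp
    qed
    with True show ?thesis by simp
  next
    case False
    let ?s = "Poly_Mapping.single x (1 :: nat)"
    have e: "?s + (e - ?s) = e"
      using False by (intro poly_mapping_eqI) (auto simp: lookup_add lookup_minus lookup_single when_def)
    have "mcoeff (mvar x * f) e = (\<Sum>(a, b)\<in>{(?s, e - ?s)}. mcoeff (mvar x) a * mcoeff f b)"
      unfolding mcoeff_mult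
    proof (rule sum.mono_neutral_right)
      show "finite {(a, b). a + b = e}" by (rule finite_monomial_splits)
      show "{(?s, e - ?s)} \<subseteq> {(a, b). a + b = e}" using e by simp
      show "\<forall>p\<in>{(a, b). a + b = e} - {(?s, e - ?s)}. (case p of (a, b) \<Rightarrow> mcoeff (mvar x) a * mcoeff f b) = 0"
      proof
        fix p assume p: "p \<in> {(a, b). a + b = e} - {(?s, e - ?s)}"
        then have "fst p \<noteq> ?s" by (cases p) auto
        then have "mcoeff (mvar x :: ('x, 'a) mfps) (fst p) = 0" using ne by blast
        then show "(case p of (a, b) \<Rightarrow> mcoeff (mvar x) a * mcoeff f b) = 0" by (cases p) simp
      qed
    qed
    with False show ?thesis by (simp add: mvar_def)
  qed
qed

lemma mcoeff_mvar_power: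
  "mcoeff (mvar x ^ r :: ('x, 'a::ring_1) mfps) e = (if e = Poly_Mapping.single x r then 1 else 0)"
proof (induction r arbitrary: e)
  case 0
  then show ?case by (simp add: one_mfps_def mconst_def)
next
  case (Suc r)
  have "Poly_Mapping.lookup e x \<noteq> 0 \<and> e - Poly_Mapping.single x 1 = Poly_Mapping.single x r \<longleftrightarrow>
      e = Poly_Mapping.single x (Suc r)"
  proof (intro iffI conjI; (elim conjE)?)
    assume 0: "Poly_Mapping.lookup e x \<noteq> 0" and eq: "e - Poly_Mapping.single x 1 = Poly_Mapping.single x r"
    show "e = Poly_Mapping.single x (Suc r)"
    proof (rule poly_mapping_eqI)
      fix y
      from eq have "Poly_Mapping.lookup e y - Poly_Mapping.lookup (Poly_Mapping.single x 1) y = Poly_Mapping.lookup (Poly_Mapping.single x r) y"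
        by (metis lookup_minus)
      then show "Poly_Mapping.lookup e y = Poly_Mapping.lookup (Poly_Mapping.single x (Suc r)) y"
        using 0 by (auto simp: lookup_single when_def split: if_splits)
    qed
  next
    assume e: "e = Poly_Mapping.single x (Suc r)"
    show "Poly_Mapping.lookup e x \<noteq> 0" unfolding e by simp
    show "e - Poly_Mapping.single x 1 = Poly_Mapping.single x r"
      unfolding e by (rule poly_mapping_eqI) (simp add: lookup_single lookup_minus when_def)
  qed
  then show ?case by (auto simp: mcoeff_mvar_times Suc.IH)
qed

lemma mconst_times: "mconst (c * d) = mconst c * mconst (d :: 'a::semiring_0)"
  by (rule mfps_eqI) (simp add: mconst_mult, simp add: mconst_def)

lemma mconst_add: "mconst (c + d) = mconst c + mconst (d :: 'a::comm_monoid_add)"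
  and mconst_minus: "mconst (c' - d') = mconst c' - mconst (d' :: 'b::ab_group_add)"
  and mconst_uminus: "mconst (- d') = - mconst d'"
  by (rule mfps_eqI, simp add: mconst_def)+

lemma mconst_power: "mconst (c ^ r) = mconst (c :: 'a::ring_1) ^ r"
  by (induction r) (simp_all add: mconst_times one_mfps_def)

lemma mconst_of_nat: "mconst (of_nat r) = (of_nat r :: ('x, 'a::ring_1) mfps)"
proof (induction r)
  case 0
  show ?case by (rule mfps_eqI) (simp add: mconst_def)
qed (simp add: mconst_add one_mfps_def)

definition shift_vars :: "nat \<Rightarrow> nat \<Rightarrow> vars set" where
  "shift_vars n m = U ` {..<n} \<union> V ` {..<m}"

text \<open>
  The \<open>u\<^sub>i\<close> are kept, and every \<open>v\<^sub>j\<close> becomes a series in the single variable \<open>v\<close>, for which \<open>V 0\<close>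
  is reused. The bounds \<open>n\<close> and \<open>m\<close> make the set of variables finite.
\<close>

definition shift_subst :: "nat \<Rightarrow> nat \<Rightarrow> vars \<Rightarrow> (vars, complex fps) mfps" where
  "shift_subst n m x = (case x of
     U i \<Rightarrow> if i < n then mvar (U i) else 0
   | V j \<Rightarrow> if j < m then mvar (V 0) - mconst (of_nat j * fps_X) else 0)"

interpretation shift: h_substitution "shift_vars n m" "shift_subst n m" for n m
proof
  show "finite (shift_vars n m)" by (simp add: shift_vars_def)
  show "x \<notin> shift_vars n m \<Longrightarrow> shift_subst n m x = 0" for x
    by (auto simp: shift_vars_def shift_subst_def split: vars.split)
  show "mcoeff (shift_subst n m x) 0 $ 0 = 0" for x
    by (auto simp: shift_subst_def mvar_def mseries_def mconst_def split: vars.split)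
qed

lemma substituted_U:
  assumes "i < n"
  shows "shift.substituted n m (mseries (U i) c) (mseries (U i) c)"
proof (rule shift.substituted_mseries)
  show "U i \<in> shift_vars n m" using assms by (simp add: shift_vars_def)
  fix e0 :: "vars \<Rightarrow>\<^sub>0 nat" and K d assume d: "mdeg e0 + K \<le> d"
  have "(\<Sum>r\<le>d. mcoeff (shift_subst n m (U i) ^ r) e0 *\<^sub>h c r) =
      (\<Sum>r\<le>d. if e0 = Poly_Mapping.single (U i) r then c r else 0)"
    using assms by (intro sum.cong) (auto simp: shift_subst_def mcoeff_mvar_power hscale_one)
  also have "\<dots> = mcoeff (mseries (U i) c) e0"
  proof (cases "Poly_Mapping.keys e0 \<subseteq> {U i}")
    case True
    define s where "s = Poly_Mapping.lookup e0 (U i)"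
    have e0: "e0 = Poly_Mapping.single (U i) s"
      unfolding s_def using True by (rule keys_subset_single)
    have "s \<le> d" using d by (simp add: e0)
    have "e0 = Poly_Mapping.single (U i) r \<longleftrightarrow> r = s" for r
      unfolding e0 by (metis lookup_single_eq)
    then show ?thesis using \<open>s \<le> d\<close> e0 by simp
  next
    case False
    then have "e0 \<noteq> Poly_Mapping.single (U i) r" for r by (cases "r = 0") auto
    with False show ?thesis by (simp add: mseries_def)
  qed
  finally show "hcong K (\<Sum>r\<le>d. mcoeff (shift_subst n m (U i) ^ r) e0 *\<^sub>h c r) (mcoeff (mseries (U i) c) e0)"
    by simp
qed

text \<open>
  The binomial formula for \<open>(v - j h)\<^sup>r\<close> as a series in several variables; \<open>shift_power_nth\<close> is
  the same formula in \<open>\<complex>[[v]][[h]]\<close>, where \<open>lshift_coeff\<close> is defined.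
\<close>

lemma mcoeff_shift_power:
  "mcoeff ((mvar x - mconst (of_nat j * fps_X)) ^ r :: ('x, complex fps) mfps) e =
     (\<Sum>b\<le>r. if e = Poly_Mapping.single x b
             then fps_const (of_nat (r choose b) * (- of_nat j) ^ (r - b)) * fps_X ^ (r - b) else 0)"
proof -
  let ?c = "- (of_nat j * fps_X) :: complex fps"
  have c: "?c ^ k = fps_const ((- of_nat j) ^ k) * fps_X ^ k" for k
  proof -
    have "?c = fps_const (- of_nat j) * fps_X" by (simp flip: fps_of_nat)
    then show ?thesis by (simp only: power_mult_distrib fps_const_power)
  qed
  have "(mvar x - mconst (of_nat j * fps_X)) ^ r = (mvar x + mconst ?c) ^ r"
    by (simp add: mconst_uminus)
  also have "\<dots> = (\<Sum>b\<le>r. mconst (of_nat (r choose b)) * mvar x ^ b * mconst (?c ^ (r - b)))"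
    by (simp only: binomial_ring mconst_of_nat mconst_power)
  also have "\<dots> = (\<Sum>b\<le>r. mconst (of_nat (r choose b) * ?c ^ (r - b)) * mvar x ^ b)"
    by (simp only: mconst_times mult_ac)
  finally have eq: "(mvar x - mconst (of_nat j * fps_X)) ^ r = \<dots>" .
  have sum: "mcoeff (sum f A) e = (\<Sum>a\<in>A. mcoeff (f a) e)" for f :: "nat \<Rightarrow> ('x, complex fps) mfps" and A
    by (induction A rule: infinite_finite_induct) simp_all
  show ?thesis
    unfolding eq sum c
    by (intro sum.cong refl) (simp add: mconst_mult mcoeff_mvar_power flip: fps_of_nat)
qed

lemma shift_power_nth:
  "shift_power k r $ s $ b = (if r = b + s then of_nat (r choose b) * (- of_nat k) ^ s else 0)"
proof -
  have c: "(- (of_nat k * fps_X)) ^ t = fps_const (fps_const ((- of_nat k) ^ t)) * (fps_X :: complex fps fps) ^ t" for t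
  proof -
    have "- (of_nat k * fps_X) = fps_const (fps_const (- of_nat k)) * (fps_X :: complex fps fps)"
      by (simp flip: fps_of_nat)
    then show ?thesis by (simp only: power_mult_distrib fps_const_power)
  qed
  have "shift_power k r = (fps_const fps_X + (- (of_nat k * fps_X))) ^ r"
    by (simp add: shift_power_def)
  also have "\<dots> = (\<Sum>a\<le>r. fps_const (of_nat (r choose a) * fps_X ^ a * fps_const ((- of_nat k) ^ (r - a))) * fps_X ^ (r - a))"
    unfolding binomial_ring c
    by (simp only: fps_const_power fps_of_nat mult.assoc flip: fps_const_mult)
  finally have "shift_power k r $ s $ b =
      (\<Sum>a\<le>r. if s = r - a \<and> a = b then of_nat (r choose a) * (- of_nat k) ^ (r - a) else 0)"
    by (auto simp: fps_sum_nth fps_X_power_nth mult.assoc simp flip: fps_of_nat intro!: sum.cong)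
  also have "\<dots> = (\<Sum>a\<le>r. if a = b then (if r = b + s then of_nat (r choose b) * (- of_nat k) ^ s else 0) else 0)"
    by (intro sum.cong) auto
  also have "\<dots> = (if r = b + s then of_nat (r choose b) * (- of_nat k) ^ s else 0)"
    by (subst sum.delta) auto
  finally show ?thesis .
qed

lemma hlinear_abs_RA: "hlinear abs_RA"
  unfolding hlinear_def by (simp add: plus_RA.abs_eq hscale_RA.abs_eq)

lemma hscale_monomial_nth:
  "((fps_const c * fps_X ^ k) *\<^sub>h fps_const p) $ s = (if s = k then cscale c p else 0)" for p :: "'a::complex_vec"
proof -
  have "((fps_const c * fps_X ^ k) *\<^sub>h fps_const p) $ s =
      (\<Sum>i\<le>s. if i = k then (if s = k then cscale c p else 0) else 0)"
    unfolding hscale_fps_def fps_nth_Abs_fps by (rule sum.cong[OF refl]) (auto simp: fps_X_power_nth)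
  then show ?thesis by (simp add: sum.delta)
qed

text \<open>
  The coefficient of \<open>v\<^sup>b\<close> is the \<open>h\<close>-adic sum \<open>\<Sum>\<^sub>r (r choose b) (- j h)\<^sup>r\<^sup>-\<^sup>b l\<^sub>p\<^sub>q\<^sup>(\<^sup>-\<^sup>r\<^sup>-\<^sup>1\<^sup>)\<close>;
  \<open>lshift_coeff\<close> arranges it by powers of \<open>h\<close>.
\<close>

lemma substituted_V:
  assumes "j < m"
  shows "shift.substituted n m (mseries (V j) (\<lambda>s. lgen s p q)) (mseries (V 0) (lshift_coeff j p q))"
proof (rule shift.substituted_mseries)
  show "V j \<in> shift_vars n m" using assms by (simp add: shift_vars_def)
  fix e0 :: "vars \<Rightarrow>\<^sub>0 nat" and K d assume d: "mdeg e0 + K \<le> d"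
  have subst: "shift_subst n m (V j) = mvar (V 0) - mconst (of_nat j * fps_X)"
    using assms by (simp add: shift_subst_def)
  show "hcong K (\<Sum>r\<le>d. mcoeff (shift_subst n m (V j) ^ r) e0 *\<^sub>h lgen r p q)
      (mcoeff (mseries (V 0) (lshift_coeff j p q)) e0)"
  proof (cases "Poly_Mapping.keys e0 \<subseteq> {V 0}")
    case False
    then have "e0 \<noteq> Poly_Mapping.single (V 0) r" for r by (cases "r = 0") auto
    with False show ?thesis unfolding subst mcoeff_shift_power by (simp add: mseries_def)
  next
    case True
    define b where "b = Poly_Mapping.lookup e0 (V 0)"
    have e0: "e0 = Poly_Mapping.single (V 0) b"
      unfolding b_def using True by (rule keys_subset_single)
    have e0_iff: "e0 = Poly_Mapping.single (V 0) r \<longleftrightarrow> r = b" for r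
      unfolding e0 by (metis lookup_single_eq)
    define C where "C r = (if b \<le> r then fps_const (of_nat (r choose b) * (- of_nat j) ^ (r - b)) * fps_X ^ (r - b)
       else 0 :: complex fps)" for r
    have coeff: "mcoeff (shift_subst n m (V j) ^ r) e0 = C r" for r
      unfolding subst mcoeff_shift_power e0_iff C_def by (simp add: sum.delta)
    let ?x = "\<Sum>r\<le>d. C r *\<^sub>h fps_const (fgen r p q)"
    let ?y = "Abs_fps (\<lambda>s. \<Sum>r\<le>b + s. cscale (shift_power j r $ s $ b) (fgen r p q))"
    have "hcong K ?x ?y"
      unfolding hcong_fps_iff
    proof (intro allI impI)
      fix s assume "s < K"
      with d have s: "b + s \<le> d" by (simp add: e0)
      have "?x $ s = (\<Sum>r\<le>d. if r = b + s then cscale (of_nat (r choose b) * (- of_nat j) ^ s) (fgen r p q) else 0)"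
        unfolding fps_sum_nth C_def
        by (intro sum.cong refl) (auto simp: hscale_monomial_nth)
      also have "\<dots> = cscale (of_nat ((b + s) choose b) * (- of_nat j) ^ s) (fgen (b + s) p q)"
        using s by (simp add: sum.delta)
      also have "\<dots> = (\<Sum>r\<le>b + s. if r = b + s then cscale (of_nat (r choose b) * (- of_nat j) ^ s) (fgen r p q) else 0)"
        by (simp add: sum.delta)
      also have "\<dots> = ?y $ s"
        unfolding fps_nth_Abs_fps by (rule sum.cong[OF refl]) (auto simp: shift_power_nth)
      finally show "?x $ s = ?y $ s" .
    qed
    from hlinear_hcong[OF hlinear_abs_RA this]
    have "hcong K (\<Sum>r\<le>d. C r *\<^sub>h lgen r p q) (lshift_coeff j p q b)"
      by (simp add: hlinear_sum[OF hlinear_abs_RA] hlinear_hscale[OF hlinear_abs_RA] lgen.abs_eq lshift_coeff.abs_eq)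
    then show ?thesis unfolding coeff by (simp add: e0)
  qed
qed


section \<open>The fusion relations in \<open>A(R\<^sup>-)\<close>\<close>

lemma RA_torsion_free:
  assumes "fps_X *\<^sub>h a = 0"
  shows "a = (0 :: 'n::finite RA)"
  using assms
proof transfer
  fix x :: "'n free_halg"
  have "fps_X *\<^sub>h x = fps_X * x"
  proof (rule fps_ext)
    fix k
    have "(fps_X *\<^sub>h x) $ k = (\<Sum>i\<le>k. if i = 1 then x $ (k - 1) else 0)"
      unfolding hscale_fps_def fps_nth_Abs_fps
      by (rule sum.cong[OF refl]) (auto simp: cscale_one)
    then show "(fps_X *\<^sub>h x) $ k = (fps_X * x) $ k"
      by (simp add: sum.delta)
  qed
  moreover assume "fps_X *\<^sub>h x - 0 \<in> rel_ideal"
  ultimately show "x - 0 \<in> rel_ideal"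
    using rel_ideal.saturated by simp
qed

text \<open>
  This is the closedness of the ideal of relations.
\<close>

lemma hseparated_RA: "hseparated TYPE('n::finite RA)"
  unfolding hseparated_def
proof (intro allI impI)
  have X: "fps_X ^ k *\<^sub>h w = fps_X ^ k * w" for w :: "'n free_halg" and k
  proof -
    have "(fps_X ^ k *\<^sub>h 1) = (fps_X ^ k :: 'n free_halg)"
      using hscale_monomial_nth[of 1 k "1 :: 'n free_alg"]
      by (intro fps_ext) (simp add: cscale_one fps_X_power_nth)
    then show ?thesis by (subst free_halg_hscale) simp
  qed
  fix x y :: "'n RA" assume "\<forall>K. hcong K x y"
  then show "x = y" unfolding hcong_def
  proof transfer
    fix x y :: "'n free_halg"
    assume *: "\<forall>K. \<exists>w. x - y - fps_X ^ K *\<^sub>h w \<in> rel_ideal"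
    have "\<exists>z w. z \<in> rel_ideal \<and> x - y - z = fps_X ^ k * w" for k
    proof -
      from * obtain w where "x - y - fps_X ^ k * w \<in> rel_ideal" by (auto simp: X)
      then show ?thesis by (intro exI[of _ "x - y - fps_X ^ k * w"] exI[of _ w]) simp
    qed
    then show "x - y \<in> rel_ideal" by (intro rel_ideal.closed allI)
  qed
qed

text \<open>
  The variables \<open>u\<close>, \<open>v\<close>, \<open>h\<close> over the free algebra, where the relations live.
\<close>

definition fu :: "'n free_alg ser" where "fu = fps_const (fps_const fls_X)"
definition fv :: "'n free_alg ser" where "fv = fps_const fps_X"
definition fh :: "'n free_alg ser" where "fh = fps_X"

lemma fu_nth: "(fu * f) $ k $ b $$ a = f $ k $ b $$ (a - 1)"
  and fv_nth: "(fv * f) $ k $ b $$ a = (if b = 0 then 0 else f $ k $ (b - 1) $$ a)"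
  and fh_nth: "(fh * f) $ k $ b $$ a = (if k = 0 then 0 else f $ (k - 1) $ b $$ a)"
  by (simp_all add: fu_def fv_def fh_def fls_X_times_conv_shift)

lemma fu_central: "f * fu = fu * f"
  by (intro fps_ext fls_eqI) (simp add: fu_def fls_X_times_conv_shift)

lemma fv_central: "f * fv = fv * f"
  by (intro fps_ext fls_eqI) (simp add: fv_def fps_mult_fps_X_commute)

lemma fh_central: "f * fh = fh * f"
  by (simp add: fh_def fps_mult_fps_X_commute)

lemma emb_ser_nth: "emb_ser f $ k $ b $$ a = Poly_Mapping.single 0 (f $ k $ b $$ a)"
proof -
  have "\<forall>\<^sub>\<infinity>n::nat. Poly_Mapping.single (0 :: 'a lword) (f $ k $ b $$ (- int n)) = 0"
    using fls_nth[of "f $ k $ b", unfolded mem_Collect_eq] by (rule MOST_mono) simp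
  then show ?thesis by (simp add: emb_ser_def Abs_fls_inverse)
qed

lemma ser_eqI: "(\<And>k b a. f $ k $ b $$ a = g $ k $ b $$ a) \<Longrightarrow> f = g" for f g :: "'a::zero ser"
  by (intro fps_ext fls_eqI)

lemma emb_ser_simps:
  "emb_ser (f + g) = emb_ser f + emb_ser g" "emb_ser (f - g) = emb_ser f - emb_ser g"
  "emb_ser (- f) = - emb_ser f" "emb_ser 0 = 0" "emb_ser 1 = 1"
  "emb_ser (su * f) = fu * emb_ser f" "emb_ser (sv * f) = fv * emb_ser f" "emb_ser (sh * f) = fh * emb_ser f"
  by (rule ser_eqI, simp add: emb_ser_nth single_add single_diff single_uminus fu_nth fv_nth fh_nth
        su_def sv_def sh_def fls_X_times_conv_shift)+

lemma ser_units:
  "(su - sv) * rinv (su - sv) = 1" "(su - sv + sh) * rinv (su - sv + sh) = 1"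
  "(- su + sv) * rinv (- su + sv) = 1" "(- su + sv + sh) * rinv (- su + sv + sh) = 1"
proof -
  have X: "fls_X * fls_X_inv = (1 :: complex fls)"
    by (simp add: fls_X_times_conv_shift fls_X_inv_conv_shift_1)
  have 1: "(fps_const fls_X - fps_X) * rinv (fps_const fls_X - fps_X) = (1 :: complex fls fps)"
    by (rule fps_unit[of _ fls_X_inv]) (simp add: X)
  have 2: "(fps_X - fps_const fls_X) * rinv (fps_X - fps_const fls_X) = (1 :: complex fls fps)"
    by (rule fps_unit[of _ "- fls_X_inv"]) (simp add: X)
  have 3: "fps_const (- fls_X) + fps_X = fps_X - fps_const (fls_X :: complex fls)"
    by (rule fps_ext) simp
  show "(su - sv) * rinv (su - sv) = 1" "(su - sv + sh) * rinv (su - sv + sh) = 1"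
    by (rule fps_unit[of _ "rinv (fps_const fls_X - fps_X)"], simp add: su_def sv_def sh_def 1)+
  show "(- su + sv) * rinv (- su + sv) = 1" "(- su + sv + sh) * rinv (- su + sv + sh) = 1"
    by (rule fps_unit[of _ "rinv (fps_X - fps_const fls_X)"], simp add: su_def sv_def sh_def 2 3)+
qed

lemma Rminus_eq:
  assumes "x * rinv x = 1"
  shows "Rminus h x i j I J = rinv (x + h) * (x * tone I J - h * tperm i j I J)"
proof -
  have "Rminus h x i j I J = rinv (x + h) * (x * tone I J - tperm i j I J * h * (x * rinv x))"
    unfolding Rminus_def by (simp add: algebra_simps)
  with assms show ?thesis by (simp add: mult.commute)
qed

lemma Rminus_cleared:
  assumes "x * rinv x = 1" "(x + h) * rinv (x + h) = 1"
  shows "(x + h) * Rminus h x i j I J = x * tone I J - h * tperm i j I J"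
  unfolding Rminus_eq[OF assms(1)] by (simp only: mult.assoc[symmetric] assms(2) mult_1)

definition ser_coeff :: "int \<Rightarrow> nat \<Rightarrow> ('n::finite) free_alg ser \<Rightarrow> 'n RA" where
  "ser_coeff a b f = abs_RA (Abs_fps (\<lambda>k. f $ k $ b $$ a))"

lemma ser_coeff_simps:
  "ser_coeff a b (f + g) = ser_coeff a b f + ser_coeff a b g"
  "ser_coeff a b (f - g) = ser_coeff a b f - ser_coeff a b g"
  "ser_coeff a b 0 = 0"
  "ser_coeff a b (fu * f) = ser_coeff (a - 1) b f"
  "ser_coeff a b (fv * f) = (if b = 0 then 0 else ser_coeff a (b - 1) f)"
  "ser_coeff a b (fh * f) = fps_X *\<^sub>h ser_coeff a b f"
proof -
  show "ser_coeff a b (f + g) = ser_coeff a b f + ser_coeff a b g"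
    unfolding ser_coeff_def plus_RA.abs_eq by (rule arg_cong[of _ _ abs_RA]) (simp add: fps_eq_iff)
  show "ser_coeff a b (f - g) = ser_coeff a b f - ser_coeff a b g"
    unfolding ser_coeff_def minus_RA.abs_eq by (rule arg_cong[of _ _ abs_RA]) (simp add: fps_eq_iff)
  show "ser_coeff a b 0 = 0"
    unfolding ser_coeff_def zero_RA_def by (rule arg_cong[of _ _ abs_RA]) (simp add: fps_eq_iff)
  show "ser_coeff a b (fu * f) = ser_coeff (a - 1) b f"
    unfolding ser_coeff_def fu_nth ..
  show "ser_coeff a b (fv * f) = (if b = 0 then 0 else ser_coeff a (b - 1) f)"
    unfolding ser_coeff_def fv_nth zero_RA_def by (auto simp: fps_eq_iff intro!: arg_cong[of _ _ abs_RA])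
  have "Abs_fps (\<lambda>k. (fh * f) $ k $ b $$ a) = fps_X *\<^sub>h Abs_fps (\<lambda>k. f $ k $ b $$ a)" (is "?l = ?r")
  proof (rule fps_ext)
    fix k
    have "?r $ k = (\<Sum>i\<le>k. if i = 1 then f $ (k - 1) $ b $$ a else 0)"
      unfolding hscale_fps_def fps_nth_Abs_fps
      by (rule sum.cong[OF refl]) (auto simp: cscale_one)
    then show "?l $ k = ?r $ k" by (simp add: sum.delta fh_nth)
  qed
  then show "ser_coeff a b (fh * f) = fps_X *\<^sub>h ser_coeff a b f"
    unfolding ser_coeff_def hscale_RA.abs_eq by simp
qed

definition null_ser :: "('n::finite) free_alg ser \<Rightarrow> bool" where
  "null_ser f \<longleftrightarrow> (\<forall>a b. ser_coeff a b f = 0)"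

lemma null_ser_mult:
  assumes "null_ser f"
  shows "null_ser (fu * f)" "null_ser (fv * f)" "null_ser (fh * f)"
  using assms by (simp_all add: null_ser_def ser_coeff_simps)

lemma null_ser_diff: "null_ser f \<Longrightarrow> null_ser g \<Longrightarrow> null_ser (f - g)"
  and null_ser_add: "null_ser f \<Longrightarrow> null_ser g \<Longrightarrow> null_ser (f + g)"
  by (simp_all add: null_ser_def ser_coeff_simps)

lemma null_rel_mat:
  assumes "I \<in> idx 2" "J \<in> idx 2"
  shows "null_ser (rel_mat I J)"
proof -
  have "ser_coeff a b (rel_mat I J) = 0" for a b
    unfolding ser_coeff_def zero_RA_def using rel_ideal.rel[OF assms, of b a]
    by (simp add: RA.abs_eq_iff)
  then show ?thesis by (simp add: null_ser_def)
qed

lemma idx_2: "idx 2 = {[i, j] | i j. True}"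
  by (auto simp: idx_def length_Suc_conv numeral_2_eq_2)

lemma sum_idx_2: "(\<Sum>K\<in>idx 2. f K) = (\<Sum>i\<in>UNIV. \<Sum>j\<in>UNIV. f [i, j :: 'n::finite])"
proof -
  have "(\<Sum>K\<in>idx 2. f K) = (\<Sum>(i, j)\<in>UNIV \<times> UNIV. f [i, j])"
    by (rule sum.reindex_bij_witness[where i = "\<lambda>(i, j). [i, j]" and j = "\<lambda>K. (K ! 0, K ! 1)"])
      (auto simp: idx_2)
  then show ?thesis by (simp add: sum.cartesian_product)
qed

lemma sum_sum_delta:
  "(\<Sum>k\<in>UNIV. \<Sum>k'\<in>UNIV. if k = p then if k' = q then G k k' else 0 else 0) = G p q"
  for p q :: "'n::finite" and G :: "'n \<Rightarrow> 'n \<Rightarrow> 'r::comm_monoid_add"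
proof -
  have "(\<Sum>k\<in>UNIV. \<Sum>k'\<in>UNIV. if k = p then if k' = q then G k k' else 0 else 0) = (\<Sum>k\<in>UNIV. if k = p then G k q else 0)"
    by (intro sum.cong refl) simp
  then show ?thesis by simp
qed

text \<open>
  The matrix \<open>a - b P\<close> applied to the row indices, and to the column indices, of a tensor with two
  legs.
\<close>

lemma sum_swap_matrix:
  fixes F :: "'n::finite \<Rightarrow> 'n \<Rightarrow> 'r::ring_1"
  shows "(\<Sum>k\<in>UNIV. \<Sum>k'\<in>UNIV. (a * tone [i, i'] [k, k'] - b * tperm 0 1 [i, i'] [k, k']) * F k k') =
      a * F i i' - b * F i' i" (is "?l")
    and "(\<Sum>k\<in>UNIV. \<Sum>k'\<in>UNIV. F k k' * (a * tone [k, k'] [i, i'] - b * tperm 0 1 [k, k'] [i, i'])) =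
      F i i' * a - F i' i * b" (is "?r")
proof -
  have "(a * tone [i, i'] [k, k'] - b * tperm 0 1 [i, i'] [k, k']) * F k k' =
      (if k = i then if k' = i' then a * F k k' else 0 else 0) - (if k = i' then if k' = i then b * F k k' else 0 else 0)" for k k'
    by (simp add: tone_def tperm_def left_diff_distrib)
  then show ?l by (simp only: sum_subtractf sum_sum_delta)
  have "F k k' * (a * tone [k, k'] [i, i'] - b * tperm 0 1 [k, k'] [i, i']) =
      (if k = i then if k' = i' then F k k' * a else 0 else 0) - (if k = i' then if k' = i then F k k' * b else 0 else 0)" for k k'
    by (simp add: tone_def tperm_def right_diff_distrib)
  then show ?r by (simp only: sum_subtractf sum_sum_delta)
qed

text \<open>
  The defining relation multiplied by \<open>(u - v + h) (v - u + h)\<close>, which clears the denominators of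
  both \<open>R\<close>-matrices. Unprimed indices belong to the first tensor factor and primed indices to the
  second one. The exchange of \<open>i\<close> and \<open>i'\<close>, or of \<open>j\<close> and \<open>j'\<close>, comes from \<open>P\<close>.
\<close>

lemma polynomial_relation:
  fixes i i' j j' :: "'n::finite"
  defines "x \<equiv> fu - fv"
  shows "null_ser ((x + fh) * (- x * (Lu i j * Lv i' j') - fh * (Lu i' j * Lv i j'))
     - (- x + fh) * (x * (Lv i' j' * Lu i j) - fh * (Lv i' j * Lu i j')))"
proof -
  let ?R = "\<lambda>I J. emb_ser (Rminus sh (- su + sv) 0 1 I J)" and ?S = "\<lambda>I J. emb_ser (Rminus sh (su - sv) 0 1 I J)"
  have R: "(- x + fh) * ?R I J = - x * tone I J - fh * tperm 0 1 I J" for I J :: "'n list"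
  proof -
    have "emb_ser ((- su + sv + sh) * Rminus sh (- su + sv) 0 1 I J) = emb_ser ((- su + sv) * tone I J - sh * tperm 0 1 I J)"
      by (subst Rminus_cleared) (rule ser_units refl)+
    then show ?thesis
      by (simp add: x_def emb_ser_simps distrib_right left_diff_distrib tone_def tperm_def split: if_splits)
  qed
  have S: "(x + fh) * ?S I J = x * tone I J - fh * tperm 0 1 I J" for I J :: "'n list"
  proof -
    have "emb_ser ((su - sv + sh) * Rminus sh (su - sv) 0 1 I J) = emb_ser ((su - sv) * tone I J - sh * tperm 0 1 I J)"
      by (subst Rminus_cleared) (rule ser_units refl)+
    then show ?thesis
      by (simp add: x_def emb_ser_simps distrib_right left_diff_distrib tone_def tperm_def split: if_splits)
  qed
  have x_central: "f * x = x * f" for f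
    unfolding x_def right_diff_distrib left_diff_distrib by (simp only: fu_central[of f] fv_central[of f])
  define D E where "D = - x + fh" and "E = x + fh"
  have central: "f * D = D * f" "f * E = E * f" for f
    unfolding D_def E_def
    by (simp_all only: distrib_left distrib_right mult_minus_left mult_minus_right x_central[of f] fh_central[of f])
  have LuLv: "tmult 2 (tmult 2 W (leg 0 Lu)) (leg 1 Lv) [i, i'] [j, j'] =
      (\<Sum>k\<in>UNIV. \<Sum>k'\<in>UNIV. W [i, i'] [k, k'] * (Lu k j * Lv k' j'))" for W :: "('n, 'n free_alg ser) tmat"
  proof -
    have "tmult 2 (tmult 2 W (leg 0 Lu)) (leg 1 Lv) [i, i'] [j, j'] =
       (\<Sum>l\<in>UNIV. \<Sum>l'\<in>UNIV. (\<Sum>k\<in>UNIV. \<Sum>k'\<in>UNIV. W [i, i'] [k, k'] * (if k' = l' then Lu k l else 0)) * (if l = j then Lv l' j' else 0))"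
      unfolding tmult_def sum_idx_2 leg_def
      by (intro sum.cong refl arg_cong2[of _ _ _ _ "(*)"]) (auto simp: less_Suc_eq)
    also have "\<dots> = (\<Sum>l'\<in>UNIV. \<Sum>k\<in>UNIV. W [i, i'] [k, l'] * Lu k j * Lv l' j')"
    proof -
      have inner: "(\<Sum>k\<in>UNIV. \<Sum>k'\<in>UNIV. W [i, i'] [k, k'] * (if k' = l' then Lu k l else 0)) =
          (\<Sum>k\<in>UNIV. W [i, i'] [k, l'] * Lu k l)" for l l'
        by (simp add: if_distrib cong: if_cong)
      have outer: "(\<Sum>l\<in>UNIV. \<Sum>l'\<in>UNIV. G l l' * (if l = j then Lv l' j' else 0)) =
          (\<Sum>l'\<in>UNIV. G j l' * Lv l' j')" for G :: "'n \<Rightarrow> 'n \<Rightarrow> 'n free_alg ser"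
        by (rule trans[OF sum.swap]) (simp add: if_distrib cong: if_cong)
      show ?thesis unfolding inner outer by (simp only: sum_distrib_right)
    qed
    also have "\<dots> = (\<Sum>k\<in>UNIV. \<Sum>k'\<in>UNIV. W [i, i'] [k, k'] * (Lu k j * Lv k' j'))"
      by (subst sum.swap) (simp add: mult.assoc)
    finally show ?thesis .
  qed
  have LvLu: "tmult 2 (tmult 2 (leg 1 Lv) (leg 0 Lu)) W [i, i'] [j, j'] =
      (\<Sum>k\<in>UNIV. \<Sum>k'\<in>UNIV. (Lv i' k' * Lu i k) * W [k, k'] [j, j'])" for W :: "('n, 'n free_alg ser) tmat"
  proof -
    have "tmult 2 (tmult 2 (leg 1 Lv) (leg 0 Lu)) W [i, i'] [j, j'] =
       (\<Sum>k\<in>UNIV. \<Sum>k'\<in>UNIV. (\<Sum>l\<in>UNIV. \<Sum>l'\<in>UNIV. (if i = l then Lv i' l' else 0) * (if l' = k' then Lu l k else 0)) * W [k, k'] [j, j'])"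
      unfolding tmult_def sum_idx_2 leg_def
      by (intro sum.cong refl arg_cong2[of _ _ _ _ "(*)"]) (auto simp: less_Suc_eq)
    moreover have "(\<Sum>l\<in>UNIV. \<Sum>l'\<in>UNIV. (if i = l then Lv i' l' else 0) * (if l' = k' then Lu l k else 0)) = Lv i' k' * Lu i k" for k k'
    proof -
      have "(if i = l then Lv i' l' else 0) * (if l' = k' then Lu l k else 0) =
          (if l = i then if l' = k' then Lv i' l' * Lu l k else 0 else 0)" for l l'
        by simp
      then show ?thesis by (simp only: sum_sum_delta)
    qed
    ultimately show ?thesis by (simp only:)
  qed
  \<comment> \<open>The relations are closed under multiplication by \<open>u\<close>, \<open>v\<close>, \<open>h\<close>, hence by the denominators.\<close>
  have "null_ser (f * rel_mat [i, i'] [j, j'])" if "f = D * E" for f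
  proof -
    have null: "null_ser (rel_mat [i, i'] [j, j'])"
      by (rule null_rel_mat) (auto simp: idx_2)
    have "null_ser (E * rel_mat [i, i'] [j, j'])"
      unfolding E_def x_def distrib_right left_diff_distrib
      by (intro null_ser_add null_ser_diff null_ser_mult null)
    then have "null_ser (fh * (E * rel_mat [i, i'] [j, j']) - (fu * (E * rel_mat [i, i'] [j, j']) - fv * (E * rel_mat [i, i'] [j, j'])))"
      by (intro null_ser_diff null_ser_mult)
    then show ?thesis unfolding that D_def x_def by (simp add: algebra_simps)
  qed
  moreover have "D * E * rel_mat [i, i'] [j, j'] =
     E * (\<Sum>k\<in>UNIV. \<Sum>k'\<in>UNIV. (D * ?R [i, i'] [k, k']) * (Lu k j * Lv k' j'))
     - D * (\<Sum>k\<in>UNIV. \<Sum>k'\<in>UNIV. (Lv i' k' * Lu i k) * (E * ?S [k, k'] [j, j']))"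
  proof -
    have DE: "D * E * (s - t) = E * (D * s) - D * (E * t)" for s t
    proof -
      have "D * E * (s - t) = D * E * s - D * E * t" by (rule right_diff_distrib)
      also have "D * E * s = E * (D * s)" unfolding central(2)[of D] by (rule mult.assoc)
      finally show ?thesis by (simp only: mult.assoc)
    qed
    have "D * (\<Sum>k\<in>UNIV. \<Sum>k'\<in>UNIV. ?R [i, i'] [k, k'] * (Lu k j * Lv k' j')) =
        (\<Sum>k\<in>UNIV. \<Sum>k'\<in>UNIV. (D * ?R [i, i'] [k, k']) * (Lu k j * Lv k' j'))"
      by (simp add: sum_distrib_left mult.assoc)
    moreover have "E * (\<Sum>k\<in>UNIV. \<Sum>k'\<in>UNIV. (Lv i' k' * Lu i k) * ?S [k, k'] [j, j']) =
        (\<Sum>k\<in>UNIV. \<Sum>k'\<in>UNIV. (Lv i' k' * Lu i k) * (E * ?S [k, k'] [j, j']))"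
      by (simp add: sum_distrib_left mult.assoc[symmetric] central)
    ultimately show ?thesis
      unfolding rel_mat_def LuLv LvLu DE by (simp only:)
  qed
  moreover have "(\<Sum>k\<in>UNIV. \<Sum>k'\<in>UNIV. (D * ?R [i, i'] [k, k']) * (Lu k j * Lv k' j')) =
      - x * (Lu i j * Lv i' j') - fh * (Lu i' j * Lv i j')"
    unfolding D_def R by (rule sum_swap_matrix)
  moreover have "(\<Sum>k\<in>UNIV. \<Sum>k'\<in>UNIV. (Lv i' k' * Lu i k) * (E * ?S [k, k'] [j, j'])) =
      x * (Lv i' j' * Lu i j) - fh * (Lv i' j * Lu i j')"
    unfolding E_def S sum_swap_matrix by (simp only: x_central fh_central)
  ultimately have "null_ser (E * (- x * (Lu i j * Lv i' j') - fh * (Lu i' j * Lv i j'))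
     - D * (x * (Lv i' j' * Lu i j) - fh * (Lv i' j * Lu i j')))"
    by (simp only:)
  then show ?thesis unfolding D_def E_def .
qed


text \<open>
  Laurent series in \<open>u\<close> admit no substitution for \<open>u\<close>. The series in the polynomial relation have
  no negative powers of \<open>u\<close>, and on such series multiplication by \<open>u\<close> agrees with multiplication
  by a variable of a power series ring; otherwise the coefficient of \<open>u\<^sup>-\<^sup>1\<close> would enter.
\<close>

definition no_poles :: "'n free_alg ser \<Rightarrow> bool" where
  "no_poles f \<longleftrightarrow> (\<forall>k b a. a < 0 \<longrightarrow> f $ k $ b $$ a = 0)"

definition to_mfps :: "'x \<Rightarrow> 'x \<Rightarrow> 'n::finite free_alg ser \<Rightarrow> ('x, 'n RA) mfps" where
  "to_mfps x y f = Abs_mfps (\<lambda>e. if Poly_Mapping.keys e \<subseteq> {x, y}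
     then ser_coeff (int (Poly_Mapping.lookup e x)) (Poly_Mapping.lookup e y) f else 0)"

lemma hRA_mult: "(c *\<^sub>h 1) * f = c *\<^sub>h (f :: 'n::finite RA)"
  using hbilinear_times_RA unfolding hbilinear_def hlinear_def by (metis mult_1)

lemma keys_diff_single:
  "Poly_Mapping.lookup e x \<noteq> 0 \<Longrightarrow> x \<in> Y \<Longrightarrow>
    Poly_Mapping.keys (e - Poly_Mapping.single x 1) \<subseteq> Y \<longleftrightarrow> Poly_Mapping.keys e \<subseteq> Y"
  for e :: "'x \<Rightarrow>\<^sub>0 nat"
  by (auto simp: in_keys_iff lookup_minus lookup_single when_def subset_iff split: if_splits)

lemma to_mfps_simps:
  "to_mfps x y (f + g) = to_mfps x y f + to_mfps x y g"
  "to_mfps x y (f - g) = to_mfps x y f - to_mfps x y g"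
  "x \<noteq> y \<Longrightarrow> no_poles f \<Longrightarrow> to_mfps x y (fu * f) = mvar x * to_mfps x y f"
  "x \<noteq> y \<Longrightarrow> to_mfps x y (fv * f) = mvar y * to_mfps x y f"
  "to_mfps x y (fh * f) = mconst (fps_X *\<^sub>h 1) * to_mfps x y f"
proof -
  show "to_mfps x y (f + g) = to_mfps x y f + to_mfps x y g"
    by (rule mfps_eqI) (simp add: to_mfps_def ser_coeff_simps)
  show "to_mfps x y (f - g) = to_mfps x y f - to_mfps x y g"
    by (rule mfps_eqI) (simp add: to_mfps_def ser_coeff_simps)
  show "to_mfps x y (fh * f) = mconst (fps_X *\<^sub>h 1) * to_mfps x y f"
    by (rule mfps_eqI) (simp add: to_mfps_def ser_coeff_simps mconst_mult hRA_mult)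
  assume xy: "x \<noteq> y"
  show "to_mfps x y (fv * f) = mvar y * to_mfps x y f"
  proof (rule mfps_eqI)
    fix e
    show "mcoeff (to_mfps x y (fv * f)) e = mcoeff (mvar y * to_mfps x y f) e"
    proof (cases "Poly_Mapping.lookup e y = 0")
      case True
      then show ?thesis by (simp add: mcoeff_mvar_times to_mfps_def ser_coeff_simps)
    next
      case False
      then show ?thesis using xy keys_diff_single[OF False, of "{x, y}"]
        by (simp add: mcoeff_mvar_times to_mfps_def ser_coeff_simps lookup_minus lookup_single)
    qed
  qed
  assume f: "no_poles f"
  have neg: "ser_coeff (- 1) b f = 0" for b
  proof -
    have "Abs_fps (\<lambda>k. f $ k $ b $$ (- 1)) = 0"
      using f by (simp add: no_poles_def fps_eq_iff)
    then show ?thesis by (simp add: ser_coeff_def zero_RA_def)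
  qed
  show "to_mfps x y (fu * f) = mvar x * to_mfps x y f"
  proof (rule mfps_eqI)
    fix e
    show "mcoeff (to_mfps x y (fu * f)) e = mcoeff (mvar x * to_mfps x y f) e"
    proof (cases "Poly_Mapping.lookup e x = 0")
      case True
      then show ?thesis by (simp add: mcoeff_mvar_times to_mfps_def ser_coeff_simps neg)
    next
      case False
      then have "int (Poly_Mapping.lookup e x) - 1 = int (Poly_Mapping.lookup e x - 1)" by simp
      then show ?thesis using False xy keys_diff_single[OF False, of "{x, y}"]
        by (simp add: mcoeff_mvar_times to_mfps_def ser_coeff_simps lookup_minus lookup_single)
    qed
  qed
qed

lemma Lu_Lv_nth:
  "(Lu i j * Lv i' j') $ k $ b $$ a = (if k = 0 \<and> a \<ge> 0 then fgen (nat a) i j * fgen b i' j' else 0)"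
  "(Lv i' j' * Lu i j) $ k $ b $$ a = (if k = 0 \<and> a \<ge> 0 then fgen b i' j' * fgen (nat a) i j else 0)"
  by (auto simp: Lu_def Lv_def)

lemma no_poles_L: "no_poles (Lu i j * Lv i' j')" "no_poles (Lv i' j' * Lu i j)"
  by (auto simp: no_poles_def Lu_Lv_nth)

lemma mcoeff_mseries_times:
  fixes c d :: "nat \<Rightarrow> 'a::semiring_0"
  assumes "x \<noteq> y"
  shows "mcoeff (mseries x c * mseries y d) e =
    (if Poly_Mapping.keys e \<subseteq> {x, y} then c (Poly_Mapping.lookup e x) * d (Poly_Mapping.lookup e y) else 0)"
proof (cases "Poly_Mapping.keys e \<subseteq> {x, y}")
  case True
  let ?a = "Poly_Mapping.single x (Poly_Mapping.lookup e x)" and ?b = "Poly_Mapping.single y (Poly_Mapping.lookup e y)"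
  have e: "e = ?a + ?b"
    using True assms by (intro poly_mapping_eqI) (auto simp: lookup_add lookup_single when_def in_keys_iff)
  have "mcoeff (mseries x c * mseries y d) (?a + ?b) = mcoeff (mseries x c) ?a * mcoeff (mseries y d) ?b"
    unfolding times_mfps_def
    by (rule mcoeff_mconv_disjoint[where Y = "{x}" and Z = "{y}"]) (use assms in \<open>auto dest: keys_mseries\<close>)
  with True show ?thesis by (simp flip: e)
next
  case False
  have "mcoeff (mseries x c * mseries y d) e = (\<Sum>(a, b) | a + b = e. 0)"
    unfolding mcoeff_mult
  proof (intro sum.cong refl, clarify)
    fix a b assume e: "e = a + b"
    have "mcoeff (mseries x c) a = 0 \<or> mcoeff (mseries y d) b = 0"
    proof (rule ccontr)
      assume "\<not> ?thesis"
      then have "Poly_Mapping.keys a \<subseteq> {x}" "Poly_Mapping.keys b \<subseteq> {y}" by (auto dest: keys_mseries)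
      then have "Poly_Mapping.keys e \<subseteq> {x, y}"
        unfolding e using Poly_Mapping.keys_add[of a b] by blast
      with False show False by simp
    qed
    then show "mcoeff (mseries x c) a * mcoeff (mseries y d) b = 0" by auto
  qed
  with False show ?thesis by simp
qed

lemma to_mfps_L:
  assumes "x \<noteq> y"
  shows "to_mfps x y (Lu i j * Lv i' j') = mseries x (\<lambda>s. lgen s i j) * mseries y (\<lambda>s. lgen s i' j')"
    and "to_mfps x y (Lv i' j' * Lu i j) = mseries y (\<lambda>s. lgen s i' j') * mseries x (\<lambda>s. lgen s i j)"
proof -
  have c: "Abs_fps (\<lambda>k. if k = 0 then p else 0) = fps_const p" for p :: "'n free_alg"
    by (simp add: fps_eq_iff)
  show "to_mfps x y (Lu i j * Lv i' j') = mseries x (\<lambda>s. lgen s i j) * mseries y (\<lambda>s. lgen s i' j')"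
    by (rule mfps_eqI)
      (simp add: mcoeff_mseries_times[OF assms] to_mfps_def ser_coeff_def Lu_Lv_nth c lgen.abs_eq times_RA.abs_eq)
  show "to_mfps x y (Lv i' j' * Lu i j) = mseries y (\<lambda>s. lgen s i' j') * mseries x (\<lambda>s. lgen s i j)"
    by (rule mfps_eqI)
      (simp add: mcoeff_mseries_times[OF assms[symmetric]] to_mfps_def ser_coeff_def Lu_Lv_nth c lgen.abs_eq times_RA.abs_eq insert_commute)
qed

text \<open>
  Multiplication by \<open>p\<close> over the free algebra corresponds to multiplication by \<open>q\<close> over \<open>A(R\<^sup>-)\<close>.
\<close>

definition acts_as :: "'x \<Rightarrow> 'x \<Rightarrow> 'n::finite free_alg ser \<Rightarrow> ('x, 'n RA) mfps \<Rightarrow> bool" where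
  "acts_as x y p q \<longleftrightarrow> (\<forall>f. no_poles f \<longrightarrow> no_poles (p * f) \<and> to_mfps x y (p * f) = q * to_mfps x y f)"

lemma acts_as_simps:
  "acts_as x y p q \<Longrightarrow> acts_as x y p' q' \<Longrightarrow> acts_as x y (p + p') (q + q')"
  "acts_as x y p q \<Longrightarrow> acts_as x y p' q' \<Longrightarrow> acts_as x y (p - p') (q - q')"
  "x \<noteq> y \<Longrightarrow> acts_as x y fu (mvar x)"
  "x \<noteq> y \<Longrightarrow> acts_as x y fv (mvar y)"
  "acts_as x y fh (mconst (fps_X *\<^sub>h 1))"
  by (auto simp: acts_as_def to_mfps_simps no_poles_def fu_nth fv_nth fh_nth distrib_right left_diff_distrib mult.assoc)

text \<open>
  The polynomial relation as an identity of power series over \<open>A(R\<^sup>-)\<close> in two variables \<open>x\<close> (for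
  \<open>u\<close>) and \<open>y\<close> (for \<open>v\<close>), ready for substitution.
\<close>

lemma mfps_relation:
  fixes i i' j j' :: "'n::finite" and x y :: 'x
  assumes xy: "x \<noteq> y"
  defines "D \<equiv> mvar x - mvar y :: ('x, 'n RA) mfps" and "H \<equiv> mconst (fps_X *\<^sub>h 1) :: ('x, 'n RA) mfps"
    and "L \<equiv> \<lambda>x i j. mseries x (\<lambda>s. lgen s i j) :: ('x, 'n RA) mfps"
  shows "(D + H) * (D * (L x i j * L y i' j') + H * (L x i' j * L y i j'))
      + (H - D) * (D * (L y i' j' * L x i j) - H * (L y i' j * L x i j')) = 0"
proof -
  define d where "d = (fu - fv :: 'n free_alg ser)"
  have d: "acts_as x y d D" "acts_as x y (d + fh) (D + H)" "acts_as x y (fh - d) (H - D)"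
    and h: "acts_as x y fh H"
    unfolding d_def D_def H_def by (intro acts_as_simps xy)+
  have act: "no_poles f \<Longrightarrow> to_mfps x y (p * f) = q * to_mfps x y f"
    "no_poles f \<Longrightarrow> no_poles (p * f)" if "acts_as x y p q" for p q f
    using that by (simp_all add: acts_as_def)
  have np: "no_poles (f + g)" "no_poles (f - g)" if "no_poles f" "no_poles g" for f g :: "'n free_alg ser"
    using that by (simp_all add: no_poles_def)
  have LL: "to_mfps x y (Lu i j * Lv i' j') = L x i j * L y i' j'"
    "to_mfps x y (Lv i' j' * Lu i j) = L y i' j' * L x i j" for i i' j j'
    unfolding L_def using to_mfps_L[OF xy] by blast+
  let ?e = "(d + fh) * (d * (Lu i j * Lv i' j') + fh * (Lu i' j * Lv i j'))
     + (fh - d) * (d * (Lv i' j' * Lu i j) - fh * (Lv i' j * Lu i j'))"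
  have "null_ser (0 - ?e)"
    using polynomial_relation[of i j i' j'] by (simp add: d_def algebra_simps)
  then have "ser_coeff a b ?e = 0" for a b
    unfolding null_ser_def ser_coeff_simps(2,3) by simp
  then have "to_mfps x y ?e = 0"
    by (intro mfps_eqI) (simp add: to_mfps_def)
  moreover have "to_mfps x y ?e = (D + H) * (D * (L x i j * L y i' j') + H * (L x i' j * L y i j'))
      + (H - D) * (D * (L y i' j' * L x i j) - H * (L y i' j * L x i j'))"
    unfolding LL[symmetric]
    by (simp only: to_mfps_simps(1,2) act[OF d(1)] act[OF d(2)] act[OF d(3)] act[OF h] no_poles_L np)
  ultimately show ?thesis by simp
qed

lemma substituted_mvar_V:
  assumes "j < m"
  shows "shift.substituted n m (mvar (V j) :: (vars, 'a::{hmodule, ring_1}) mfps)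
     (mvar (V 0) - mconst ((of_nat j * fps_X) *\<^sub>h 1))"
proof -
  have "map_coeffs (\<lambda>c. c *\<^sub>h 1) (shift_subst n m (V j)) = (mvar (V 0) - mconst ((of_nat j * fps_X) *\<^sub>h 1) :: (vars, 'a) mfps)"
  proof (rule mfps_eqI)
    fix e
    have m: "(c - d) *\<^sub>h (1 :: 'a) = c *\<^sub>h 1 - d *\<^sub>h 1" for c d
      using hscale_add_left[of "c - d" d "1 :: 'a"] by (simp add: eq_diff_eq)
    show "mcoeff (map_coeffs (\<lambda>c. c *\<^sub>h 1) (shift_subst n m (V j))) e =
        mcoeff (mvar (V 0) - mconst ((of_nat j * fps_X) *\<^sub>h (1 :: 'a))) e"
      using assms by (simp add: map_coeffs_def shift_subst_def mvar_def mseries_def mconst_def m hscale_one)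
  qed
  moreover have "V j \<in> shift_vars n m" using assms by (simp add: shift_vars_def)
  ultimately show ?thesis using shift.substituted_mvar by metis
qed

text \<open>
  This is the series \<open>l\<^sub>i\<^sub>j(v - k h)\<close>, with \<open>V 0\<close> standing for \<open>v\<close>.
\<close>

definition shifted_L :: "nat \<Rightarrow> 'n::finite \<Rightarrow> 'n \<Rightarrow> (vars, 'n RA) mfps" where
  "shifted_L k i j = mseries (V 0) (lshift_coeff k i j)"

text \<open>
  After the substitution, \<open>v\<^sub>k\<close> and \<open>v\<^sub>k\<^sub>+\<^sub>1\<close> differ by \<open>h\<close>. With \<open>u = v\<^sub>k\<close> and \<open>v = v\<^sub>k\<^sub>+\<^sub>1\<close> the
  second summand of the relation loses its factor \<open>h - (u - v)\<close> and the first becomes \<open>2 h\<^sup>2\<close>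
  times the row identity. Exchanging the roles of the two variables removes the first summand
  instead and gives the column identity.
\<close>

lemma fusion:
  fixes i i' j j' :: "'n::finite"
  shows "shifted_L k i j * shifted_L (Suc k) i' j' + shifted_L k i' j * shifted_L (Suc k) i j' = 0" (is ?rows)
    and "shifted_L k i j * shifted_L (Suc k) i' j' + shifted_L k i j' * shifted_L (Suc k) i' j = 0" (is ?columns)
proof -
  let ?H = "mconst (fps_X *\<^sub>h 1) :: (vars, 'n RA) mfps"
  note times = shift.substituted_times[OF hbilinear_times_RA]
  have sL: "shift.substituted 0 (k + 2) (mseries (V l) (\<lambda>s. lgen s p q)) (shifted_L l p q)"
    if "l < k + 2" for l and p q :: 'n
    unfolding shifted_L_def using that by (rule substituted_V)
  have sH: "shift.substituted 0 (k + 2) ?H ?H" by (rule shift.substituted_mconst)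
  let ?c = "\<lambda>l. mconst ((of_nat l * fps_X) *\<^sub>h 1) :: (vars, 'n RA) mfps"
  have "(of_nat (Suc k) * fps_X) *\<^sub>h (1 :: 'n RA) = fps_X *\<^sub>h 1 + (of_nat k * fps_X) *\<^sub>h 1"
    by (simp only: of_nat_Suc distrib_right mult_1 hscale_add_left)
  then have c: "?c (Suc k) = ?H + ?c k" by (simp only: mconst_add)
  have V: "shift.substituted 0 (k + 2) (mvar (V l)) (mvar (V 0) - ?c l)" if "l < k + 2" for l
    using that by (rule substituted_mvar_V)
  have "shift.substituted 0 (k + 2) (mvar (V k) - mvar (V (Suc k))) ((mvar (V 0) - ?c k) - (mvar (V 0) - ?c (Suc k)))"
    by (intro shift.substituted_diff V) simp_all
  then have sD: "shift.substituted 0 (k + 2) (mvar (V k) - mvar (V (Suc k))) ?H"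
    unfolding c by simp
  have "shift.substituted 0 (k + 2) (mvar (V (Suc k)) - mvar (V k)) ((mvar (V 0) - ?c (Suc k)) - (mvar (V 0) - ?c k))"
    by (intro shift.substituted_diff V) simp_all
  then have sD': "shift.substituted 0 (k + 2) (mvar (V (Suc k)) - mvar (V k)) (- ?H)"
    unfolding c by simp
  have cancel: "f = 0" if "?H * f + ?H * f = 0" for f
  proof (rule mfps_eqI)
    fix e
    have "fps_X *\<^sub>h (mcoeff f e + mcoeff f e) = 0"
      using arg_cong[OF that, of "\<lambda>g. mcoeff g e"] by (simp add: mconst_mult hRA_mult hscale_add_right)
    then have "mcoeff f e + mcoeff f e = 0" by (rule RA_torsion_free)
    from hmodule_no_2_torsion[OF this] show "mcoeff f e = mcoeff 0 e" by (simp only: mcoeff_zero)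
  qed
  have vanish: "g = 0" if "shift.substituted 0 (k + 2) f g" "f = 0" for f g :: "(vars, 'n RA) mfps"
    using shift.substituted_unique[OF hseparated_RA that(1)] that(2) shift.substituted_zero by metis
  let ?f = "shifted_L k i j * shifted_L (Suc k) i' j' + shifted_L k i' j * shifted_L (Suc k) i j'"
  have "(?H + ?H) * (?H * (shifted_L k i j * shifted_L (Suc k) i' j') + ?H * (shifted_L k i' j * shifted_L (Suc k) i j'))
     + (?H - ?H) * (?H * (shifted_L (Suc k) i' j' * shifted_L k i j) - ?H * (shifted_L (Suc k) i' j * shifted_L k i j')) = 0"
  proof (rule vanish)
    show "shift.substituted 0 (k + 2) (((mvar (V k) - mvar (V (Suc k))) + ?H) *
          ((mvar (V k) - mvar (V (Suc k))) * (mseries (V k) (\<lambda>s. lgen s i j) * mseries (V (Suc k)) (\<lambda>s. lgen s i' j'))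
            + ?H * (mseries (V k) (\<lambda>s. lgen s i' j) * mseries (V (Suc k)) (\<lambda>s. lgen s i j')))
       + (?H - (mvar (V k) - mvar (V (Suc k)))) *
          ((mvar (V k) - mvar (V (Suc k))) * (mseries (V (Suc k)) (\<lambda>s. lgen s i' j') * mseries (V k) (\<lambda>s. lgen s i j))
            - ?H * (mseries (V (Suc k)) (\<lambda>s. lgen s i' j) * mseries (V k) (\<lambda>s. lgen s i j'))))
      ((?H + ?H) * (?H * (shifted_L k i j * shifted_L (Suc k) i' j') + ?H * (shifted_L k i' j * shifted_L (Suc k) i j'))
     + (?H - ?H) * (?H * (shifted_L (Suc k) i' j' * shifted_L k i j) - ?H * (shifted_L (Suc k) i' j * shifted_L k i j')))"
      by (intro shift.substituted_add shift.substituted_diff times sL sH sD; simp)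
  qed (rule mfps_relation, simp)
  then have "?H * (?H * ?f) + ?H * (?H * ?f) = 0" by (simp add: algebra_simps)
  then have "?H * ?f = 0" by (rule cancel)
  then have "?H * ?f + ?H * ?f = 0" by simp
  then show ?rows by (rule cancel)
  let ?g = "shifted_L k i j * shifted_L (Suc k) i' j' + shifted_L k i j' * shifted_L (Suc k) i' j"
  have "(- ?H + ?H) * (- ?H * (shifted_L (Suc k) i' j' * shifted_L k i j) + ?H * (shifted_L (Suc k) i j' * shifted_L k i' j))
     + (?H - - ?H) * (- ?H * (shifted_L k i j * shifted_L (Suc k) i' j') - ?H * (shifted_L k i j' * shifted_L (Suc k) i' j)) = 0"
  proof (rule vanish)
    show "shift.substituted 0 (k + 2) (((mvar (V (Suc k)) - mvar (V k)) + ?H) *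
          ((mvar (V (Suc k)) - mvar (V k)) * (mseries (V (Suc k)) (\<lambda>s. lgen s i' j') * mseries (V k) (\<lambda>s. lgen s i j))
            + ?H * (mseries (V (Suc k)) (\<lambda>s. lgen s i j') * mseries (V k) (\<lambda>s. lgen s i' j)))
       + (?H - (mvar (V (Suc k)) - mvar (V k))) *
          ((mvar (V (Suc k)) - mvar (V k)) * (mseries (V k) (\<lambda>s. lgen s i j) * mseries (V (Suc k)) (\<lambda>s. lgen s i' j'))
            - ?H * (mseries (V k) (\<lambda>s. lgen s i j') * mseries (V (Suc k)) (\<lambda>s. lgen s i' j))))
      ((- ?H + ?H) * (- ?H * (shifted_L (Suc k) i' j' * shifted_L k i j) + ?H * (shifted_L (Suc k) i j' * shifted_L k i' j))
     + (?H - - ?H) * (- ?H * (shifted_L k i j * shifted_L (Suc k) i' j') - ?H * (shifted_L k i j' * shifted_L (Suc k) i' j)))"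
      by (intro shift.substituted_add shift.substituted_diff times sL sH sD'; simp)
  qed (rule mfps_relation, simp)
  moreover have "(?H - - ?H) * (- ?H * a - ?H * b) = - (?H * (?H * (a + b)) + ?H * (?H * (a + b)))" for a b
    by (simp add: algebra_simps)
  ultimately have "?H * (?H * ?g) + ?H * (?H * ?g) = 0"
    by (simp only: left_minus mult_zero_left add_0 neg_equal_0_iff_equal)
  then have "?H * ?g = 0" by (rule cancel)
  then have "?H * ?g + ?H * ?g = 0" by simp
  then show ?columns by (rule cancel)
qed


section \<open>The action of \<open>R\<close>-matrices on antisymmetric families\<close>

definition swap_at :: "nat \<Rightarrow> nat \<Rightarrow> 'n list \<Rightarrow> 'n list" where
  "swap_at i j I = I[i := I ! j, j := I ! i]"

lemma length_swap_at [simp]: "length (swap_at i j I) = length I"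
  by (simp add: swap_at_def)

lemma swap_at_idx: "I \<in> idx p \<Longrightarrow> swap_at i j I \<in> idx p"
  by (simp add: idx_def)

lemma nth_swap_at:
  "i < length I \<Longrightarrow> j < length I \<Longrightarrow> l < length I \<Longrightarrow>
    swap_at i j I ! l = (if l = j then I ! i else if l = i then I ! j else I ! l)"
  by (simp add: swap_at_def nth_list_update)

lemma swap_at_involutive:
  assumes "I \<in> idx p" "i < p" "j < p"
  shows "swap_at i j (swap_at i j I) = I"
  using assms by (intro nth_equalityI) (auto simp: nth_swap_at idx_def)

lemma swap_at_eq_iff:
  assumes "I \<in> idx p" "J \<in> idx p" "i < p" "j < p"
  shows "I = swap_at i j J \<longleftrightarrow> J = swap_at i j I"
  using assms swap_at_involutive by metis

lemma swap_at_same: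
  assumes "I \<in> idx p" "i < p" "j < p" "I ! i = I ! j"
  shows "swap_at i j I = I"
  using assms by (intro nth_equalityI) (auto simp: nth_swap_at idx_def)

lemma swap_at_swap_at:
  assumes "I \<in> idx p" "i < p" "j < p" "k < p" "i \<noteq> j" "i \<noteq> k" "j \<noteq> k"
  shows "swap_at i j (swap_at i k I) = swap_at j k (swap_at i j I)"
    and "swap_at i k I = swap_at j k (swap_at i j (swap_at j k I))"
  using assms by (auto intro!: nth_equalityI simp: nth_swap_at idx_def)

lemma finite_idx [simp]: "finite (idx p :: 'n::finite list set)"
  unfolding idx_def using finite_lists_length_eq[of "UNIV :: 'n set" p] by simp

lemma sum_idx_delta: "(\<Sum>K\<in>idx p. if K = I then f K else 0) = (if I \<in> idx p then f I else 0)"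
  for I :: "'n::finite list"
  by (simp add: sum.delta)

text \<open>
  For a fixed list \<open>K\<close>, an additive map \<open>W K\<close> from the commutative ring \<open>'r\<close> to \<open>'g\<close> is an element
  of the \<open>'r\<close>-module of all additive maps, where \<open>r\<close> acts by multiplying the argument. So \<open>W\<close> is a
  vector with entries in an \<open>'r\<close>-module, and matrices over \<open>'r\<close> act on it. The example of interest
  is \<open>g \<mapsto> w\<^sub>K \<otimes> g\<close>: this avoids a module structure over \<open>\<complex>((z))[[h]]\<close> on the completed tensor
  product.
\<close>

definition additive_family :: "('n list \<Rightarrow> 'r::comm_ring_1 \<Rightarrow> 'g::ab_group_add) \<Rightarrow> bool" where
  "additive_family W \<longleftrightarrow> (\<forall>K a b. W K (a + b) = W K a + W K b)"

lemma additive_family_add: "additive_family W \<Longrightarrow> W K (a + b) = W K a + W K b"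
  by (simp add: additive_family_def)

lemma additive_family_zero: "additive_family W \<Longrightarrow> W K 0 = 0"
  using additive_family_add[of W K 0 0] by simp

lemma additive_family_diff: "additive_family W \<Longrightarrow> W K (a - b) = W K a - W K b"
  using additive_family_add[of W K "a - b" b] by simp

lemma additive_family_sum: "additive_family W \<Longrightarrow> W K (sum f A) = (\<Sum>a\<in>A. W K (f a))"
  by (induction A rule: infinite_finite_induct) (simp_all add: additive_family_zero additive_family_add)

definition mat_act ::
  "nat \<Rightarrow> ('n, 'r::comm_ring_1) tmat \<Rightarrow> ('n list \<Rightarrow> 'r \<Rightarrow> 'g::ab_group_add) \<Rightarrow> 'n list \<Rightarrow> 'r \<Rightarrow> 'g" where
  "mat_act p A W I g = (\<Sum>K\<in>idx p. W K (A I K * g))"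

lemma additive_mat_act: "additive_family W \<Longrightarrow> additive_family (mat_act p A W)"
  unfolding additive_family_def mat_act_def by (simp add: distrib_left sum.distrib)

lemma mat_act_tone:
  "additive_family W \<Longrightarrow> I \<in> idx p \<Longrightarrow> mat_act p tone W I g = W I g" for I :: "'n::finite list"
proof -
  assume W: "additive_family W" and I: "I \<in> idx p"
  have "mat_act p tone W I g = (\<Sum>K\<in>idx p. if K = I then W K g else 0)"
    unfolding mat_act_def by (intro sum.cong) (auto simp: tone_def additive_family_zero[OF W])
  then show ?thesis using I by simp
qed

lemma mat_act_tmult:
  assumes "additive_family W"
  shows "mat_act p (tmult p A B) W I g = mat_act p A (mat_act p B W) I g"
proof -
  have "mat_act p (tmult p A B) W I g = (\<Sum>K\<in>idx p. \<Sum>L\<in>idx p. W K (A I L * B L K * g))"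
    unfolding mat_act_def tmult_def sum_distrib_right by (simp add: additive_family_sum[OF assms])
  also have "\<dots> = mat_act p A (mat_act p B W) I g"
    unfolding mat_act_def by (subst sum.swap) (simp add: mult_ac)
  finally show ?thesis .
qed

lemma mat_act_cong:
  "(\<And>K. K \<in> idx p \<Longrightarrow> W K = W' K) \<Longrightarrow> mat_act p A W = mat_act p A W'"
  unfolding mat_act_def by (intro ext sum.cong refl) simp

lemma additive_foldr: "additive_family W \<Longrightarrow> additive_family (foldr (mat_act p) Xs W)"
  by (induction Xs) (simp_all add: additive_mat_act)

lemma mat_act_tprod:
  fixes I :: "'n::finite list"
  assumes W: "additive_family W" and I: "I \<in> idx p"
  shows "mat_act p (tprod p Xs) W I = foldr (mat_act p) Xs W I"
  using I
proof (induction Xs arbitrary: I)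
  case Nil
  then show ?case by (intro ext) (simp add: tprod_def mat_act_tone[OF W])
next
  case (Cons X Xs)
  have "mat_act p (tprod p (X # Xs)) W I = mat_act p X (mat_act p (tprod p Xs) W) I"
    by (intro ext) (simp add: tprod_def mat_act_tmult[OF W])
  also have "\<dots> = mat_act p X (foldr (mat_act p) Xs W) I"
    by (rule fun_cong[OF mat_act_cong]) (rule Cons.IH)
  finally show ?case by simp
qed

text \<open>
  Transposition reverses the order of a product of matrices and fixes the symmetric factors.
\<close>

lemma mat_act_transpose_tprod:
  fixes J :: "'n::finite list"
  assumes W: "additive_family W" and J: "J \<in> idx p"
    and sym: "\<And>X I J. X \<in> set Xs \<Longrightarrow> I \<in> idx p \<Longrightarrow> J \<in> idx p \<Longrightarrow> X I J = X J I"
  shows "mat_act p (\<lambda>J I. tprod p Xs I J) W J = foldr (mat_act p) (rev Xs) W J"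
  using W J sym
proof (induction Xs arbitrary: W)
  case Nil
  then have "mat_act p (\<lambda>J I. tone I J) W J = mat_act p tone W J"
    unfolding mat_act_def tone_def by (intro ext sum.cong refl) auto
  with Nil show ?case by (intro ext) (simp add: tprod_def mat_act_tone)
next
  case (Cons X Xs)
  have X: "mat_act p (\<lambda>J I. X I J) W K = mat_act p X W K" if "K \<in> idx p" for K
    unfolding mat_act_def using that Cons.prems(3) by (intro ext sum.cong refl) simp
  have "mat_act p (\<lambda>J I. tprod p (X # Xs) I J) W J = mat_act p (tmult p (\<lambda>J I. tprod p Xs I J) (\<lambda>J I. X I J)) W J"
    unfolding mat_act_def tprod_def tmult_def
    by (simp add: mult.commute)
  also have "\<dots> = mat_act p (\<lambda>J I. tprod p Xs I J) (mat_act p (\<lambda>J I. X I J) W) J"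
    by (intro ext mat_act_tmult Cons.prems)
  also have "\<dots> = mat_act p (\<lambda>J I. tprod p Xs I J) (mat_act p X W) J"
    by (rule fun_cong[OF mat_act_cong]) (rule X)
  also have "\<dots> = foldr (mat_act p) (rev Xs) (mat_act p X W) J"
    by (rule Cons.IH) (use Cons.prems in \<open>auto intro: additive_mat_act\<close>)
  finally show ?case by simp
qed

definition antisymmetric_on :: "nat \<Rightarrow> nat set \<Rightarrow> ('n list \<Rightarrow> 'g::uminus) \<Rightarrow> bool" where
  "antisymmetric_on p B W \<longleftrightarrow>
     (\<forall>K\<in>idx p. \<forall>j\<in>B. \<forall>k\<in>B. j \<noteq> k \<longrightarrow> W (swap_at j k K) = - W K)"

lemma antisymmetric_onD:
  "antisymmetric_on p B W \<Longrightarrow> K \<in> idx p \<Longrightarrow> j \<in> B \<Longrightarrow> k \<in> B \<Longrightarrow> j \<noteq> k \<Longrightarrow> W (swap_at j k K) = - W K"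
  by (simp add: antisymmetric_on_def)

lemma swap_at_commute: "I \<in> idx p \<Longrightarrow> i < p \<Longrightarrow> j < p \<Longrightarrow> swap_at i j I = swap_at j i I"
  by (intro nth_equalityI) (auto simp: nth_swap_at idx_def)

text \<open>
  The exchange of \<open>j\<close> and \<open>k + 1\<close> is the exchange of \<open>j\<close> and \<open>k\<close> conjugated by that of \<open>k\<close> and
  \<open>k + 1\<close>, hence a product of an odd number of adjacent exchanges.
\<close>

lemma antisymmetric_adjacent:
  fixes W :: "'n list \<Rightarrow> 'g::group_add"
  assumes adj: "\<And>K j. K \<in> idx p \<Longrightarrow> Suc j < p \<Longrightarrow> W (swap_at j (Suc j) K) = - W K"
  shows "antisymmetric_on p {..<p} W"
proof -
  have less: "W (swap_at j (Suc (j + d)) K) = - W K" if "Suc (j + d) < p" "K \<in> idx p" for j d and K :: "'n list"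
    using that
  proof (induction d arbitrary: K)
    case 0
    then show ?case by (simp add: adj)
  next
    case (Suc d)
    let ?k = "Suc (j + d)"
    have "swap_at j (Suc ?k) K = swap_at ?k (Suc ?k) (swap_at j ?k (swap_at ?k (Suc ?k) K))"
      using Suc.prems by (intro swap_at_swap_at(2)) auto
    then have "W (swap_at j (Suc ?k) K) = - (- (- W K))"
      using Suc.prems by (simp add: adj Suc.IH swap_at_idx)
    then show ?case by simp
  qed
  show ?thesis
    unfolding antisymmetric_on_def
  proof (intro ballI impI)
    fix K :: "'n list" and j k assume K: "K \<in> idx p" and jk: "j \<in> {..<p}" "k \<in> {..<p}" "j \<noteq> k"
    show "W (swap_at j k K) = - W K"
    proof (cases "j < k")
      case True
      then obtain d where "k = Suc (j + d)" using less_imp_Suc_add by blast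
      with less K jk show ?thesis by simp
    next
      case False
      with jk obtain d where "j = Suc (k + d)" using less_imp_Suc_add[of k j] by auto
      have "swap_at j k K = swap_at k j K" using K jk by (intro swap_at_commute) auto
      with less[of k d K] K jk \<open>j = Suc (k + d)\<close> show ?thesis by simp
    qed
  qed
qed

text \<open>
  On tensors antisymmetric in the \<open>N\<close> factors \<open>B\<close>, the operator \<open>\<Sum>\<^sub>j P\<^sub>i\<^sub>j\<close> is the identity. Among
  the \<open>N + 1\<close> entries of \<open>I\<close> at \<open>i\<close> and at \<open>B\<close> two agree. If both positions lie in \<open>B\<close>, then \<open>W I\<close>
  vanishes, as do all summands but two, and these two cancel. If one position is \<open>i\<close>, then all
  summands vanish except possibly that of the other one, and exchanging the two equal entries
  leaves \<open>I\<close> unchanged.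
\<close>

lemma sum_swaps:
  fixes W :: "'n::finite list \<Rightarrow> 'g::ab_group_add"
  assumes no2: "\<And>x :: 'g. x + x = 0 \<Longrightarrow> x = 0"
    and anti: "antisymmetric_on p B W"
    and B: "B \<subseteq> {..<p}" "card B = CARD('n)" and i: "i < p" "i \<notin> B" and I: "I \<in> idx p"
  shows "(\<Sum>j\<in>B. W (swap_at i j I)) = W I"
proof -
  have fin: "finite B" using B finite_subset by blast
  have zero: "W K = 0" if "K \<in> idx p" "j \<in> B" "k \<in> B" "j \<noteq> k" "K ! j = K ! k" for j k and K :: "'n list"
  proof -
    have "swap_at j k K = K" using that B by (intro swap_at_same) auto
    then have "W K = - W K" using antisymmetric_onD[OF anti, of K j k] that by simp
    then have "W K + W K = 0" by (simp only: eq_neg_iff_add_eq_0)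
    then show ?thesis by (rule no2)
  qed
  have "\<not> inj_on (\<lambda>l. I ! l) (insert i B)"
  proof
    assume "inj_on (\<lambda>l. I ! l) (insert i B)"
    then have "card (insert i B) \<le> CARD('n)"
      by (rule card_inj_on_le) simp_all
    with B i fin show False by simp
  qed
  then obtain a b where ab: "a \<in> insert i B" "b \<in> insert i B" "a \<noteq> b" "I ! a = I ! b"
    unfolding inj_on_def by blast
  then consider "a \<in> B" "b \<in> B" | k where "k \<in> B" "I ! i = I ! k"
    by (cases "a = i"; cases "b = i") auto
  then show ?thesis
  proof cases
    case 1
    have other: "W (swap_at i l I) = 0" if "l \<in> B - {a} - {b}" for l
      using that 1 ab B i I
      by (intro zero[of _ a b] swap_at_idx) (auto simp: nth_swap_at idx_def subset_iff)
    have "swap_at i a I = swap_at b a (swap_at i b I)"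
      using 1 ab B i I by (intro nth_equalityI) (auto simp: nth_swap_at idx_def subset_iff)
    moreover have "W (swap_at b a (swap_at i b I)) = - W (swap_at i b I)"
      using 1 ab by (intro antisymmetric_onD[OF anti] swap_at_idx[OF I]) auto
    ultimately have "W (swap_at i a I) + W (swap_at i b I) = 0"
      by (simp only: left_minus)
    moreover have "(\<Sum>j\<in>B. W (swap_at i j I)) = W (swap_at i a I) + (W (swap_at i b I) + (\<Sum>j\<in>B - {a} - {b}. W (swap_at i j I)))"
      using sum.remove[of B a "\<lambda>j. W (swap_at i j I)"] sum.remove[of "B - {a}" b "\<lambda>j. W (swap_at i j I)"] 1 ab fin
      by (simp only: finite_Diff Diff_iff singleton_iff simp_thms not_sym)
    moreover have "(\<Sum>j\<in>B - {a} - {b}. W (swap_at i j I)) = 0"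
      using other by (intro sum.neutral) blast
    ultimately have "(\<Sum>j\<in>B. W (swap_at i j I)) = 0"
      by (simp only: add_0_right)
    with zero[of I a b] 1 ab I show ?thesis by simp
  next
    case 2
    have k: "k < p" "k \<noteq> i" using 2 B i by auto
    have "W (swap_at i l I) = 0" if l: "l \<in> B - {k}" for l
    proof (rule zero[of _ l k])
      show "swap_at i l I \<in> idx p" by (rule swap_at_idx[OF I])
      show "l \<in> B" "k \<in> B" "l \<noteq> k" using l 2 by auto
      have "l < p" "l \<noteq> i" using l B i by auto
      with k l I i(1) show "swap_at i l I ! l = swap_at i l I ! k"
        by (simp add: nth_swap_at idx_def 2)
    qed
    then have "(\<Sum>j\<in>B - {k}. W (swap_at i j I)) = 0"
      by (intro sum.neutral) blast
    then have "(\<Sum>j\<in>B. W (swap_at i j I)) = W (swap_at i k I)"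
      using sum.remove[OF fin 2(1), of "\<lambda>j. W (swap_at i j I)"] by simp
    also have "swap_at i k I = I"
      by (rule swap_at_same[OF I i(1) k(1) 2(2)])
    finally show ?thesis .
  qed
qed

lemma tperm_swap_at: "tperm i j I J = (if I = swap_at i j J then 1 else 0)"
  by (simp add: tperm_def swap_at_def)

lemma mat_act_Rminus:
  fixes I :: "'n::finite list"
  assumes W: "additive_family W" and x: "x * rinv x = 1" and I: "I \<in> idx p" and ij: "i < p" "j < p"
  shows "mat_act p (Rminus h x i j) W I g =
    W I (rinv (x + h) * x * g) - W (swap_at i j I) (rinv (x + h) * h * g)"
proof -
  have "W K (Rminus h x i j I K * g) =
      (if K = I then W K (rinv (x + h) * x * g) else 0) - (if K = swap_at i j I then W K (rinv (x + h) * h * g) else 0)"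
    if "K \<in> idx p" for K
  proof -
    have "Rminus h x i j I K * g =
        (if K = I then rinv (x + h) * x * g else 0) - (if K = swap_at i j I then rinv (x + h) * h * g else 0)"
      using swap_at_eq_iff[OF I that ij]
      by (simp add: Rminus_eq[OF x] tone_def tperm_swap_at algebra_simps)
    then show ?thesis
      by (simp add: additive_family_diff[OF W] additive_family_zero[OF W])
  qed
  then have "mat_act p (Rminus h x i j) W I g = (\<Sum>K\<in>idx p. (if K = I then W K (rinv (x + h) * x * g) else 0)
      - (if K = swap_at i j I then W K (rinv (x + h) * h * g) else 0))"
    unfolding mat_act_def by (intro sum.cong) auto
  with I show ?thesis by (simp add: sum_subtractf sum_idx_delta swap_at_idx)
qed

text \<open>
  With \<open>m = N\<close>, the product of the factors from \<open>k\<close> on maps \<open>W\<close> to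
  \<open>(x\<^sub>k W - h \<Sum>\<^sub>j\<^sub>\<ge>\<^sub>k P\<^sub>i\<^sub>j W) / x\<^sub>m\<close>, by descending induction on \<open>k\<close>. The normalising factors
  telescope because \<open>x\<^sub>k + h = x\<^sub>k\<^sub>+\<^sub>1\<close>, and products of two exchanges reduce to one because
  \<open>P\<^sub>i\<^sub>k P\<^sub>i\<^sub>j W = - P\<^sub>i\<^sub>j W\<close> for antisymmetric \<open>W\<close>. For \<open>k = 0\<close> the sum of exchanges is the
  identity.
\<close>

lemma mat_act_row:
  fixes W :: "'n::finite list \<Rightarrow> 'r::comm_ring_1 \<Rightarrow> 'g::ab_group_add"
  assumes W: "additive_family W" and no2: "\<And>x :: 'g. x + x = 0 \<Longrightarrow> x = 0"
    and anti: "\<And>g. antisymmetric_on p {s..<s + CARD('n)} (\<lambda>K. W K g)"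
    and p: "s + CARD('n) \<le> p" "i < s"
    and x: "\<And>k. x (Suc k) = x k + h" "\<And>k. x k * rinv (x k) = 1"
    and I: "I \<in> idx p"
  shows "foldr (mat_act p) (map (\<lambda>k. Rminus h (x k) i (s + k)) [0..<CARD('n)]) W I g =
     W I ((x 0 - h) * rinv (x CARD('n)) * g)"
proof -
  let ?m = "CARD('n)"
  let ?d = "rinv (x ?m)"
  let ?F = "\<lambda>k. foldr (mat_act p) (map (\<lambda>k. Rminus h (x k) i (s + k)) [k..<?m]) W"
  have part: "?F k I g = W I (?d * x k * g) - (\<Sum>j\<in>{k..<?m}. W (swap_at i (s + j) I) (?d * h * g))"
    if "k \<le> ?m" "I \<in> idx p" for k I g
    using that
  proof (induction arbitrary: I g rule: inc_induct)
    case base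
    then show ?case by (simp add: x mult.commute[of "rinv _"])
  next
    case (step k)
    let ?e = "rinv (x (Suc k))" and ?K = "swap_at i (s + k) I"
    have e: "?d * x (Suc k) * (?e * y * g) = ?d * y * g" for y g
    proof -
      have "?d * x (Suc k) * (?e * y * g) = (x (Suc k) * ?e) * (?d * y * g)" by (simp only: mult_ac)
      then show ?thesis by (simp only: x(2) mult_1)
    qed
    have e': "?e * (x k + h) = 1"
      using x(2)[of "Suc k"] by (simp add: x(1) mult.commute)
    have K: "?K \<in> idx p" using step.prems by (rule swap_at_idx)
    have "?F k I g = mat_act p (Rminus h (x k) i (s + k)) (?F (Suc k)) I g"
      using step.hyps by (simp add: upt_conv_Cons)
    also have "\<dots> = ?F (Suc k) I (?e * x k * g) - ?F (Suc k) ?K (?e * h * g)"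
      using step p by (subst mat_act_Rminus) (auto intro: additive_foldr W x(2) simp: x(1))
    also have "?F (Suc k) I (?e * x k * g) = W I (?d * x k * g)
        - (\<Sum>j\<in>{Suc k..<?m}. W (swap_at i (s + j) I) (?d * h * ?e * x k * g))"
      unfolding step.IH[OF step.prems] e by (simp only: mult.assoc)
    also have "?F (Suc k) ?K (?e * h * g) = W ?K (?d * h * g)
        - (\<Sum>j\<in>{Suc k..<?m}. W (swap_at i (s + j) ?K) (?d * h * ?e * h * g))"
      unfolding step.IH[OF K] e by (simp only: mult.assoc)
    also have "(\<Sum>j\<in>{Suc k..<?m}. W (swap_at i (s + j) ?K) (?d * h * ?e * h * g)) =
        (\<Sum>j\<in>{Suc k..<?m}. - W (swap_at i (s + j) I) (?d * h * ?e * h * g))"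
    proof (intro sum.cong refl)
      fix j assume j: "j \<in> {Suc k..<?m}"
      then have "swap_at i (s + j) ?K = swap_at (s + j) (s + k) (swap_at i (s + j) I)"
        using step.hyps p by (intro swap_at_swap_at(1)[OF step.prems]) auto
      then show "W (swap_at i (s + j) ?K) (?d * h * ?e * h * g) = - W (swap_at i (s + j) I) (?d * h * ?e * h * g)"
        using antisymmetric_onD[OF anti, of "swap_at i (s + j) I" "s + j" "s + k"] j step p
        by (simp add: swap_at_idx)
    qed
    also have "W I (?d * x k * g) - (\<Sum>j\<in>{Suc k..<?m}. W (swap_at i (s + j) I) (?d * h * ?e * x k * g))
        - (W ?K (?d * h * g) - (\<Sum>j\<in>{Suc k..<?m}. - W (swap_at i (s + j) I) (?d * h * ?e * h * g))) =
        W I (?d * x k * g) - (W ?K (?d * h * g) + (\<Sum>j\<in>{Suc k..<?m}. W (swap_at i (s + j) I) (?d * h * g)))"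
    proof -
      have "?d * h * ?e * x k * g + ?d * h * ?e * h * g = ?d * h * (?e * (x k + h)) * g"
        by (simp add: algebra_simps)
      then have "W J (?d * h * ?e * x k * g) + W J (?d * h * ?e * h * g) = W J (?d * h * g)" for J
        unfolding additive_family_add[OF W, symmetric] e' by simp
      then have "(\<Sum>j\<in>{Suc k..<?m}. W (swap_at i (s + j) I) (?d * h * g)) =
          (\<Sum>j\<in>{Suc k..<?m}. W (swap_at i (s + j) I) (?d * h * ?e * x k * g))
          + (\<Sum>j\<in>{Suc k..<?m}. W (swap_at i (s + j) I) (?d * h * ?e * h * g))"
        by (simp flip: sum.distrib)
      then show ?thesis by (simp add: sum_negf)
    qed
    also have "W ?K (?d * h * g) + (\<Sum>j\<in>{Suc k..<?m}. W (swap_at i (s + j) I) (?d * h * g)) =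
        (\<Sum>j\<in>{k..<?m}. W (swap_at i (s + j) I) (?d * h * g))"
      using step.hyps by (simp add: sum.atLeast_Suc_lessThan)
    finally show ?case .
  qed
  have "(\<Sum>j\<in>{0..<?m}. W (swap_at i (s + j) I) (?d * h * g)) =
      (\<Sum>j\<in>{s..<s + ?m}. W (swap_at i j I) (?d * h * g))"
    by (rule sum.reindex_bij_witness[where j = "\<lambda>j. s + j" and i = "\<lambda>j. j - s"]) auto
  also have "\<dots> = W I (?d * h * g)"
    by (rule sum_swaps[OF no2 anti _ _ _ _ I]) (use p in auto)
  finally have "?F 0 I g = W I (?d * x 0 * g - ?d * h * g)"
    using part[of 0 I g] I by (simp add: additive_family_diff[OF W])
  then show ?thesis by (simp add: algebra_simps)
qed

lemma foldr_mat_act_cong: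
  assumes "\<And>K. K \<in> idx p \<Longrightarrow> W K = W' K" "I \<in> idx p"
  shows "foldr (mat_act p) Xs W I = foldr (mat_act p) Xs W' I"
  using assms(2)
proof (induction Xs arbitrary: I)
  case (Cons X Xs)
  have "mat_act p X (foldr (mat_act p) Xs W) I = mat_act p X (foldr (mat_act p) Xs W') I"
    by (rule fun_cong[OF mat_act_cong]) (rule Cons.IH)
  then show ?case by simp
qed (use assms in simp)

text \<open>
  A row of factors multiplies \<open>W\<close> by a scalar, so the result is antisymmetric again and the next
  row applies.
\<close>

lemma mat_act_rows:
  fixes W :: "'n::finite list \<Rightarrow> 'r::comm_ring_1 \<Rightarrow> 'g::ab_group_add"
  assumes W: "additive_family W" and no2: "\<And>x :: 'g. x + x = 0 \<Longrightarrow> x = 0"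
    and anti: "\<And>g. antisymmetric_on p {s..<s + CARD('n)} (\<lambda>K. W K g)"
    and p: "s + CARD('n) \<le> p" "\<And>i. i \<in> set is \<Longrightarrow> i < s"
    and x: "\<And>i k. x i (Suc k) = x i k + h" "\<And>i k. x i k * rinv (x i k) = 1"
    and I: "I \<in> idx p"
  shows "foldr (mat_act p) (concat (map (\<lambda>i. map (\<lambda>k. Rminus h (x i k) i (s + k)) [0..<CARD('n)]) is)) W I g =
    W I (prod_list (map (\<lambda>i. (x i 0 - h) * rinv (x i CARD('n))) is) * g)"
  using p(2) I
proof (induction "is" arbitrary: I g)
  case Nil
  then show ?case by simp
next
  case (Cons i "is")
  let ?row = "map (\<lambda>k. Rminus h (x i k) i (s + k)) [0..<CARD('n)]"
  let ?c = "prod_list (map (\<lambda>i. (x i 0 - h) * rinv (x i CARD('n))) is)"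
  let ?rest = "foldr (mat_act p) (concat (map (\<lambda>i. map (\<lambda>k. Rminus h (x i k) i (s + k)) [0..<CARD('n)]) is)) W"
  let ?W = "\<lambda>K g. W K (?c * g)"
  have 1: "foldr (mat_act p) ?row ?rest I = foldr (mat_act p) ?row ?W I"
    using Cons by (intro foldr_mat_act_cong ext) simp_all
  have 2: "foldr (mat_act p) ?row ?W I g = ?W I ((x i 0 - h) * rinv (x i CARD('n)) * g)"
  proof (rule mat_act_row[where W = ?W and x = "x i", OF _ no2 _ p(1) _ x(1) x(2) Cons.prems(2)])
    show "additive_family ?W"
      using W by (simp add: additive_family_def distrib_left)
    show "antisymmetric_on p {s..<s + CARD('n)} (\<lambda>K. ?W K g)" for g by (rule anti)
    show "i < s" using Cons.prems by simp
  qed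
  have "foldr (mat_act p) (concat (map (\<lambda>i. map (\<lambda>k. Rminus h (x i k) i (s + k)) [0..<CARD('n)]) (i # is))) W I g
      = foldr (mat_act p) ?row ?rest I g"
    by simp
  then show ?case unfolding 1 2 by (simp add: mult_ac)
qed

section \<open>Invertibility\<close>

lemma tmult_assoc: "tmult p (tmult p A B) C I J = tmult p A (tmult p B C) I J"
  unfolding tmult_def sum_distrib_right sum_distrib_left
  by (subst sum.swap) (simp add: mult.assoc)

lemma tmult_cong:
  assumes "\<And>K. K \<in> idx p \<Longrightarrow> A I K = A' I' K" "\<And>K. K \<in> idx p \<Longrightarrow> B K J = B' K J'"
  shows "tmult p A B I J = tmult p A' B' I' J'"
  unfolding tmult_def using assms by (intro sum.cong) auto

lemma tmult_tone:
  fixes A :: "('n::finite, 'r::ring_1) tmat"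
  shows "I \<in> idx p \<Longrightarrow> tmult p tone A I J = A I J" "J \<in> idx p \<Longrightarrow> tmult p A tone I J = A I J"
proof -
  have "tone I K * A K J = (if K = I then A K J else 0)" "A I K * tone K J = (if K = J then A I K else 0)" for K
    by (simp_all add: tone_def)
  then show "I \<in> idx p \<Longrightarrow> tmult p tone A I J = A I J" "J \<in> idx p \<Longrightarrow> tmult p A tone I J = A I J"
    unfolding tmult_def by (simp_all only: sum_idx_delta if_True)
qed

definition inverse_mat :: "nat \<Rightarrow> ('n, 'r::ring_1) tmat \<Rightarrow> ('n, 'r) tmat \<Rightarrow> bool" where
  "inverse_mat p X Y \<longleftrightarrow>
     (\<forall>I\<in>idx p. \<forall>J\<in>idx p. tmult p X Y I J = tone I J \<and> tmult p Y X I J = tone I J)"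

lemma inverse_mat_tmult:
  fixes A :: "('n::finite, 'r::ring_1) tmat"
  assumes "inverse_mat p A A'" "inverse_mat p B B'"
  shows "inverse_mat p (tmult p A B) (tmult p B' A')"
  unfolding inverse_mat_def
proof (intro ballI conjI)
  fix I J :: "'n list" assume I: "I \<in> idx p" and J: "J \<in> idx p"
  have *: "tmult p (tmult p A B) (tmult p B' A') I J = tone I J"
    if "inverse_mat p A A'" "inverse_mat p B B'" for A B A' B' :: "('n, 'r) tmat"
  proof -
    have "tmult p (tmult p A B) (tmult p B' A') I J = tmult p A (tmult p (tmult p B B') A') I J"
      unfolding tmult_assoc[of p A] by (rule tmult_cong) (simp_all add: tmult_assoc)
    also have "\<dots> = tmult p A (tmult p tone A') I J"
      by (intro tmult_cong refl) (use that in \<open>simp add: inverse_mat_def\<close>)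
    also have "\<dots> = tmult p A A' I J"
      by (intro tmult_cong refl tmult_tone)
    finally show ?thesis using that I J by (simp add: inverse_mat_def)
  qed
  have sym: "inverse_mat p Y X" if "inverse_mat p X Y" for X Y :: "('n, 'r) tmat"
    using that by (auto simp: inverse_mat_def)
  show "tmult p (tmult p A B) (tmult p B' A') I J = tone I J" using * assms by blast
  show "tmult p (tmult p B' A') (tmult p A B) I J = tone I J" using * sym assms by blast
qed

lemma inverse_mat_tprod:
  fixes Xs :: "('n::finite, 'r::ring_1) tmat list"
  assumes "\<And>X. X \<in> set Xs \<Longrightarrow> \<exists>Y. inverse_mat p X Y"
  shows "\<exists>Y. inverse_mat p (tprod p Xs) Y"
  using assms
proof (induction Xs)
  case Nil
  have "inverse_mat p (tone :: ('n, 'r) tmat) tone" unfolding inverse_mat_def by (intro ballI conjI tmult_tone(1))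
  then show ?case by (auto simp: tprod_def)
next
  case (Cons X Xs)
  have "\<exists>Y. inverse_mat p X Y" by (rule Cons.prems) simp
  then obtain Y where Y: "inverse_mat p X Y" ..
  have "\<exists>Y. inverse_mat p (tprod p Xs) Y" by (rule Cons.IH) (rule Cons.prems, simp)
  then obtain Y' where Y': "inverse_mat p (tprod p Xs) Y'" ..
  have "inverse_mat p (tprod p (X # Xs)) (tmult p Y' Y)"
    using inverse_mat_tmult[OF Y Y'] by (simp add: tprod_def)
  then show ?case by (intro exI[of _ "tmult p Y' Y"])
qed

lemma inverse_mat_tinv:
  assumes "\<exists>Y. inverse_mat p X Y"
  shows "inverse_mat p X (tinv p X)"
  using someI_ex[OF assms] unfolding tinv_def inverse_mat_def .

text \<open>
  The inverse of \<open>x - h P\<close> is a multiple of \<open>x + h P\<close>, as \<open>(x - h P) (x + h P) = x\<^sup>2 - h\<^sup>2\<close>. The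
  proof treats \<open>x + s P\<close> for \<open>s = \<plusminus> h\<close> at once, to get both sides of the inverse.
\<close>

lemma inverse_mat_Rminus:
  fixes x h :: "'r::comm_ring_1"
  assumes x: "x * rinv x = 1" "(x + h) * rinv (x + h) = 1" "(x - h) * rinv (x - h) = 1"
    and ij: "i < p" "j < p"
  shows "\<exists>Y. inverse_mat p (Rminus h x i j :: ('n::finite, 'r) tmat) Y"
proof -
  define M where "M s e = (\<lambda>I J :: 'n list. e * (x * tone I J + s * tperm i j I J))" for s e :: 'r
  have M: "tmult p (M s e) (M (- s) e') I J = e * e' * (x * x - s * s) * tone I J"
    if I: "I \<in> idx p" and J: "J \<in> idx p" for s e e' and I J :: "'n list"
  proof -
    let ?I = "swap_at i j I"
    have "M s e I K * M (- s) e' K J = (if K = I then e * x * M (- s) e' K J else 0) + (if K = ?I then e * s * M (- s) e' K J else 0)"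
      if "K \<in> idx p" for K
      using swap_at_eq_iff[OF I that ij] unfolding M_def[of s e]
      by (simp add: tone_def tperm_swap_at algebra_simps)
    then have "tmult p (M s e) (M (- s) e') I J =
        (\<Sum>K\<in>idx p. (if K = I then e * x * M (- s) e' K J else 0) + (if K = ?I then e * s * M (- s) e' K J else 0))"
      unfolding tmult_def by (intro sum.cong) auto
    also have "\<dots> = e * x * M (- s) e' I J + e * s * M (- s) e' ?I J"
      using I by (simp add: sum.distrib sum_idx_delta swap_at_idx)
    also have "\<dots> = e * e' * (x * x - s * s) * tone I J"
    proof -
      have t: "tone ?I J = tperm i j I J" "tperm i j ?I J = tone I J"
        using swap_at_eq_iff[OF J I ij] swap_at_involutive[OF I ij] swap_at_involutive[OF J ij]
        by (auto simp: tone_def tperm_swap_at)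
      show ?thesis unfolding M_def t by (simp add: algebra_simps)
    qed
    finally show ?thesis .
  qed
  have R: "Rminus h x i j = M (- h) (rinv (x + h))"
    by (intro ext) (simp add: Rminus_eq[OF x(1)] M_def)
  have "rinv (x + h) * rinv (x - h) * (x * x - h * h) = ((x + h) * rinv (x + h)) * ((x - h) * rinv (x - h))"
    by (simp add: algebra_simps)
  then have 1: "rinv (x + h) * rinv (x - h) * (x * x - h * h) = 1" by (simp add: x)
  have "inverse_mat p (Rminus h x i j) (M h (rinv (x - h)) :: ('n, 'r) tmat)"
    unfolding inverse_mat_def R
    using M[of _ _ "- h"] M[of _ _ h] 1 by (simp add: mult.commute[of "rinv (x - h)"])
  then show ?thesis by blast
qed

section \<open>Ordered products of single-leg matrices\<close>

text \<open>
  In the induction, the factors from \<open>q\<close> on change only the entries at positions at least \<open>q\<close>.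
\<close>

lemma tprod_leg:
  fixes A :: "nat \<Rightarrow> 'n::finite \<Rightarrow> 'n \<Rightarrow> 'r::ring_1"
  assumes I: "I \<in> idx p" and J: "J \<in> idx p"
  shows "tprod p (map (\<lambda>k. leg k (A k)) [0..<p]) I J = prod_list (map (\<lambda>k. A k (I ! k) (J ! k)) [0..<p])"
proof -
  have "tprod p (map (\<lambda>k. leg k (A k)) [q..<p]) I J =
      (if \<forall>l<q. I ! l = J ! l then prod_list (map (\<lambda>k. A k (I ! k) (J ! k)) [q..<p]) else 0)"
    if "q \<le> p" "I \<in> idx p" for q I
    using that
  proof (induction arbitrary: I rule: inc_induct)
    case base
    have "I = J \<longleftrightarrow> (\<forall>l<p. I ! l = J ! l)"
      using base J by (auto simp: idx_def intro: nth_equalityI)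
    then show ?case by (simp add: tprod_def tone_def)
  next
    case (step q)
    let ?T = "\<lambda>q. tprod p (map (\<lambda>k. leg k (A k)) [q..<p])"
    let ?K = "I[q := J ! q]"
    have len: "length I = p" "length J = p" using step.prems J by (simp_all add: idx_def)
    have "?T q I J = (\<Sum>K\<in>idx p. leg q (A q) I K * ?T (Suc q) K J)"
      using step.hyps by (simp add: upt_conv_Cons tprod_def tmult_def)
    also have "\<dots> = (\<Sum>K\<in>idx p. if K = ?K then A q (I ! q) (J ! q) * ?T (Suc q) ?K J else 0)"
    proof (intro sum.cong refl)
      fix K :: "'n list" assume K: "K \<in> idx p"
      show "leg q (A q) I K * ?T (Suc q) K J = (if K = ?K then A q (I ! q) (J ! q) * ?T (Suc q) ?K J else 0)"
      proof (cases "K = ?K")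
        case True
        then show ?thesis using step.hyps len by (simp add: leg_def nth_list_update)
      next
        case False
        then obtain l where l: "l < p" "K ! l \<noteq> ?K ! l"
          using K len by (metis (mono_tags, lifting) idx_def length_list_update mem_Collect_eq nth_equalityI)
        show ?thesis
        proof (cases "l = q")
          case True
          with l len have "K ! q \<noteq> J ! q" by simp
          then have "?T (Suc q) K J = 0" using step.IH[OF K] by auto
          with False show ?thesis by simp
        next
          case False
          with l have "leg q (A q) I K = 0" using len by (auto simp: leg_def)
          with \<open>K \<noteq> ?K\<close> show ?thesis by simp
        qed
      qed
    qed
    also have "\<dots> = A q (I ! q) (J ! q) * ?T (Suc q) ?K J"
    proof -
      have "?K \<in> idx p" using len by (simp add: idx_def)
      then show ?thesis by (simp only: sum_idx_delta if_True)
    qed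
    also have "?T (Suc q) ?K J = (if \<forall>l<Suc q. ?K ! l = J ! l then
        prod_list (map (\<lambda>k. A k (?K ! k) (J ! k)) [Suc q..<p]) else 0)"
      using len by (intro step.IH) (simp add: idx_def)
    also have "(\<forall>l<Suc q. ?K ! l = J ! l) \<longleftrightarrow> (\<forall>l<q. I ! l = J ! l)"
      using step.hyps len by (auto simp: less_Suc_eq nth_list_update)
    also have "map (\<lambda>k. A k (?K ! k) (J ! k)) [Suc q..<p] = map (\<lambda>k. A k (I ! k) (J ! k)) [Suc q..<p]"
      by auto
    finally show ?case
      using step.hyps by (simp only: upt_conv_Cons list.map prod_list.Cons if_distrib[of "(*) _"] mult_zero_right)
  qed
  from this[of 0 I] I show ?thesis by simp
qed


section \<open>Substitution into matrices\<close>

lemma substituted_prod_list: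
  assumes "\<And>k. k \<in> set ks \<Longrightarrow> shift.substituted n m (f k) (g k :: (vars, 'n::finite RA) mfps)"
  shows "shift.substituted n m (prod_list (map f ks)) (prod_list (map g ks))"
  using assms
  by (induction ks) (simp_all add: shift.substituted_one shift.substituted_times[OF hbilinear_times_RA])

lemma substituted_tprod:
  fixes X Y :: "'k \<Rightarrow> ('n::finite, (vars, zh) mfps) tmat"
  assumes "\<And>k I J. k \<in> set ks \<Longrightarrow> shift.substituted n m (X k I J) (Y k I J)"
  shows "shift.substituted n m (tprod p (map X ks) I J) (tprod p (map Y ks) I J)"
  using assms
proof (induction ks arbitrary: I J)
  case Nil
  then show ?case by (simp add: tprod_def tone_def shift.substituted_one shift.substituted_zero)
next
  case (Cons k ks)
  have "shift.substituted n m (tmult p (X k) (tprod p (map X ks)) I J) (tmult p (Y k) (tprod p (map Y ks)) I J)"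
    unfolding tmult_def
    by (intro shift.substituted_sum shift.substituted_times[OF hbilinear_times_zh] Cons) simp_all
  then show ?case by (simp add: tprod_def)
qed

text \<open>
  Here \<open>fls_X\<close> is \<open>z\<close>: a series whose leading term is \<open>z\<close> is invertible over \<open>\<complex>((z))[[h]]\<close>.
\<close>

lemma zh_unit:
  assumes "mcoeff f 0 $ 0 = fls_X"
  shows "f * rinv f = (1 :: (vars, zh) mfps)"
proof (rule mfps_unit, rule fps_unit)
  show "mcoeff f 0 $ 0 * fls_X_inv = 1"
    using assms by (simp add: fls_X_times_conv_shift fls_X_inv_conv_shift_1)
qed

lemma substituted_Rminus:
  fixes x x' h h' :: "(vars, zh) mfps"
  assumes "shift.substituted n m x x'" "shift.substituted n m h h'"
    and "x * rinv x = 1" "(x + h) * rinv (x + h) = 1"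
  shows "shift.substituted n m (Rminus h x i j I J) (Rminus h' x' i j I J)"
proof -
  have "shift.substituted n m (tone I J :: (vars, zh) mfps) (tone I J)"
    "shift.substituted n m (tperm i j I J :: (vars, zh) mfps) (tperm i j I J)"
    by (simp_all add: tone_def tperm_def shift.substituted_one shift.substituted_zero)
  then show ?thesis
    unfolding Rminus_def
    by (intro shift.substituted_times[OF hbilinear_times_zh] shift.substituted_diff shift.substituted_add
        shift.substituted_rinv[OF hbilinear_times_zh] assms)
qed

definition hbar :: "(vars, zh) mfps" where "hbar = mconst fps_X"

text \<open>
  The arguments \<open>z + u\<^sub>i - v\<^sub>j\<close> of the \<open>R\<close>-matrices become \<open>z + u\<^sub>i - v + j h\<close> under the
  substitution. These are in arithmetic progression with step \<open>h\<close>, as the scalar action requires.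
\<close>

definition spectral :: "nat \<Rightarrow> nat \<Rightarrow> (vars, zh) mfps" where
  "spectral i j = mconst (fps_const fls_X) + mvar (U i) - mvar (V j)"

definition shifted_spectral :: "nat \<Rightarrow> nat \<Rightarrow> (vars, zh) mfps" where
  "shifted_spectral i j = mconst (fps_const fls_X) + mvar (U i) - (mvar (V 0) - mconst ((of_nat j * fps_X) *\<^sub>h 1))"

lemma hscale_X_one: "fps_X *\<^sub>h (1 :: zh) = fps_X"
  using hscale_monomial_nth[of 1 1 "1 :: complex fls"] by (intro fps_ext) (simp add: cscale_one)

lemma shifted_spectral_Suc: "shifted_spectral i (Suc j) = shifted_spectral i j + hbar"
proof -
  have "(of_nat (Suc j) * fps_X) *\<^sub>h (1 :: zh) = fps_X + (of_nat j * fps_X) *\<^sub>h 1"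
    by (simp only: of_nat_Suc distrib_right mult_1 hscale_add_left hscale_X_one)
  then show ?thesis
    unfolding shifted_spectral_def hbar_def by (simp add: mconst_add)
qed

lemma mcoeff_mvar_0 [simp]: "mcoeff (mvar x) 0 = 0"
  by (simp add: mvar_def mseries_def)

lemma mcoeff_mconst_0 [simp]: "mcoeff (mconst c) 0 = c"
  by (simp add: mconst_def)

lemma spectral_units:
  "spectral i j * rinv (spectral i j) = 1"
  "(spectral i j + hbar) * rinv (spectral i j + hbar) = 1"
  "(spectral i j - hbar) * rinv (spectral i j - hbar) = 1"
  "shifted_spectral i j * rinv (shifted_spectral i j) = 1"
  by (rule zh_unit, simp add: spectral_def shifted_spectral_def hbar_def hscale_nth_0)+

lemma substituted_spectral:
  assumes "i < n" "j < m"
  shows "shift.substituted n m (spectral i j) (shifted_spectral i j)"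
proof -
  have "shift.substituted n m (mvar (U i) :: (vars, zh) mfps) (mvar (U i))"
    unfolding mvar_def using assms by (intro substituted_U)
  then show ?thesis
    unfolding spectral_def shifted_spectral_def
    by (intro shift.substituted_add shift.substituted_diff shift.substituted_mconst substituted_mvar_V assms)
qed

lemma substituted_hbar: "shift.substituted n m hbar hbar"
  unfolding hbar_def by (rule shift.substituted_mconst)

lemma Rfactor_eq: "Rfactor n i j = Rminus hbar (spectral i j) i (n + j)"
  by (simp add: Rfactor_def hbar_def spectral_def)

text \<open>
  The order of the factors \<open>R\<^sub>i\<^sub>j\<close> in the product with barred superscripts; the other product has
  exactly the reverse order.
\<close>

definition factor_order :: "nat \<Rightarrow> nat \<Rightarrow> (nat \<times> nat) list" where
  "factor_order n m = concat (map (\<lambda>i. map (\<lambda>j. (i, j)) [0..<m]) (rev [0..<n]))"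

lemma set_factor_order: "(i, j) \<in> set (factor_order n m) \<longleftrightarrow> i < n \<and> j < m"
  by (auto simp: factor_order_def image_iff)

lemma Rnm_bar_eq: "Rnm_bar n m = tprod (n + m) (map (\<lambda>(i, j). Rfactor n i j) (factor_order n m))"
  by (simp add: Rnm_bar_def factor_order_def map_concat comp_def)

lemma Rnm_eq: "Rnm n m = tprod (n + m) (map (\<lambda>(i, j). Rfactor n i j) (rev (factor_order n m)))"
  by (simp add: Rnm_def factor_order_def map_concat rev_concat rev_map comp_def)

definition Rshift :: "nat \<Rightarrow> nat \<times> nat \<Rightarrow> ('n, (vars, zh) mfps) tmat" where
  "Rshift n = (\<lambda>(i, j). Rminus hbar (shifted_spectral i j) i (n + j))"

lemma substituted_Rfactors:
  fixes I J :: "'n::finite list"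
  assumes "set ks \<subseteq> set (factor_order n m)"
  shows "shift.substituted n m (tprod p (map (\<lambda>(i, j). Rfactor n i j) ks) I J) (tprod p (map (Rshift n) ks) I J)"
proof (rule substituted_tprod)
  fix k and I J :: "'n list" assume "k \<in> set ks"
  with assms have "k \<in> set (factor_order n m)" by blast
  moreover obtain i j where k: "k = (i, j)" by (cases k)
  ultimately have "i < n" "j < m" by (simp_all add: set_factor_order)
  then have "shift.substituted n m (Rminus hbar (spectral i j) i (n + j) I J) (Rminus hbar (shifted_spectral i j) i (n + j) I J)"
    by (intro substituted_Rminus substituted_spectral substituted_hbar spectral_units)
  then show "shift.substituted n m ((case k of (i, j) \<Rightarrow> Rfactor n i j) I J) (Rshift n k I J)"
    unfolding k Rshift_def Rfactor_eq prod.case .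
qed

section \<open>Pairings of series\<close>

lemma mconv_add_right: "hbilinear op \<Longrightarrow> mconv op f (g + g') = mconv op f g + mconv op f g'"
  and mconv_add_left: "hbilinear op \<Longrightarrow> mconv op (f + f') g = mconv op f g + mconv op f' g"
  by (rule mfps_eqI, simp add: mcoeff_mconv case_prod_unfold hlinear_add[OF hbilinearD(1)]
      hlinear_add[OF hbilinearD(2)] sum.distrib)+

lemma mconv_zero_right: "hbilinear op \<Longrightarrow> mconv op f 0 = 0"
  and mconv_zero_left: "hbilinear op \<Longrightarrow> mconv op 0 g = 0"
  using mconv_add_right[of op f 0 0] mconv_add_left[of op 0 0 g] by simp_all

lemma mconv_uminus_left: "hbilinear op \<Longrightarrow> mconv op (- f) g = - mconv op f g"
  using mconv_add_left[of op f "- f" g] by (simp add: mconv_zero_left add_eq_0_iff)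

lemma mconv_uminus_right: "hbilinear op \<Longrightarrow> mconv op f (- g) = - mconv op f g"
  using mconv_add_right[of op f g "- g"] by (simp add: mconv_zero_right add_eq_0_iff)

lemma mcoeff_mconv_one:
  fixes op :: "'a::hmodule \<Rightarrow> 'b::{hmodule, ring_1} \<Rightarrow> 'c::hmodule" and f :: "('x, 'a) mfps"
  assumes "hbilinear op"
  shows "mcoeff (mconv op f 1) e = op (mcoeff f e) 1"
proof -
  have "mcoeff (mconv op f 1) (e + 0) = op (mcoeff f e) (mcoeff (1 :: ('x, 'b) mfps) 0)"
    by (rule mcoeff_mconv_disjoint[where Y = UNIV and Z = "{}"])
      (auto simp: one_mfps_def mconst_def hlinear_zero[OF hbilinearD(1)[OF assms]]
        hlinear_zero[OF hbilinearD(2)[OF assms]] split: if_splits)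
  then show ?thesis by (simp add: one_mfps_def)
qed

lemma mfps_no_2_torsion: "x + x = 0 \<Longrightarrow> x = (0 :: ('x, 'a::hmodule) mfps)"
proof (rule mfps_eqI)
  fix e assume "x + x = 0"
  from arg_cong[OF this, of "\<lambda>f. mcoeff f e"] have "mcoeff x e + mcoeff x e = 0" by simp
  then show "mcoeff x e = mcoeff 0 e" by (simp only: hmodule_no_2_torsion[OF \<open>mcoeff x e + mcoeff x e = 0\<close>] mcoeff_zero)
qed

section \<open>The fused product\<close>

text \<open>
  The entries of \<open>L\<^sub>1(v) L\<^sub>2(v - h) \<cdots> L\<^sub>N(v - (N - 1) h)\<close>; \<open>tprod_leg\<close> shows that they are ordered
  products of entries.
\<close>

definition fused :: "('n::finite, (vars, 'n RA) mfps) tmat" where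
  "fused I J = prod_list (map (\<lambda>k. shifted_L k (I ! k) (J ! k)) [0..<CARD('n)])"

text \<open>
  The fusion relations are these identities for adjacent indices.
\<close>

lemma fused_antisymmetric:
  fixes I J :: "'n::finite list"
  shows "J \<in> idx CARD('n) \<Longrightarrow> antisymmetric_on CARD('n) {..<CARD('n)} (\<lambda>I. fused I J)"
    and "I \<in> idx CARD('n) \<Longrightarrow> antisymmetric_on CARD('n) {..<CARD('n)} (\<lambda>J. fused I J)"
proof -
  have split: "[0..<p] = [0..<j] @ [j, Suc j] @ [Suc (Suc j)..<p]" if "Suc j < p" for j p
  proof -
    have "[0..<p] = [0..<j] @ [j..<p]" using that upt_add_eq_append[of 0 j "p - j"] by simp
    then show ?thesis using that by (simp add: upt_conv_Cons)
  qed
  let ?F = "\<lambda>I J ks. prod_list (map (\<lambda>k. shifted_L k (I ! k) (J ! k)) ks) :: (vars, 'n RA) mfps"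
  have fused: "fused I J = ?F I J [0..<j] *
      (shifted_L j (I ! j) (J ! j) * shifted_L (Suc j) (I ! Suc j) (J ! Suc j)) * ?F I J [Suc (Suc j)..<CARD('n)]"
    if "Suc j < CARD('n)" for I J :: "'n list" and j
    unfolding fused_def split[OF that] by (simp add: mult.assoc)
  have minus: "A * b * C = - (A * a * C)" if "a + b = 0" for A a b C :: "(vars, 'n RA) mfps"
  proof -
    have "b = - a" using that by (simp add: add_eq_0_iff)
    then show ?thesis by simp
  qed
  show "antisymmetric_on CARD('n) {..<CARD('n)} (\<lambda>I. fused I J)"
  proof (rule antisymmetric_adjacent)
    fix I :: "'n list" and j assume I: "I \<in> idx CARD('n)" and j: "Suc j < CARD('n)"
    let ?I = "swap_at j (Suc j) I"
    have len: "length I = CARD('n)" using I by (simp add: idx_def)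
    have eq: "?F ?I J [0..<j] = ?F I J [0..<j]" "?F ?I J [Suc (Suc j)..<CARD('n)] = ?F I J [Suc (Suc j)..<CARD('n)]"
      by (rule arg_cong[of _ _ prod_list], use len j in \<open>auto simp: nth_swap_at\<close>)+
    show "fused ?I J = - fused I J"
      unfolding fused[OF j] eq using len j fusion(1)
      by (intro minus) (simp add: nth_swap_at)
  qed
  show "antisymmetric_on CARD('n) {..<CARD('n)} (\<lambda>J. fused I J)"
  proof (rule antisymmetric_adjacent)
    fix J :: "'n list" and j assume J: "J \<in> idx CARD('n)" and j: "Suc j < CARD('n)"
    let ?J = "swap_at j (Suc j) J"
    have len: "length J = CARD('n)" using J by (simp add: idx_def)
    have eq: "?F I ?J [0..<j] = ?F I J [0..<j]" "?F I ?J [Suc (Suc j)..<CARD('n)] = ?F I J [Suc (Suc j)..<CARD('n)]"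
      by (rule arg_cong[of _ _ prod_list], use len j in \<open>auto simp: nth_swap_at\<close>)+
    show "fused I ?J = - fused I J"
      unfolding fused[OF j] eq using len j fusion(2)
      by (intro minus) (simp add: nth_swap_at)
  qed
qed

text \<open>
  The result of the substitution in \<open>Lpair n N\<close>.
\<close>

definition fused_pair :: "nat \<Rightarrow> ('n::finite, (vars, ('n RA, 'n RA) ctensor) mfps) tmat" where
  "fused_pair n I J = mconv (\<otimes>\<^sub>h) (Lprod n U (take n I) (take n J)) (fused (drop n I) (drop n J))"

lemma substituted_fused_pair:
  fixes I J :: "'n::finite list"
  assumes I: "I \<in> idx (n + CARD('n))" and J: "J \<in> idx (n + CARD('n))"
  shows "shift.substituted n CARD('n) (Lpair n CARD('n) I J) (fused_pair n I J)"
proof -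
  have drop: "drop n I \<in> idx CARD('n)" "drop n J \<in> idx CARD('n)"
    and take: "take n I \<in> idx n" "take n J \<in> idx n"
    using I J by (simp_all add: idx_def)
  have "shift.substituted n CARD('n) (Lprod CARD('n) V (drop n I) (drop n J)) (fused (drop n I) (drop n J))"
    unfolding Lprod_def tprod_leg[OF drop] fused_def shifted_L_def
    by (intro substituted_prod_list substituted_V) simp
  moreover have "shift.substituted n CARD('n) (Lprod n U (take n I) (take n J)) (Lprod n U (take n I) (take n J))"
    unfolding Lprod_def tprod_leg[OF take]
    by (intro substituted_prod_list substituted_U) simp
  ultimately show ?thesis
    unfolding Lpair_def fused_pair_def by (intro shift.substituted_mconv[OF hbilinear_ctens])
qed

lemma fused_pair_antisymmetric:
  fixes I J :: "'n::finite list"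
  shows "J \<in> idx (n + CARD('n)) \<Longrightarrow> antisymmetric_on (n + CARD('n)) {n..<n + CARD('n)} (\<lambda>I. fused_pair n I J)"
    and "I \<in> idx (n + CARD('n)) \<Longrightarrow> antisymmetric_on (n + CARD('n)) {n..<n + CARD('n)} (\<lambda>J. fused_pair n I J)"
proof -
  have td: "take n (swap_at j k K) = take n K" "drop n (swap_at j k K) = swap_at (j - n) (k - n) (drop n K)"
    "drop n K \<in> idx CARD('n)"
    if "K \<in> idx (n + CARD('n))" "j \<in> {n..<n + CARD('n)}" "k \<in> {n..<n + CARD('n)}" for K :: "'n list" and j k
    using that by (simp_all add: swap_at_def drop_update_swap idx_def)
  show "antisymmetric_on (n + CARD('n)) {n..<n + CARD('n)} (\<lambda>I. fused_pair n I J)" if "J \<in> idx (n + CARD('n))"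
    unfolding antisymmetric_on_def
  proof (intro ballI impI)
    fix K :: "'n list" and j k
    assume K: "K \<in> idx (n + CARD('n))" "j \<in> {n..<n + CARD('n)}" "k \<in> {n..<n + CARD('n)}" and "j \<noteq> k"
    have "fused (swap_at (j - n) (k - n) (drop n K)) (drop n J) = - fused (drop n K) (drop n J)"
      by (rule antisymmetric_onD[OF fused_antisymmetric(1)]) (use that K \<open>j \<noteq> k\<close> in \<open>auto simp: idx_def\<close>)
    then show "fused_pair n (swap_at j k K) J = - fused_pair n K J"
      unfolding fused_pair_def td[OF K] by (simp add: mconv_uminus_right[OF hbilinear_ctens])
  qed
  show "antisymmetric_on (n + CARD('n)) {n..<n + CARD('n)} (\<lambda>J. fused_pair n I J)" if "I \<in> idx (n + CARD('n))"
    unfolding antisymmetric_on_def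
  proof (intro ballI impI)
    fix K :: "'n list" and j k
    assume K: "K \<in> idx (n + CARD('n))" "j \<in> {n..<n + CARD('n)}" "k \<in> {n..<n + CARD('n)}" and "j \<noteq> k"
    have "fused (drop n I) (swap_at (j - n) (k - n) (drop n K)) = - fused (drop n I) (drop n K)"
      by (rule antisymmetric_onD[OF fused_antisymmetric(2)]) (use that K \<open>j \<noteq> k\<close> in \<open>auto simp: idx_def\<close>)
    then show "fused_pair n I (swap_at j k K) = - fused_pair n I K"
      unfolding fused_pair_def td[OF K] by (simp add: mconv_uminus_right[OF hbilinear_ctens])
  qed
qed


section \<open>The braiding on the fused product\<close>

text \<open>
  With \<open>x\<^sub>i = z + u\<^sub>i - v\<close> this is \<open>\<Prod>\<^sub>i (x\<^sub>i - h) / (x\<^sub>i + m h)\<close>.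
\<close>

definition fused_scalar :: "nat \<Rightarrow> nat \<Rightarrow> (vars, zh) mfps" where
  "fused_scalar n m = prod_list (map (\<lambda>i. (shifted_spectral i 0 - hbar) * rinv (shifted_spectral i m)) (rev [0..<n]))"

text \<open>
  The same scalar occurs for the action of the barred product on rows and of the other product on
  columns: the transpose of the latter product is the former.
\<close>

lemma Rshift_scalar:
  fixes W :: "'n::finite list \<Rightarrow> (vars, zh) mfps \<Rightarrow> (vars, 'a::hmodule) mfps"
  assumes W: "additive_family W"
    and anti: "\<And>g. antisymmetric_on (n + CARD('n)) {n..<n + CARD('n)} (\<lambda>K. W K g)"
    and I: "I \<in> idx (n + CARD('n))"
  shows "mat_act (n + CARD('n)) (tprod (n + CARD('n)) (map (Rshift n) (factor_order n CARD('n)))) W I g =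
      W I (fused_scalar n CARD('n) * g)"
    and "mat_act (n + CARD('n)) (\<lambda>J I. tprod (n + CARD('n)) (map (Rshift n) (rev (factor_order n CARD('n)))) I J) W I g =
      W I (fused_scalar n CARD('n) * g)"
proof -
  let ?p = "n + CARD('n)"
  have list: "map (Rshift n) (factor_order n CARD('n)) =
      concat (map (\<lambda>i. map (\<lambda>k. Rminus hbar (shifted_spectral i k) i (n + k)) [0..<CARD('n)]) (rev [0..<n]))"
    unfolding factor_order_def Rshift_def map_concat map_map comp_def prod.case ..
  have fold: "foldr (mat_act ?p) (map (Rshift n) (factor_order n CARD('n))) W I g = W I (fused_scalar n CARD('n) * g)"
    unfolding list fused_scalar_def
    by (rule mat_act_rows[where x = shifted_spectral, OF W mfps_no_2_torsion anti _ _ shifted_spectral_Suc spectral_units(4) I]) auto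
  show "mat_act ?p (tprod ?p (map (Rshift n) (factor_order n CARD('n)))) W I g = W I (fused_scalar n CARD('n) * g)"
    unfolding mat_act_tprod[OF W I] by (rule fold)
  have sym: "X J K = X K J" if X: "X \<in> set (map (Rshift n) (rev (factor_order n CARD('n))))"
    and J: "J \<in> idx ?p" and K: "K \<in> idx ?p" for X and J K :: "'n list"
  proof -
    obtain k where k: "k \<in> set (factor_order n CARD('n))" "X = Rshift n k" using X by auto
    obtain i j where ij: "k = (i, j)" by (cases k)
    with k have "i < n" "j < CARD('n)" by (simp_all add: set_factor_order)
    then have "J = swap_at i (n + j) K \<longleftrightarrow> K = swap_at i (n + j) J"
      by (intro swap_at_eq_iff[OF J K]) simp_all
    then have "tperm i (n + j) J K = (tperm i (n + j) K J :: (vars, zh) mfps)"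
      by (simp only: tperm_swap_at)
    moreover have "tone J K = (tone K J :: (vars, zh) mfps)" by (auto simp: tone_def)
    ultimately show ?thesis
      unfolding k ij Rshift_def prod.case Rminus_def by (simp only:)
  qed
  have "mat_act ?p (\<lambda>J I. tprod ?p (map (Rshift n) (rev (factor_order n CARD('n)))) I J) W I =
      foldr (mat_act ?p) (rev (map (Rshift n) (rev (factor_order n CARD('n))))) W I"
    by (rule mat_act_transpose_tprod[OF W I]) (rule sym)
  then show "mat_act ?p (\<lambda>J I. tprod ?p (map (Rshift n) (rev (factor_order n CARD('n)))) I J) W I g =
      W I (fused_scalar n CARD('n) * g)"
    using fold by (simp add: rev_map)
qed

lemma additive_mconv: "additive_family (\<lambda>K. mconv (\<otimes>\<^sub>h) (F K :: (vars, 'a::hmodule) mfps) :: (vars, zh) mfps \<Rightarrow> _)"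
  by (simp add: additive_family_def mconv_add_right[OF hbilinear_ctens])

text \<open>
  The barred product \<open>A\<close> acts on the rows as the scalar \<open>c\<close>. On the columns, \<open>c\<close> is the action of
  \<open>B\<close>, and then \<open>B Y = 1\<close> removes both.
\<close>

lemma conjugation_trivial:
  fixes Y :: "('n::finite, (vars, zh) mfps) tmat" and n :: nat
  defines "p \<equiv> n + CARD('n)"
  defines "A \<equiv> tprod p (map (Rshift n) (factor_order n CARD('n)))"
  defines "B \<equiv> tprod p (map (Rshift n) (rev (factor_order n CARD('n))))"
  assumes Y: "\<And>I J. I \<in> idx p \<Longrightarrow> J \<in> idx p \<Longrightarrow> tmult p B Y I J = tone I J"
    and I: "I \<in> idx p" and J: "J \<in> idx p"
  shows "(\<Sum>K\<in>idx p. \<Sum>M\<in>idx p. mconv (\<otimes>\<^sub>h) (fused_pair n K M) (A I K * Y M J)) = mconv (\<otimes>\<^sub>h) (fused_pair n I J) 1"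
proof -
  let ?W = "\<lambda>K M. mconv (\<otimes>\<^sub>h) (fused_pair n K M :: (vars, ('n RA, 'n RA) ctensor) mfps) :: (vars, zh) mfps \<Rightarrow> _"
  let ?c = "fused_scalar n CARD('n)"
  note antiW = mconv_uminus_left[OF hbilinear_ctens]
  have rows: "antisymmetric_on p {n..<n + CARD('n)} (\<lambda>K. ?W K M g)" if "M \<in> idx p" for M g
    using fused_pair_antisymmetric(1)[of M n] that unfolding p_def antisymmetric_on_def by (simp add: antiW)
  have cols: "antisymmetric_on p {n..<n + CARD('n)} (\<lambda>M. ?W K M g)" if "K \<in> idx p" for K g
    using fused_pair_antisymmetric(2)[of K n] that unfolding p_def antisymmetric_on_def by (simp add: antiW)
  have "(\<Sum>K\<in>idx p. \<Sum>M\<in>idx p. ?W K M (A I K * Y M J)) = (\<Sum>M\<in>idx p. mat_act p A (\<lambda>K. ?W K M) I (Y M J))"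
    unfolding mat_act_def by (rule sum.swap)
  also have "\<dots> = (\<Sum>M\<in>idx p. ?W I M (?c * Y M J))"
    unfolding A_def p_def
    by (intro sum.cong refl Rshift_scalar(1) additive_mconv rows[unfolded p_def] I[unfolded p_def])
  also have "\<dots> = (\<Sum>M\<in>idx p. mat_act p (\<lambda>J I. B I J) (?W I) M (Y M J))"
    unfolding B_def p_def
    by (intro sum.cong refl Rshift_scalar(2)[symmetric] additive_mconv cols[unfolded p_def] I[unfolded p_def])
  also have "\<dots> = mat_act p (\<lambda>J M. tmult p B Y M J) (?W I) J 1"
    unfolding mat_act_def tmult_def
    by (subst sum.swap) (simp add: additive_family_sum[OF additive_mconv])
  also have "\<dots> = mat_act p tone (?W I) J 1"
    unfolding mat_act_def using Y J by (intro sum.cong refl) (auto simp: tone_def)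
  also have "\<dots> = ?W I J 1"
    by (rule mat_act_tone[OF additive_mconv J])
  finally show ?thesis .
qed

text \<open>
  The formula for \<open>S\<close> is an identity of series in the \<open>u\<^sub>i\<close> and \<open>v\<^sub>j\<close>. The substitution in it,
  entry by entry, is legitimate on both sides, and \<open>conjugation_trivial\<close> evaluates the right-hand
  side.
\<close>

lemma braiding_fused_pair:
  fixes S :: "('n::finite RA, 'n RA) ctensor \<Rightarrow> (('n RA, 'n RA) ctensor, zh) ctensor"
  assumes S: "is_braiding S" and n: "n \<ge> 1"
    and I: "I \<in> idx (n + CARD('n))" and J: "J \<in> idx (n + CARD('n))"
  shows "S (mcoeff (fused_pair n I J) e) = mcoeff (fused_pair n I J) e \<otimes>\<^sub>h 1"
proof -
  let ?m = "CARD('n)"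
  let ?p = "n + ?m"
  let ?A = "tprod ?p (map (Rshift n) (factor_order n ?m)) :: ('n, (vars, zh) mfps) tmat"
  let ?B = "tprod ?p (map (Rshift n) (rev (factor_order n ?m))) :: ('n, (vars, zh) mfps) tmat"
  define T where "T = (tinv ?p (Rnm n ?m) :: ('n, (vars, zh) mfps) tmat)"
  note times = shift.substituted_times[OF hbilinear_times_zh]
  have "\<exists>Z. inverse_mat ?p X Z" if X: "X \<in> set (map (\<lambda>(i, j). Rfactor n i j) (rev (factor_order n ?m)))"
    for X :: "('n, (vars, zh) mfps) tmat"
  proof -
    obtain i j where ij: "(i, j) \<in> set (factor_order n ?m)" "X = Rfactor n i j" using X by auto
    then have "i < n" "j < ?m" by (simp_all add: set_factor_order)
    then show ?thesis
      unfolding ij Rfactor_eq by (intro inverse_mat_Rminus spectral_units) simp_all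
  qed
  then have inv: "inverse_mat ?p (Rnm n ?m) T"
    unfolding T_def Rnm_eq by (intro inverse_mat_tinv inverse_mat_tprod)
  define Y where "Y M K = (SOME g. shift.substituted n ?m (T M K) g)" for M K
  have Y: "shift.substituted n ?m (T M K) (Y M K)" for M K
    unfolding Y_def by (rule someI_ex) (rule shift.substituted_exists)
  have B: "shift.substituted n ?m (Rnm n ?m M K) (?B M K)" for M K
    unfolding Rnm_eq by (rule substituted_Rfactors) simp
  have A: "shift.substituted n ?m (Rnm_bar n ?m M K) (?A M K)" for M K
    unfolding Rnm_bar_eq by (rule substituted_Rfactors) simp
  have BY: "tmult ?p ?B Y M K = tone M K" if "M \<in> idx ?p" "K \<in> idx ?p" for M K
  proof (rule shift.substituted_unique[OF hseparated_fps])
    have "shift.substituted n ?m (tmult ?p (Rnm n ?m) T M K) (tmult ?p ?B Y M K)"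
      unfolding tmult_def by (intro shift.substituted_sum times B Y)
    moreover have "tmult ?p (Rnm n ?m) T M K = tone M K"
      using inv that by (simp add: inverse_mat_def)
    ultimately show "shift.substituted n ?m (tone M K) (tmult ?p ?B Y M K)" by simp
    show "shift.substituted n ?m (tone M K) (tone M K)"
      by (simp add: tone_def shift.substituted_one shift.substituted_zero)
  qed
  have lin: "hlinear S"
    and eq: "S (mcoeff (Lpair n ?m I J) e) = mcoeff (\<Sum>K\<in>idx ?p. \<Sum>M\<in>idx ?p.
          mconv (\<otimes>\<^sub>h) (Lpair n ?m K M) (Rnm_bar n ?m I K * T M J)) e" for e
    using S n I J unfolding is_braiding_def T_def by simp_all
  have 1: "map_coeffs S (Lpair n ?m I J) = (\<Sum>K\<in>idx ?p. \<Sum>M\<in>idx ?p.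
          mconv (\<otimes>\<^sub>h) (Lpair n ?m K M) (Rnm_bar n ?m I K * T M J))"
    by (rule mfps_eqI) (simp only: map_coeffs_def mcoeff_Abs eq)
  have 2: "shift.substituted n ?m (map_coeffs S (Lpair n ?m I J)) (map_coeffs S (fused_pair n I J))"
    by (intro shift.substituted_map_coeffs lin substituted_fused_pair I J)
  have 3: "shift.substituted n ?m (\<Sum>K\<in>idx ?p. \<Sum>M\<in>idx ?p.
          mconv (\<otimes>\<^sub>h) (Lpair n ?m K M) (Rnm_bar n ?m I K * T M J))
      (\<Sum>K\<in>idx ?p. \<Sum>M\<in>idx ?p. mconv (\<otimes>\<^sub>h) (fused_pair n K M) (?A I K * Y M J))"
    by (intro shift.substituted_sum shift.substituted_mconv[OF hbilinear_ctens] substituted_fused_pair times A Y)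
  have "map_coeffs S (fused_pair n I J) =
      (\<Sum>K\<in>idx ?p. \<Sum>M\<in>idx ?p. mconv (\<otimes>\<^sub>h) (fused_pair n K M) (?A I K * Y M J))"
    by (rule shift.substituted_unique[OF hseparated_hcompl 2]) (simp only: 1 3)
  also have "\<dots> = mconv (\<otimes>\<^sub>h) (fused_pair n I J) 1"
    by (rule conjugation_trivial[OF BY I J])
  finally have "mcoeff (map_coeffs S (fused_pair n I J)) e = mcoeff (mconv (\<otimes>\<^sub>h) (fused_pair n I J) 1) e"
    by simp
  then show ?thesis
    by (simp add: mcoeff_mconv_one[OF hbilinear_ctens] map_coeffs_def)
qed

section \<open>Coefficients\<close>

definition supported_on :: "'x set \<Rightarrow> ('x, 'a::zero) mfps \<Rightarrow> bool" where
  "supported_on Y f \<longleftrightarrow> (\<forall>a. mcoeff f a \<noteq> 0 \<longrightarrow> Poly_Mapping.keys a \<subseteq> Y)"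

lemma supported_on_times:
  fixes f g :: "('x, 'a::ring_1) mfps"
  assumes "supported_on Y f" "supported_on Y g"
  shows "supported_on Y (f * g)"
  unfolding supported_on_def
proof (intro allI impI)
  fix e assume "mcoeff (f * g) e \<noteq> 0"
  then obtain p where p: "p \<in> {(a, b). a + b = e}" "(case p of (a, b) \<Rightarrow> mcoeff f a * mcoeff g b) \<noteq> 0"
    unfolding mcoeff_mult by (metis (no_types, lifting) sum.neutral)
  obtain a b where ab: "p = (a, b)" by (cases p)
  with p have e: "e = a + b" and "mcoeff f a \<noteq> 0" "mcoeff g b \<noteq> 0" by auto
  then have "Poly_Mapping.keys a \<subseteq> Y" "Poly_Mapping.keys b \<subseteq> Y"
    using assms by (simp_all add: supported_on_def)
  then show "Poly_Mapping.keys e \<subseteq> Y"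
    unfolding e using Poly_Mapping.keys_add[of a b] by blast
qed

lemma supported_on_mseries: "x \<in> Y \<Longrightarrow> supported_on Y (mseries x c)"
  using keys_mseries unfolding supported_on_def by fastforce

lemma supported_on_prod_list:
  fixes f :: "'k \<Rightarrow> ('x, 'a::ring_1) mfps"
  shows "(\<And>k. k \<in> set ks \<Longrightarrow> supported_on Y (f k)) \<Longrightarrow> supported_on Y (prod_list (map f ks))"
proof (induction ks)
  case Nil
  then show ?case by (simp add: supported_on_def one_mfps_def mconst_def)
next
  case (Cons k ks)
  then show ?case by (simp add: supported_on_times)
qed

definition monomial_U :: "nat \<Rightarrow> (nat \<Rightarrow> nat) \<Rightarrow> vars \<Rightarrow>\<^sub>0 nat" where
  "monomial_U n r = (\<Sum>k<n. Poly_Mapping.single (U k) (r k))"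

lemma keys_monomial_U: "Poly_Mapping.keys (monomial_U n r) \<subseteq> U ` {..<n}"
proof (induction n)
  case (Suc n)
  have "Poly_Mapping.keys (monomial_U (Suc n) r) \<subseteq> Poly_Mapping.keys (monomial_U n r) \<union> Poly_Mapping.keys (Poly_Mapping.single (U n) (r n))"
    unfolding monomial_U_def sum.lessThan_Suc by (rule Poly_Mapping.keys_add)
  also have "\<dots> \<subseteq> U ` {..<n} \<union> {U n}"
    using Suc by (intro Un_mono) simp_all
  finally show ?case by (simp add: lessThan_Suc)
qed (simp add: monomial_U_def)

lemma mcoeff_prod_U:
  fixes c :: "nat \<Rightarrow> nat \<Rightarrow> 'a::ring_1"
  shows "mcoeff (prod_list (map (\<lambda>k. mseries (U k) (c k)) [0..<n])) (monomial_U n r) =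
    prod_list (map (\<lambda>k. c k (r k)) [0..<n])"
proof (induction n)
  case 0
  then show ?case by (simp add: monomial_U_def one_mfps_def)
next
  case (Suc n)
  let ?f = "prod_list (map (\<lambda>k. mseries (U k) (c k)) [0..<n])"
  have sup: "supported_on (U ` {..<n}) ?f"
    by (intro supported_on_prod_list supported_on_mseries) auto
  have "mcoeff (mconv (*) ?f (mseries (U n) (c n))) (monomial_U n r + Poly_Mapping.single (U n) (r n)) =
      mcoeff ?f (monomial_U n r) * mcoeff (mseries (U n) (c n)) (Poly_Mapping.single (U n) (r n))"
    by (rule mcoeff_mconv_disjoint[where Y = "U ` {..<n}" and Z = "{U n}"])
      (use sup keys_monomial_U in \<open>auto simp: supported_on_def dest: keys_mseries\<close>)
  then have "mcoeff (?f * mseries (U n) (c n)) (monomial_U (Suc n) r) =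
      prod_list (map (\<lambda>k. c k (r k)) [0..<n]) * c n (r n)"
    by (simp only: Suc times_mfps_def mcoeff_mseries_single) (simp add: monomial_U_def)
  then show ?case by simp
qed

lemma mseries_fps_times:
  fixes f g :: "'a::ring_1 fps" and x :: 'x
  shows "mseries x (fps_nth f) * mseries x (fps_nth g) = mseries x (fps_nth (f * g))"
proof (rule mfps_eqI)
  fix e :: "'x \<Rightarrow>\<^sub>0 nat"
  have sup: "supported_on {x} (mseries x (fps_nth f) * mseries x (fps_nth g))"
    by (intro supported_on_times supported_on_mseries) simp_all
  show "mcoeff (mseries x (fps_nth f) * mseries x (fps_nth g)) e = mcoeff (mseries x (fps_nth (f * g))) e"
  proof (cases "Poly_Mapping.keys e \<subseteq> {x}")
    case False
    with sup have "mcoeff (mseries x (fps_nth f) * mseries x (fps_nth g)) e = 0"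
      by (auto simp: supported_on_def)
    with False show ?thesis by (simp add: mseries_def)
  next
    case True
    define b where "b = Poly_Mapping.lookup e x"
    have e: "e = Poly_Mapping.single x b" unfolding b_def by (rule keys_subset_single[OF True])
    let ?F = "\<lambda>(p, q). mcoeff (mseries x (fps_nth f)) p * mcoeff (mseries x (fps_nth g)) q"
    let ?s = "\<lambda>i. (Poly_Mapping.single x i, Poly_Mapping.single x (b - i))"
    have inj: "inj_on ?s {0..b}"
      by (rule inj_onI) (metis fst_conv lookup_single_eq)
    have "mcoeff (mseries x (fps_nth f) * mseries x (fps_nth g)) e = sum ?F {(p, q). p + q = e}"
      by (rule mcoeff_mult)
    also have "\<dots> = sum ?F (?s ` {0..b})"
    proof (rule sum.mono_neutral_right)
      show "finite {(p, q). p + q = e}" by (rule finite_monomial_splits)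
      show "?s ` {0..b} \<subseteq> {(p, q). p + q = e}" by (auto simp: e simp flip: single_add)
      show "\<forall>pq\<in>{(p, q). p + q = e} - ?s ` {0..b}. ?F pq = 0"
      proof
        fix pq assume pq: "pq \<in> {(p, q). p + q = e} - ?s ` {0..b}"
        obtain p q where [simp]: "pq = (p, q)" by (cases pq)
        have sum: "p + q = e" using pq by simp
        then have "Poly_Mapping.lookup p x + Poly_Mapping.lookup q x = b" by (simp add: b_def flip: sum lookup_add)
        then have le: "Poly_Mapping.lookup p x \<in> {0..b}" "Poly_Mapping.lookup q x = b - Poly_Mapping.lookup p x" by auto
        show "?F pq = 0"
        proof (rule ccontr)
          assume "?F pq \<noteq> 0"
          then have "Poly_Mapping.keys p \<subseteq> {x}" "Poly_Mapping.keys q \<subseteq> {x}"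
            by (auto dest!: keys_mseries simp: mseries_def split: if_splits)
          then have "p = Poly_Mapping.single x (Poly_Mapping.lookup p x)" "q = Poly_Mapping.single x (Poly_Mapping.lookup q x)"
            by (auto dest: keys_subset_single)
          then have "pq = ?s (Poly_Mapping.lookup p x)" using le(2) by simp
          with pq le(1) show False by blast
        qed
      qed
    qed
    also have "\<dots> = (\<Sum>i=0..b. f $ i * g $ (b - i))"
      by (subst sum.reindex[OF inj]) simp
    also have "\<dots> = mcoeff (mseries x (fps_nth (f * g))) e"
      by (simp add: e fps_mult_nth)
    finally show ?thesis .
  qed
qed

lemma prod_list_mseries_fps:
  fixes f :: "'k \<Rightarrow> 'a::ring_1 fps" and x :: 'x
  shows "prod_list (map (\<lambda>k. mseries x (fps_nth (f k))) ks) = mseries x (fps_nth (prod_list (map f ks)))"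
proof (induction ks)
  case Nil
  have "mseries x (fps_nth (1 :: 'a fps)) = 1"
  proof (rule mfps_eqI)
    fix e :: "'x \<Rightarrow>\<^sub>0 nat"
    have "e = 0" if "Poly_Mapping.keys e \<subseteq> {x}" "Poly_Mapping.lookup e x = 0"
      using keys_subset_single[OF that(1)] that(2) by simp
    then show "mcoeff (mseries x (fps_nth (1 :: 'a fps))) e = mcoeff 1 e"
      by (auto simp: mseries_def one_mfps_def mconst_def)
  qed
  then show ?case by (simp only: list.map prod_list.Nil)
next
  case (Cons k ks)
  then show ?case by (simp only: list.map prod_list.Cons mseries_fps_times)
qed

lemma supported_fused: "supported_on {V 0} (fused I J)"
  unfolding fused_def shifted_L_def by (intro supported_on_prod_list supported_on_mseries) simp

lemma Lbar_nth:
  "(Lbar :: 'n::finite RA fps) $ b = (\<Sum>I\<in>idx CARD('n). mcoeff (fused I I) (Poly_Mapping.single (V 0) b))"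
proof -
  have L: "(Lbar :: 'n RA fps) = (\<Sum>I\<in>idx CARD('n). prod_list (map (\<lambda>k. Abs_fps (lshift_coeff k (I ! k) (I ! k))) [0..<CARD('n)]))"
    unfolding Lbar_def ttrace_def by (intro sum.cong refl tprod_leg)
  have C: "mcoeff (fused I I) (Poly_Mapping.single (V 0) b) =
      prod_list (map (\<lambda>k. Abs_fps (lshift_coeff k (I ! k) (I ! k))) [0..<CARD('n)]) $ b" for I :: "'n list"
  proof -
    have "fused I I = prod_list (map (\<lambda>k. mseries (V 0) (fps_nth (Abs_fps (lshift_coeff k (I ! k) (I ! k))))) [0..<CARD('n)])"
    proof -
      have "fps_nth (Abs_fps f) = f" for f :: "nat \<Rightarrow> 'n RA" by (rule ext) simp
      then show ?thesis unfolding fused_def shifted_L_def by (simp only:)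
    qed
    then show ?thesis by (simp only: prod_list_mseries_fps mcoeff_mseries_single)
  qed
  show ?thesis unfolding L fps_sum_nth C ..
qed

text \<open>
  The first factor contains only the \<open>u\<^sub>i\<close> and the second one only \<open>v\<close>, so no coefficients mix.
\<close>

lemma mcoeff_fused_pair:
  fixes I J :: "'n::finite list" and I' J' :: "'n list"
  assumes I: "I \<in> idx n" and J: "J \<in> idx n"
  shows "mcoeff (fused_pair n (I @ I') (J @ J')) (monomial_U n r + Poly_Mapping.single (V 0) b) =
    prod_list (map (\<lambda>k. lgen (r k) (I ! k) (J ! k)) [0..<n]) \<otimes>\<^sub>h mcoeff (fused I' J') (Poly_Mapping.single (V 0) b)"
proof -
  have len: "length I = n" "length J = n" using I J by (simp_all add: idx_def)
  have L: "Lprod n U I J = prod_list (map (\<lambda>k. mseries (U k) (\<lambda>s. lgen s (I ! k) (J ! k))) [0..<n])"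
    unfolding Lprod_def by (rule tprod_leg[OF I J])
  have sup: "supported_on (U ` {..<n}) (Lprod n U I J)"
    unfolding L by (intro supported_on_prod_list supported_on_mseries) auto
  have "mcoeff (fused_pair n (I @ I') (J @ J')) (monomial_U n r + Poly_Mapping.single (V 0) b) =
      mcoeff (Lprod n U I J) (monomial_U n r) \<otimes>\<^sub>h mcoeff (fused I' J') (Poly_Mapping.single (V 0) b)"
  proof -
    have td: "take n (I @ I') = I" "drop n (I @ I') = I'" "take n (J @ J') = J" "drop n (J @ J') = J'"
      using len by simp_all
    show ?thesis
      unfolding fused_pair_def td
    proof (rule mcoeff_mconv_disjoint[where Y = "U ` {..<n}" and Z = "{V 0}"])
      show "mcoeff (Lprod n U I J) a \<noteq> 0 \<Longrightarrow> Poly_Mapping.keys a \<subseteq> U ` {..<n}" for a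
        using sup unfolding supported_on_def by blast
      show "mcoeff (fused I' J') a \<noteq> 0 \<Longrightarrow> Poly_Mapping.keys a \<subseteq> {V 0}" for a
        using supported_fused[of I' J'] unfolding supported_on_def by blast
      show "Poly_Mapping.keys (monomial_U n r) \<subseteq> U ` {..<n}" by (rule keys_monomial_U)
    qed (auto simp: hlinear_zero[OF hbilinearD(1)[OF hbilinear_ctens]] hlinear_zero[OF hbilinearD(2)[OF hbilinear_ctens]])
  qed
  then show ?thesis unfolding L mcoeff_prod_U .
qed

text \<open>
  A nonempty word is a coefficient of an entry of \<open>L\<^sub>1(u\<^sub>1) \<cdots> L\<^sub>n(u\<^sub>n)\<close>. The empty word is the
  vacuum, on which \<open>S\<close> is prescribed separately.
\<close>

lemma braiding_word:
  fixes S :: "('n::finite RA, 'n RA) ctensor \<Rightarrow> (('n RA, 'n RA) ctensor, zh) ctensor"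
  assumes S: "is_braiding S"
  shows "S (prod_list (map (\<lambda>(r, i, j). lgen r i j) w) \<otimes>\<^sub>h (Lbar $ b)) =
    (prod_list (map (\<lambda>(r, i, j). lgen r i j) w) \<otimes>\<^sub>h (Lbar $ b)) \<otimes>\<^sub>h 1"
proof (cases "w = []")
  case True
  with S show ?thesis by (simp add: is_braiding_def)
next
  case False
  let ?n = "length w"
  let ?I = "map (\<lambda>(r, i, j). i) w" and ?J = "map (\<lambda>(r, i, j). j) w"
  let ?a = "prod_list (map (\<lambda>(r, i, j). lgen r i j) w)"
  have lin: "hlinear S" using S by (simp add: is_braiding_def)
  have word: "prod_list (map (\<lambda>k. lgen (fst (w ! k)) (?I ! k) (?J ! k)) [0..<?n]) = ?a"
    by (rule arg_cong[of _ _ prod_list], rule nth_equalityI) (auto simp: case_prod_unfold)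
  have "S (?a \<otimes>\<^sub>h mcoeff (fused K K) (Poly_Mapping.single (V 0) b)) =
      (?a \<otimes>\<^sub>h mcoeff (fused K K) (Poly_Mapping.single (V 0) b)) \<otimes>\<^sub>h 1" if K: "K \<in> idx CARD('n)" for K
  proof -
    have "?I \<in> idx ?n" "?J \<in> idx ?n" by (simp_all add: idx_def)
    from mcoeff_fused_pair[OF this, of K K "\<lambda>k. fst (w ! k)" b]
    have "mcoeff (fused_pair ?n (?I @ K) (?J @ K)) (monomial_U ?n (\<lambda>k. fst (w ! k)) + Poly_Mapping.single (V 0) b) =
        ?a \<otimes>\<^sub>h mcoeff (fused K K) (Poly_Mapping.single (V 0) b)"
      unfolding word .
    moreover have "?n \<ge> 1" "?I @ K \<in> idx (?n + CARD('n))" "?J @ K \<in> idx (?n + CARD('n))"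
      using False K by (simp_all add: idx_def Suc_le_eq)
    ultimately show ?thesis using braiding_fused_pair[OF S] by metis
  qed
  then show ?thesis
    unfolding Lbar_nth hlinear_sum[OF hbilinearD(1)[OF hbilinear_ctens]] hlinear_sum[OF lin]
      hlinear_sum[OF hbilinearD(2)[OF hbilinear_ctens]]
    by (intro sum.cong refl)
qed

section \<open>Words span a dense subspace\<close>

text \<open>
  Modulo \<open>h\<^sup>K\<close>, every element of \<open>A(R\<^sup>-)\<close> is a finite \<open>\<complex>[[h]]\<close>-linear combination of words.
\<close>

lemma hlinear_zero_on_words:
  fixes D :: "'n::finite RA \<Rightarrow> 'a::hmodule"
  assumes D: "hlinear D" and sep: "hseparated TYPE('a)"
    and words: "\<And>w. D (prod_list (map (\<lambda>(r, i, j). lgen r i j) w)) = 0"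
  shows "D a = 0"
proof -
  let ?D = "\<lambda>x. D (abs_RA x)"
  have lin: "hlinear ?D"
    unfolding hlinear_def
    by (simp add: hlinear_add[OF D] hlinear_add[OF hlinear_abs_RA] hlinear_hscale[OF D] hlinear_hscale[OF hlinear_abs_RA])
  have const_add: "?D (fps_const (p + q)) = ?D (fps_const p) + ?D (fps_const q)" for p q
    using hlinear_add[OF lin, of "fps_const p" "fps_const q"] by simp
  have word: "abs_RA (fps_const (Poly_Mapping.single (Lword gs) 1)) =
      prod_list (map (\<lambda>(r, i, j). lgen r i j) (map (\<lambda>g. case g of Gen r i j \<Rightarrow> (r, i, j)) gs))" for gs :: "'n gen list"
  proof (induction gs)
    case Nil
    have "Poly_Mapping.single (Lword []) (1 :: complex) = (1 :: 'n free_alg)"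
      unfolding zero_lword_def[symmetric] by (rule single_one)
    then show ?case by (simp add: one_RA_def)
  next
    case (Cons g gs)
    obtain r i j where g: "g = Gen r i j" by (cases g)
    have "Poly_Mapping.single (Lword (g # gs)) 1 = fgen r i j * Poly_Mapping.single (Lword gs) (1 :: complex)"
      by (simp add: fgen_def g mult_single)
    then have "abs_RA (fps_const (Poly_Mapping.single (Lword (g # gs)) 1)) =
        lgen r i j * abs_RA (fps_const (Poly_Mapping.single (Lword gs) 1))"
      by (simp add: lgen.abs_eq times_RA.abs_eq)
    then show ?case by (simp add: Cons g)
  qed
  have single: "?D (fps_const (Poly_Mapping.single l c)) = 0" for l c
  proof -
    obtain gs where l: "l = Lword gs" by (cases l)
    have "fps_const (Poly_Mapping.single l c) = (fps_const c * fps_X ^ 0) *\<^sub>h fps_const (Poly_Mapping.single l 1)"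
      by (rule fps_ext) (simp only: hscale_monomial_nth, simp add: free_alg_cscale mult_single)
    then have "?D (fps_const (Poly_Mapping.single l c)) = (fps_const c * fps_X ^ 0) *\<^sub>h ?D (fps_const (Poly_Mapping.single l 1))"
      by (simp only: hlinear_hscale[OF lin])
    then show ?thesis unfolding l word words by simp
  qed
  have const: "?D (fps_const p) = 0" for p
  proof (induction p rule: update_induct)
    case const
    then show ?case using hlinear_zero[OF lin] by simp
  next
    case (update f a b)
    have "Poly_Mapping.update a b f = f + Poly_Mapping.single a b"
      using update by (intro update_eq_add) simp
    then show ?case using update by (simp add: const_add single)
  qed
  obtain x where a: "a = abs_RA x"
    using Quotient3_abs_rep[OF Quotient3_RA, of a] by metis
  have "hcong K (?D x) 0" for K
  proof -
    let ?y = "\<Sum>s<K. (fps_const 1 * fps_X ^ s) *\<^sub>h fps_const (x $ s)"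
    have "?y $ k = x $ k" if "k < K" for k
      using that by (simp only: fps_sum_nth hscale_monomial_nth) (simp add: cscale_one)
    then have "hcong K x ?y" by (simp only: hcong_fps_iff) simp
    then have "hcong K (?D x) (?D ?y)" by (rule hlinear_hcong[OF lin])
    also have "?D ?y = 0" by (simp only: hlinear_sum[OF lin] hlinear_hscale[OF lin] const hscale_zero_right) simp
    finally show ?thesis .
  qed
  then show ?thesis unfolding a by (rule hseparatedD[OF sep])
qed

theorem theorem6p3:
  fixes S :: "('n::finite RA, 'n RA) ctensor \<Rightarrow> (('n RA, 'n RA) ctensor, zh) ctensor"
    and a :: "'n RA"
  assumes "CARD('n) \<ge> 2"
    and "is_braiding S"
  shows "\<forall>b. S (a \<otimes>\<^sub>h (Lbar $ b)) = (a \<otimes>\<^sub>h (Lbar $ b)) \<otimes>\<^sub>h 1"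
proof
  fix b
  have lin: "hlinear S" using assms(2) by (simp add: is_braiding_def)
  note left = hbilinearD(2)[OF hbilinear_ctens]
  let ?D = "\<lambda>a. S (a \<otimes>\<^sub>h (Lbar $ b)) - (a \<otimes>\<^sub>h (Lbar $ b)) \<otimes>\<^sub>h 1"
  have "hlinear ?D"
    unfolding hlinear_def
    by (simp add: hlinear_add[OF left] hlinear_add[OF lin] hlinear_hscale[OF left] hlinear_hscale[OF lin] hscale_diff_right)
  then have "?D a = 0"
    by (rule hlinear_zero_on_words[OF _ hseparated_hcompl]) (simp add: braiding_word[OF assms(2)])
  then show "S (a \<otimes>\<^sub>h (Lbar $ b)) = (a \<otimes>\<^sub>h (Lbar $ b)) \<otimes>\<^sub>h 1" by simp
qed

end
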